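(* Let $k > 0$ and $X_k = \{A\subseteq\{0,1\}^* \mid \Sigma_k^{\mathrm{P},A} = \Pi_k^{\mathrm{P},A}\}$. If $X_k$ has $\mathrm{p}_2$-betting-game measure zero, then $\Sigma_k^{\mathrm{P}} \neq \mathrm{EXP}$.
   Context: $\Sigma_k^{\mathrm{P},A},\Pi_k^{\mathrm{P},A}$ denote the $k$-th levels of the polynomial-time hierarchy relative to oracle $A$; $\mathrm{EXP}=\mathrm{DTIME}(2^{n^{O(1)}})$. A betting game $G$ is an oracle Turing machine with a capital tape and a bet tape that works in rounds $i=1,2,\dots$: at the start of round $i$ the capital tape holds a nonnegative rational $C_{i-1}$ (with $C_0>0$ rational); $G$ computes a string $x_i$ not among the previously chosen $x_1,\dots,x_{i-1}$, a bet amount $0\le B_i\le C_{i-1}$ and a sign $b_i\in\{-1,+1\}$; then for the oracle language $A$, the new capital is $C_i=C_{i-1}+B_i$ if ($x_i\in A$ and $b_i=+1$) or ($x_i\notin A$ and $b_i=-1$), and $C_i=C_{i-1}-B_i$ otherwise (the machine is charged for writing the new capital). $G$ succeeds on $A$ if $\sup_i C_i=\infty$ when playing against $A$. $G$ runs in time $t(2^n)$ if for every language $A$, every string of length $n$ chosen by $G$ is chosen within the first $t(2^n)$ steps of the computation. A $\mathrm{p}_2$-betting game is one running in time $t(N)=2^{(\log N)^{O(1)}}$. A class $X$ of languages has $\mathrm{p}_2$-betting-game measure 0 if some $\mathrm{p}_2$-betting game succeeds on every language in $X$. *)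

theory Defs
  imports Complex_Main
begin

type_synonym language = "bool list set"

section \<open>Multi-tape oracle Turing machines\<close>

datatype symbol = Blank | Bit bool | Sep | Sym nat

datatype state = Start | Accept | Reject | Query | Yes | No | Work nat

datatype direction = Lft | Stay | Rgt

text \<open>Tapes are infinite in both directions; a tape is its contents with the head position.\<close>

type_synonym tape = "(int \<Rightarrow> symbol) \<times> int"

type_synonym action = "state \<times> (symbol \<times> direction) list"

record machine =
  tape_count :: nat
  states :: "state set"
  alphabet :: "symbol set"
  delta :: "state \<Rightarrow> symbol list \<Rightarrow> action set"

record config =
  state :: state
  tapes :: "tape list"

text \<open>Tape 1 is the query tape of every machine. The values of \<^term>\<open>delta M\<close> outside
  the finite domain \<^term>\<open>states M\<close>, \<^term>\<open>alphabet M\<close> never matter for a well-formed machine.\<close>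

definition wf_machine :: "'a machine_scheme \<Rightarrow> bool" where
  "wf_machine M \<longleftrightarrow>
     finite (states M) \<and> {Start, Accept, Reject, Query, Yes, No} \<subseteq> states M \<and>
     finite (alphabet M) \<and> {Blank, Bit False, Bit True, Sep} \<subseteq> alphabet M \<and>
     2 \<le> tape_count M \<and>
     (\<forall>q\<in>states M. \<forall>ss. length ss = tape_count M \<and> set ss \<subseteq> alphabet M \<longrightarrow>
        (\<forall>(q', ws)\<in>delta M q ss.
           q' \<in> states M \<and> length ws = tape_count M \<and> fst ` set ws \<subseteq> alphabet M))"

definition deterministic :: "'a machine_scheme \<Rightarrow> bool" where
  "deterministic M \<longleftrightarrow>
     (\<forall>q\<in>states M. \<forall>ss. length ss = tape_count M \<and> set ss \<subseteq> alphabet M \<longrightarrow>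
        (\<forall>a\<in>delta M q ss. \<forall>a'\<in>delta M q ss. a = a'))"

definition oracle_free :: "'a machine_scheme \<Rightarrow> bool" where
  "oracle_free M \<longleftrightarrow>
     (\<forall>q\<in>states M. \<forall>ss. length ss = tape_count M \<and> set ss \<subseteq> alphabet M \<longrightarrow>
        (\<forall>(q', ws)\<in>delta M q ss. q' \<noteq> Query))"

fun shift :: "direction \<Rightarrow> int \<Rightarrow> int" where
  "shift Lft i = i - 1"
| "shift Stay i = i"
| "shift Rgt i = i + 1"

definition scanned :: "tape \<Rightarrow> symbol" where
  "scanned t = fst t (snd t)"

definition update_tape :: "symbol \<times> direction \<Rightarrow> tape \<Rightarrow> tape" where
  "update_tape w t = ((fst t)(snd t := fst w), shift (snd w) (snd t))"

definition perform :: "action \<Rightarrow> 'c config_scheme \<Rightarrow> 'c config_scheme" where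
  "perform a c = c\<lparr>state := fst a, tapes := map2 update_tape (snd a) (tapes c)\<rparr>"

definition moves :: "'a machine_scheme \<Rightarrow> 'c config_scheme \<Rightarrow> 'c config_scheme set" where
  "moves M c = (if state c \<in> {Query, Accept, Reject} then {}
     else (\<lambda>a. perform a c) ` delta M (state c) (map scanned (tapes c)))"

definition tape_of :: "symbol list \<Rightarrow> tape" where
  "tape_of ss = ((\<lambda>i. if 0 \<le> i \<and> i < int (length ss) then ss ! nat i else Blank), 0)"

abbreviation blank_tape :: tape where
  "blank_tape \<equiv> tape_of []"

text \<open>The longest block of symbols satisfying \<open>P\<close> that starts in cell 0. Every tape occurring in a
  computation has only finitely many nonblank cells, so the minimum exists.\<close>

definition block :: "(symbol \<Rightarrow> bool) \<Rightarrow> tape \<Rightarrow> symbol list" where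
  "block P t = map (\<lambda>i. fst t (int i)) [0..<(LEAST n. \<not> P (fst t (int n)))]"

definition tape_contents :: "tape \<Rightarrow> symbol list" where
  "tape_contents t = block (\<lambda>s. s \<noteq> Blank) t"

definition tape_word :: "tape \<Rightarrow> bool list" where
  "tape_word t = map (\<lambda>s. s = Bit True) (block (\<lambda>s. s \<in> range Bit) t)"

definition query_word :: "'c config_scheme \<Rightarrow> bool list" where
  "query_word c = tape_word (tapes c ! 1)"

definition answer :: "language \<Rightarrow> 'c config_scheme \<Rightarrow> 'c config_scheme" where
  "answer A c = c\<lparr>state := (if query_word c \<in> A then Yes else No),
                  tapes := (tapes c)[1 := blank_tape]\<rparr>"

definition oracle_step :: "language \<Rightarrow> machine \<Rightarrow> config \<Rightarrow> config \<Rightarrow> bool" where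
  "oracle_step A M c c' \<longleftrightarrow> (if state c = Query then c' = answer A c else c' \<in> moves M c)"

definition input_config :: "machine \<Rightarrow> bool list \<Rightarrow> config" where
  "input_config M x = \<lparr>state = Start,
     tapes = tape_of (map Bit x) # replicate (tape_count M - 1) blank_tape\<rparr>"

text \<open>Every computation path on inputs of length \<open>n\<close> has at most \<open>T n\<close> steps, and an input is
  accepted iff some path reaches the accepting state.\<close>

definition decides_in_time ::
    "language \<Rightarrow> machine \<Rightarrow> language \<Rightarrow> (nat \<Rightarrow> nat) \<Rightarrow> bool" where
  "decides_in_time A M L T \<longleftrightarrow>
     (\<forall>x. (\<forall>m c. (oracle_step A M ^^ m) (input_config M x) c \<longrightarrow> m \<le> T (length x)) \<and>
          (x \<in> L \<longleftrightarrow> (\<exists>c. (oracle_step A M)\<^sup>*\<^sup>* (input_config M x) c \<and> state c = Accept)))"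


section \<open>Complexity classes\<close>

definition P_class :: "language \<Rightarrow> language set" where
  "P_class A = {L. \<exists>M c. wf_machine M \<and> deterministic M \<and>
                         decides_in_time A M L (\<lambda>n. n ^ c + c)}"

definition NP_class :: "language \<Rightarrow> language set" where
  "NP_class A = {L. \<exists>M c. wf_machine M \<and> decides_in_time A M L (\<lambda>n. n ^ c + c)}"

definition EXP :: "language set" where
  "EXP = {L. \<exists>M c. wf_machine M \<and> deterministic M \<and> oracle_free M \<and>
                   decides_in_time {} M L (\<lambda>n. 2 ^ (n ^ c + c))}"

text \<open>The unrelativized levels are those relative to the empty oracle.\<close>

fun Sigma_P :: "nat \<Rightarrow> language \<Rightarrow> language set" where
  "Sigma_P 0 A = P_class A"
| "Sigma_P (Suc k) A = (\<Union>B\<in>Sigma_P k A. NP_class B)"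

definition Pi_P :: "nat \<Rightarrow> language \<Rightarrow> language set" where
  "Pi_P k A = {- L | L. L \<in> Sigma_P k A}"


section \<open>Betting games\<close>

text \<open>Tape 0 is the capital tape and tape 2 the bet tape. A rational is written as numerator,
  separator, denominator in binary, least significant bit first; the capital is in lowest terms.
  The bet tape holds a sign bit (\<^const>\<open>True\<close> for +1) followed by the amount.\<close>

record betting_game = machine +
  initial_capital :: rat

record game_config = config +
  capital :: rat
  elapsed :: nat

fun binary :: "nat \<Rightarrow> bool list" where
  "binary n = (if n = 0 then [] else odd n # binary (n div 2))"

declare binary.simps [simp del]

definition rat_symbols :: "rat \<Rightarrow> symbol list" where
  "rat_symbols r = (case quotient_of r of (p, q) \<Rightarrow>
     map Bit (binary (nat p)) @ Sep # map Bit (binary (nat q)))"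

definition nat_of_symbols :: "symbol list \<Rightarrow> nat" where
  "nat_of_symbols ss = horner_sum (\<lambda>s. of_bool (s = Bit True)) 2 ss"

definition rat_of_symbols :: "symbol list \<Rightarrow> rat" where
  "rat_of_symbols ss =
     of_nat (nat_of_symbols (takeWhile (\<lambda>s. s \<noteq> Sep) ss)) /
     of_nat (nat_of_symbols (tl (dropWhile (\<lambda>s. s \<noteq> Sep) ss)))"

definition bet_well_formed :: "game_config \<Rightarrow> bool" where
  "bet_well_formed c \<longleftrightarrow>
     (\<exists>b ns ds. tape_contents (tapes c ! 2) = Bit b # map Bit ns @ Sep # map Bit ds \<and>
                nat_of_symbols (map Bit ds) > 0)"

definition bet_sign :: "game_config \<Rightarrow> bool" where
  "bet_sign c \<longleftrightarrow> hd (tape_contents (tapes c ! 2)) = Bit True"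

definition bet_amount :: "game_config \<Rightarrow> rat" where
  "bet_amount c = rat_of_symbols (tl (tape_contents (tapes c ! 2)))"

definition new_capital :: "language \<Rightarrow> game_config \<Rightarrow> rat" where
  "new_capital A c =
     (if query_word c \<in> A \<and> bet_sign c \<or> query_word c \<notin> A \<and> \<not> bet_sign c
      then capital c + bet_amount c else capital c - bet_amount c)"

text \<open>Entering the query state ends a round. The machine learns the answer, the new capital is
  written on the capital tape and its length charged, and the query and bet tapes are blanked.
  The actual capital is the field \<^const>\<open>capital\<close>, so overwriting the capital tape has no
  effect on it.\<close>

definition settle :: "language \<Rightarrow> game_config \<Rightarrow> game_config" where
  "settle A c = (let C = new_capital A c in
     (answer A c)\<lparr>tapes := (tapes c)[0 := tape_of (rat_symbols C), 1 := blank_tape, 2 := blank_tape],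
                  capital := C,
                  elapsed := elapsed c + 1 + length (rat_symbols C)\<rparr>)"

text \<open>A game that halts stays in its last configuration and makes no further bets.\<close>

definition game_step :: "language \<Rightarrow> betting_game \<Rightarrow> game_config \<Rightarrow> game_config" where
  "game_step A G c =
     (if state c = Query then settle A c
      else if moves G c = {} then c
      else (the_elem (moves G c))\<lparr>elapsed := elapsed c + 1\<rparr>)"

definition game_start :: "betting_game \<Rightarrow> game_config" where
  "game_start G = \<lparr>state = Start,
     tapes = tape_of (rat_symbols (initial_capital G)) # replicate (tape_count G - 1) blank_tape,
     capital = initial_capital G, elapsed = 0\<rparr>"

definition play :: "language \<Rightarrow> betting_game \<Rightarrow> nat \<Rightarrow> game_config" where
  "play A G m = (game_step A G ^^ m) (game_start G)"

definition is_betting_game :: "betting_game \<Rightarrow> bool" where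
  "is_betting_game G \<longleftrightarrow>
     wf_machine G \<and> deterministic G \<and> 3 \<le> tape_count G \<and> initial_capital G > 0 \<and>
     (\<forall>A m. state (play A G m) = Query \<longrightarrow>
        bet_well_formed (play A G m) \<and>
        0 \<le> bet_amount (play A G m) \<and> bet_amount (play A G m) \<le> capital (play A G m) \<and>
        (\<forall>m'<m. state (play A G m') = Query \<longrightarrow>
                query_word (play A G m') \<noteq> query_word (play A G m)))"

definition succeeds_on :: "betting_game \<Rightarrow> language \<Rightarrow> bool" where
  "succeeds_on G A \<longleftrightarrow> \<not> bdd_above (range (\<lambda>m. capital (play A G m)))"

text \<open>Time \<open>t(2\<^sup>n)\<close>.\<close>

definition runs_in_time :: "betting_game \<Rightarrow> (nat \<Rightarrow> nat) \<Rightarrow> bool" where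
  "runs_in_time G t \<longleftrightarrow>
     (\<forall>A m. state (play A G m) = Query \<longrightarrow>
        elapsed (play A G m) \<le> t (2 ^ length (query_word (play A G m))))"

definition p2_bounded :: "(nat \<Rightarrow> nat) \<Rightarrow> bool" where
  "p2_bounded t \<longleftrightarrow>
     (\<exists>c::nat. \<forall>N\<ge>1. real (t N) \<le> 2 powr (log 2 (real N) ^ c + real c))"

definition p2_betting_game :: "betting_game \<Rightarrow> bool" where
  "p2_betting_game G \<longleftrightarrow> is_betting_game G \<and> (\<exists>t. p2_bounded t \<and> runs_in_time G t)"

definition p2_betting_game_measure_zero :: "language set \<Rightarrow> bool" where
  "p2_betting_game_measure_zero X \<longleftrightarrow> (\<exists>G. p2_betting_game G \<and> (\<forall>A\<in>X. succeeds_on G A))"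

end

theory Submission
  imports Defs "HOL-Library.Countable_Set" "HOL-Library.More_List"
begin

text \<open>Suppose \<open>Sigma_P k {} = EXP\<close>. For a language \<open>A\<close> in EXP, \<open>Sigma_P k A\<close> lies between
  \<open>Sigma_P k {}\<close> and EXP, by exhaustive simulation, so it equals EXP and is closed under
  complement. Hence a betting game that succeeds on all \<open>A\<close> with \<open>Sigma_P k A = Pi_P k A\<close> succeeds
  on all of EXP. But the language that answers each query of the game so that the bet is lost is
  itself in EXP: a string of length \<open>n\<close> is queried within the first \<open>t (2 ^ n)\<close> steps or not at
  all, so it suffices to simulate the game for that long.

  Membership in EXP is reduced to polynomial time on inputs padded in unary. Polynomial-time
  functions operate on binary trees, kept in prefix notation on a stack, and are closed under
  iteration as long as the intermediate results stay polynomially bounded.\<close>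
section \<open>Structured programs for multi-tape machines\<close>

datatype com =
    Act "symbol list \<Rightarrow> (symbol \<times> direction) list"
  | Seq com com (infixl \<open>;;\<close> 60)
  | Cond "symbol list \<Rightarrow> bool" com com
  | Loop "symbol list \<Rightarrow> bool" com

definition stay :: "symbol list \<Rightarrow> (symbol \<times> direction) list" where
  "stay ss = map (\<lambda>s. (s, Stay)) ss"

fun successor :: "com \<Rightarrow> com list \<Rightarrow> symbol list \<Rightarrow> com list \<times> (symbol \<times> direction) list" where
  "successor (Act f) k ss = (k, f ss)"
| "successor (a ;; b) k ss = (a # b # k, stay ss)"
| "successor (Cond P a b) k ss = ((if P ss then a else b) # k, stay ss)"
| "successor (Loop P a) k ss = (if P ss then a # Loop P a # k else k, stay ss)"

inductive com_step :: "com list \<times> tape list \<Rightarrow> com list \<times> tape list \<Rightarrow> bool" where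
  com_stepI: "successor c k (map scanned ts) = (k', ws) \<Longrightarrow>
    com_step (c # k, ts) (k', map2 update_tape ws ts)"

definition com_steps :: "nat \<Rightarrow> com list \<times> tape list \<Rightarrow> com list \<times> tape list \<Rightarrow> bool" where
  "com_steps n x y \<longleftrightarrow> (\<exists>m\<le>n. (com_step ^^ m) x y)"

text \<open>A stack occupies the cells to the right of the head; what is to the left of the head is
  irrelevant, so popping need not erase anything.\<close>

definition holds_stack :: "tape \<Rightarrow> symbol list \<Rightarrow> bool" where
  "holds_stack t xs \<longleftrightarrow> Blank \<notin> set xs \<and>
     (\<forall>i. fst t (snd t + int i) = (if i < length xs then xs ! i else Blank))"

definition top_symbol :: "symbol list \<Rightarrow> symbol" where
  "top_symbol xs = (case xs of [] \<Rightarrow> Blank | x # _ \<Rightarrow> x)"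

definition exec :: "nat \<Rightarrow> com \<Rightarrow> symbol list list \<Rightarrow> symbol list list \<Rightarrow> bool" where
  "exec n c s s' \<longleftrightarrow> (\<forall>ts k. list_all2 holds_stack ts s \<longrightarrow>
     (\<exists>ts'. com_steps n (c # k, ts) (k, ts') \<and> list_all2 holds_stack ts' s'))"

lemma top_symbol_simps [simp]: "top_symbol [] = Blank" "top_symbol (x # xs) = x"
  by (simp_all add: top_symbol_def)

lemma com_steps_mono: "com_steps m x y \<Longrightarrow> m \<le> n \<Longrightarrow> com_steps n x y"
  unfolding com_steps_def using le_trans by blast

lemma com_steps_step: "com_step x y \<Longrightarrow> com_steps n y z \<Longrightarrow> com_steps (Suc n) x z"
  unfolding com_steps_def by (meson Suc_le_mono relpowp_Suc_I2)

lemma com_steps_refl: "com_steps n x x"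
  unfolding com_steps_def by (intro exI[of _ 0]) simp

lemma com_steps_trans: "com_steps m x y \<Longrightarrow> com_steps n y z \<Longrightarrow> com_steps (m + n) x z"
  unfolding com_steps_def by (meson add_mono relpowp_trans)

lemma map2_stay [simp]: "map2 update_tape (stay (map scanned ts)) ts = ts"
  by (rule nth_equalityI)
     (auto simp: stay_def update_tape_def scanned_def prod_eq_iff)

lemma map2_stay_update:
  "i < length ts \<Longrightarrow>
   map2 update_tape ((stay (map scanned ts))[i := w]) ts = ts[i := update_tape w (ts ! i)]"
  by (rule nth_equalityI)
     (auto simp: stay_def update_tape_def scanned_def prod_eq_iff nth_list_update)

lemma scanned_stack: "holds_stack t xs \<Longrightarrow> scanned t = top_symbol xs"
  unfolding holds_stack_def scanned_def top_symbol_def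
  by (auto dest!: spec[of _ 0] split: list.splits)

lemma scanned_stacks: "list_all2 holds_stack ts s \<Longrightarrow> map scanned ts = map top_symbol s"
  by (induction rule: list_all2_induct) (auto simp: scanned_stack)

lemma execI:
  assumes "\<And>ts k. list_all2 holds_stack ts s \<Longrightarrow>
    \<exists>ts'. com_steps n (c # k, ts) (k, ts') \<and> list_all2 holds_stack ts' s'"
  shows "exec n c s s'"
  using assms unfolding exec_def by blast

lemma execE:
  assumes "exec n c s s'" "list_all2 holds_stack ts s"
  obtains ts' where "com_steps n (c # k, ts) (k, ts')" "list_all2 holds_stack ts' s'"
  using assms unfolding exec_def by blast

lemma exec_mono: "exec m c s s' \<Longrightarrow> m \<le> n \<Longrightarrow> exec n c s s'"
  unfolding exec_def using com_steps_mono by blast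

subsection \<open>Control structures\<close>

lemma com_step_stay:
  assumes "successor c k (map scanned ts) = (k', stay (map scanned ts))"
  shows "com_step (c # k, ts) (k', ts)"
  using com_stepI[OF assms] by simp

lemma exec_seq [trans]:
  assumes "exec m a s s1" "exec n b s1 s2"
  shows "exec (m + n + 1) (a ;; b) s s2"
proof (rule execI)
  fix ts k assume ts: "list_all2 holds_stack ts s"
  obtain ts1 where first: "com_steps m (a # b # k, ts) (b # k, ts1)" "list_all2 holds_stack ts1 s1"
    using execE[OF assms(1) ts] by blast
  obtain ts2 where second: "com_steps n (b # k, ts1) (k, ts2)" "list_all2 holds_stack ts2 s2"
    using execE[OF assms(2) first(2)] by blast
  have "com_step ((a ;; b) # k, ts) (a # b # k, ts)"
    by (rule com_step_stay) simp
  then have "com_steps (m + n + 1) ((a ;; b) # k, ts) (k, ts2)"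
    using com_steps_step com_steps_trans[OF first(1) second(1)] by fastforce
  then show "\<exists>ts'. com_steps (m + n + 1) ((a ;; b) # k, ts) (k, ts') \<and> list_all2 holds_stack ts' s2"
    using second(2) by blast
qed

lemma exec_cond:
  assumes "P (map top_symbol s) \<Longrightarrow> exec n a s s'" "\<not> P (map top_symbol s) \<Longrightarrow> exec n b s s'"
  shows "exec (n + 1) (Cond P a b) s s'"
proof (rule execI)
  fix ts k assume ts: "list_all2 holds_stack ts s"
  let ?c = "if P (map top_symbol s) then a else b"
  have "exec n ?c s s'" using assms by simp
  then obtain ts' where ts': "com_steps n (?c # k, ts) (k, ts')" "list_all2 holds_stack ts' s'"
    using execE ts by blast
  have "com_step (Cond P a b # k, ts) (?c # k, ts)"
    by (rule com_step_stay) (simp add: scanned_stacks[OF ts])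
  then show "\<exists>ts'. com_steps (n + 1) (Cond P a b # k, ts) (k, ts') \<and> list_all2 holds_stack ts' s'"
    using com_steps_step ts' by fastforce
qed

lemma exec_loop_stop:
  assumes "\<not> P (map top_symbol s)"
  shows "exec 1 (Loop P a) s s"
proof (rule execI)
  fix ts k assume ts: "list_all2 holds_stack ts s"
  have "com_step (Loop P a # k, ts) (k, ts)"
    by (rule com_step_stay) (simp add: scanned_stacks[OF ts] assms)
  then have "com_steps 1 (Loop P a # k, ts) (k, ts)"
    using com_steps_step com_steps_refl by fastforce
  then show "\<exists>ts'. com_steps 1 (Loop P a # k, ts) (k, ts') \<and> list_all2 holds_stack ts' s"
    using ts by blast
qed

lemma exec_loop_step:
  assumes "P (map top_symbol s)" "exec m a s s1" "exec n (Loop P a) s1 s2"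
  shows "exec (m + n + 1) (Loop P a) s s2"
proof (rule execI)
  fix ts k assume ts: "list_all2 holds_stack ts s"
  obtain ts1 where body: "com_steps m (a # Loop P a # k, ts) (Loop P a # k, ts1)"
      "list_all2 holds_stack ts1 s1"
    using execE[OF assms(2) ts] by blast
  obtain ts2 where rest: "com_steps n (Loop P a # k, ts1) (k, ts2)" "list_all2 holds_stack ts2 s2"
    using execE[OF assms(3) body(2)] by blast
  have "com_step (Loop P a # k, ts) (a # Loop P a # k, ts)"
    by (rule com_step_stay) (simp add: scanned_stacks[OF ts] assms(1))
  then have "com_steps (m + n + 1) (Loop P a # k, ts) (k, ts2)"
    using com_steps_step com_steps_trans[OF body(1) rest(1)] by fastforce
  then show "\<exists>ts'. com_steps (m + n + 1) (Loop P a # k, ts) (k, ts') \<and> list_all2 holds_stack ts' s2"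
    using rest(2) by blast
qed

lemma exec_loop_list:
  assumes "\<And>ys z zs. xs = ys @ z # zs \<Longrightarrow> P (map top_symbol (S ys (z # zs)))"
    and "\<And>ys z zs. xs = ys @ z # zs \<Longrightarrow> exec n a (S ys (z # zs)) (S (ys @ [z]) zs)"
    and "\<not> P (map top_symbol (S xs []))"
  shows "exec (length xs * (n + 1) + 1) (Loop P a) (S [] xs) (S xs [])"
proof -
  have "exec (length zs * (n + 1) + 1) (Loop P a) (S ys zs) (S xs [])" if "xs = ys @ zs" for ys zs
    using that
  proof (induction zs arbitrary: ys)
    case Nil
    then show ?case using exec_loop_stop[of P, OF assms(3)] by simp
  next
    case (Cons z zs)
    have "exec (n + (length zs * (n + 1) + 1) + 1) (Loop P a) (S ys (z # zs)) (S xs [])"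
      using Cons assms(1,2) by (intro exec_loop_step) auto
    then show ?case by (simp add: algebra_simps)
  qed
  from this[of "[]" xs] show ?thesis by simp
qed

subsection \<open>Stack operations\<close>

definition act_on :: "nat \<Rightarrow> (symbol list \<Rightarrow> symbol \<times> direction) \<Rightarrow> com" where
  "act_on i w = Act (\<lambda>ss. (stay ss)[i := w ss])"

definition skip :: com where
  "skip = Act stay"

definition pop :: "nat \<Rightarrow> com" where
  "pop i = act_on i (\<lambda>ss. (ss ! i, Rgt))"

definition push_read :: "nat \<Rightarrow> (symbol list \<Rightarrow> symbol) \<Rightarrow> com" where
  "push_read i g = act_on i (\<lambda>ss. (ss ! i, Lft)) ;; act_on i (\<lambda>ss. (g ss, Stay))"

definition push :: "nat \<Rightarrow> symbol \<Rightarrow> com" where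
  "push i x = push_read i (\<lambda>_. x)"

definition copy :: "nat \<Rightarrow> nat \<Rightarrow> com" where
  "copy i j = push_read j (\<lambda>ss. ss ! i)"

definition move :: "nat \<Rightarrow> nat \<Rightarrow> com" where
  "move i j = copy i j ;; pop i"

lemma com_steps_act_on:
  assumes "i < length ts"
  shows "com_steps 1 (act_on i w # k, ts) (k, ts[i := update_tape (w (map scanned ts)) (ts ! i)])"
proof -
  have "com_step (act_on i w # k, ts) (k, ts[i := update_tape (w (map scanned ts)) (ts ! i)])"
    unfolding act_on_def map2_stay_update[OF assms, symmetric] by (rule com_stepI) simp
  then show ?thesis using com_steps_step com_steps_refl by fastforce
qed

lemma exec_skip: "exec 1 skip s s"
proof (rule execI)
  fix ts k assume ts: "list_all2 holds_stack ts s"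
  have "com_step (skip # k, ts) (k, ts)"
    by (rule com_step_stay) (simp add: skip_def)
  then show "\<exists>ts'. com_steps 1 (skip # k, ts) (k, ts') \<and> list_all2 holds_stack ts' s"
    using ts com_steps_step com_steps_refl by fastforce
qed

lemma holds_stack_pop:
  assumes "holds_stack t xs"
  shows "holds_stack (update_tape (scanned t, Rgt) t) (tl xs)"
proof -
  have "fst t (snd t + 1 + int i) = (if i < length (tl xs) then tl xs ! i else Blank)" for i
    using assms[unfolded holds_stack_def, THEN conjunct2, rule_format, of "Suc i"]
    by (cases xs) (auto simp: algebra_simps)
  moreover have "Blank \<notin> set (tl xs)"
    using assms unfolding holds_stack_def by (cases xs) auto
  ultimately show ?thesis
    by (simp add: holds_stack_def update_tape_def scanned_def)
qed

lemma holds_stack_push: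
  assumes "holds_stack t xs" "x \<noteq> Blank"
  shows "holds_stack (update_tape (x, Stay) (update_tape (scanned t, Lft) t)) (x # xs)"
proof -
  have "((fst t)(snd t - 1 := x)) (snd t - 1 + int i) =
      (if i < length (x # xs) then (x # xs) ! i else Blank)" for i
    using assms(1) by (cases i) (simp_all add: holds_stack_def)
  moreover have "Blank \<notin> set (x # xs)"
    using assms unfolding holds_stack_def by auto
  ultimately show ?thesis
    by (simp add: holds_stack_def update_tape_def scanned_def)
qed

lemma exec_pop:
  assumes "i < length s"
  shows "exec 1 (pop i) s (s[i := tl (s ! i)])"
proof (rule execI)
  fix ts k assume ts: "list_all2 holds_stack ts s"
  have i: "i < length ts" using assms ts by (simp add: list_all2_lengthD)
  let ?ts' = "ts[i := update_tape (scanned (ts ! i), Rgt) (ts ! i)]"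
  have "com_steps 1 (pop i # k, ts) (k, ?ts')"
    using com_steps_act_on[OF i, of "\<lambda>ss. (ss ! i, Rgt)"] i by (simp add: pop_def)
  moreover have "list_all2 holds_stack ?ts' (s[i := tl (s ! i)])"
    by (intro list_all2_update_cong ts holds_stack_pop list_all2_nthD[OF ts i])
  ultimately show "\<exists>ts'. com_steps 1 (pop i # k, ts) (k, ts') \<and>
      list_all2 holds_stack ts' (s[i := tl (s ! i)])"
    by blast
qed

lemma exec_push_read:
  assumes i: "i < length s" and g: "\<And>ss y. g (ss[i := y]) = g ss"
    and nonblank: "g (map top_symbol s) \<noteq> Blank"
  shows "exec 3 (push_read i g) s (s[i := g (map top_symbol s) # s ! i])"
proof (rule execI)
  fix ts k assume ts: "list_all2 holds_stack ts s"
  have i': "i < length ts" using i ts by (simp add: list_all2_lengthD)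
  let ?x = "g (map top_symbol s)" and ?left = "act_on i (\<lambda>ss. (ss ! i, Lft))"
    and ?write = "act_on i (\<lambda>ss. (g ss, Stay))"
  let ?t1 = "update_tape (scanned (ts ! i), Lft) (ts ! i)"
  let ?t2 = "update_tape (?x, Stay) ?t1"
  have "com_step (push_read i g # k, ts) (?left # ?write # k, ts)"
    unfolding push_read_def by (rule com_step_stay) simp
  moreover have "com_steps 1 (?left # ?write # k, ts) (?write # k, ts[i := ?t1])"
    using com_steps_act_on[OF i', of "\<lambda>ss. (ss ! i, Lft)"] i' by simp
  moreover have "com_steps 1 (?write # k, ts[i := ?t1]) (k, ts[i := ?t2])"
    using com_steps_act_on[of i "ts[i := ?t1]" "\<lambda>ss. (g ss, Stay)"] i'
    by (simp add: map_update g scanned_stacks[OF ts])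
  ultimately have "com_steps (Suc (1 + 1)) (push_read i g # k, ts) (k, ts[i := ?t2])"
    by (rule com_steps_step[OF _ com_steps_trans])
  moreover have "list_all2 holds_stack (ts[i := ?t2]) (s[i := ?x # s ! i])"
    by (intro list_all2_update_cong ts holds_stack_push list_all2_nthD[OF ts i'] nonblank)
  ultimately show "\<exists>ts'. com_steps 3 (push_read i g # k, ts) (k, ts') \<and>
      list_all2 holds_stack ts' (s[i := ?x # s ! i])"
    by (auto simp: numeral_3_eq_3)
qed

lemma exec_push:
  assumes "i < length s" "x \<noteq> Blank"
  shows "exec 3 (push i x) s (s[i := x # s ! i])"
  unfolding push_def using exec_push_read[of i s "\<lambda>_. x"] assms by simp

lemma exec_copy:
  assumes "i < length s" "j < length s" "i \<noteq> j" "s ! i = x # xs" "x \<noteq> Blank"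
  shows "exec 3 (copy i j) s (s[j := x # s ! j])"
  unfolding copy_def using exec_push_read[of j s "\<lambda>ss. ss ! i"] assms by simp

lemma exec_move:
  assumes "i < length s" "j < length s" "i \<noteq> j" "s ! i = x # xs" "x \<noteq> Blank"
  shows "exec 5 (move i j) s (s[j := x # s ! j, i := xs])"
proof -
  have "exec 1 (pop i) (s[j := x # s ! j]) (s[j := x # s ! j, i := xs])"
    using exec_pop[of i "s[j := x # s ! j]"] assms by simp
  from exec_seq[OF exec_copy[OF assms] this] show ?thesis by (simp add: move_def)
qed

lemma exec_move_until:
  assumes ij: "i < length s" "j < length s" "i \<noteq> j" and split: "s ! i = xs @ b"
    and "Blank \<notin> set xs" "top_symbol b \<notin> set xs"
  shows "exec (6 * length xs + 1) (Loop (\<lambda>ss. ss ! i \<noteq> top_symbol b) (move i j))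
    s (s[i := b, j := rev xs @ s ! j])"
proof -
  let ?S = "\<lambda>ys zs. s[i := zs @ b, j := rev ys @ s ! j]"
  have "exec (length xs * (5 + 1) + 1) (Loop (\<lambda>ss. ss ! i \<noteq> top_symbol b) (move i j))
      (?S [] xs) (?S xs [])"
  proof (rule exec_loop_list)
    fix ys z zs assume "xs = ys @ z # zs"
    then have z: "z \<noteq> Blank" "z \<noteq> top_symbol b" using assms(5,6) by auto
    show "map top_symbol (?S ys (z # zs)) ! i \<noteq> top_symbol b"
      using z ij by simp
    have "(?S ys (z # zs))[j := z # ?S ys (z # zs) ! j, i := zs @ b] = ?S (ys @ [z]) zs"
      using ij by (simp add: list_update_swap)
    then show "exec 5 (move i j) (?S ys (z # zs)) (?S (ys @ [z]) zs)"
      using exec_move[of i "?S ys (z # zs)" j z "zs @ b"] ij z by simp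
  qed (use ij in simp)
  moreover have "?S [] xs = s" by (simp flip: split)
  ultimately show ?thesis by (simp add: mult.commute)
qed

lemma exec_pop_until:
  assumes i: "i < length s" and split: "s ! i = xs @ b" and "top_symbol b \<notin> set xs"
  shows "exec (2 * length xs + 1) (Loop (\<lambda>ss. ss ! i \<noteq> top_symbol b) (pop i)) s (s[i := b])"
proof -
  let ?S = "\<lambda>ys zs. s[i := zs @ b]"
  have "exec (length xs * (1 + 1) + 1) (Loop (\<lambda>ss. ss ! i \<noteq> top_symbol b) (pop i))
      (?S [] xs) (?S xs [])"
  proof (rule exec_loop_list)
    fix ys z zs assume "xs = ys @ z # zs"
    then have "z \<noteq> top_symbol b" using assms(3) by auto
    then show "map top_symbol (?S ys (z # zs)) ! i \<noteq> top_symbol b"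
      using i by simp
    show "exec 1 (pop i) (?S ys (z # zs)) (?S (ys @ [z]) zs)"
      using exec_pop[of i "?S ys (z # zs)"] i by simp
  qed (use i in simp)
  moreover have "?S [] xs = s" by (simp flip: split)
  ultimately show ?thesis by (simp add: mult_2)
qed

subsection \<open>Compilation to Turing machines\<close>

definition stack_alphabet :: "symbol set" where
  "stack_alphabet = {Blank, Bit False, Bit True, Sep}"

fun wf_com :: "nat \<Rightarrow> com \<Rightarrow> bool" where
  "wf_com n (Act f) \<longleftrightarrow> (\<forall>ss. length ss = n \<and> set ss \<subseteq> stack_alphabet \<longrightarrow>
     length (f ss) = n \<and> fst ` set (f ss) \<subseteq> stack_alphabet)"
| "wf_com n (a ;; b) \<longleftrightarrow> wf_com n a \<and> wf_com n b"
| "wf_com n (Cond P a b) \<longleftrightarrow> wf_com n a \<and> wf_com n b"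
| "wf_com n (Loop P a) \<longleftrightarrow> wf_com n a"

lemma in_stack_alphabet [simp]: "Bit b \<in> stack_alphabet" "Sep \<in> stack_alphabet"
  by (cases b) (auto simp: stack_alphabet_def)

lemma fst_set_stay [simp]: "fst ` set (stay ss) = set ss"
  by (simp add: stay_def image_image)

lemma length_stay [simp]: "length (stay ss) = length ss"
  by (simp add: stay_def)

lemma wf_act_on:
  assumes "\<And>ss. length ss = n \<Longrightarrow> set ss \<subseteq> stack_alphabet \<Longrightarrow> fst (w ss) \<in> stack_alphabet"
  shows "wf_com n (act_on i w)"
proof -
  have "fst ` set ((stay ss)[i := w ss]) \<subseteq> stack_alphabet"
    if "length ss = n" "set ss \<subseteq> stack_alphabet" for ss
  proof -
    have "fst ` set ((stay ss)[i := w ss]) \<subseteq> insert (fst (w ss)) (fst ` set (stay ss))"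
      using image_mono[OF set_update_subset_insert, of fst "stay ss" i "w ss"] by simp
    then show ?thesis using that assms by auto
  qed
  then show ?thesis by (simp add: act_on_def)
qed

lemma wf_skip [simp]: "wf_com n skip"
  by (simp add: skip_def)

lemma wf_pop [simp]: "i < n \<Longrightarrow> wf_com n (pop i)"
  unfolding pop_def by (rule wf_act_on) (metis fst_conv nth_mem subsetD)

lemma wf_push_read:
  assumes "i < n" "\<And>ss. length ss = n \<Longrightarrow> set ss \<subseteq> stack_alphabet \<Longrightarrow> g ss \<in> stack_alphabet"
  shows "wf_com n (push_read i g)"
  unfolding push_read_def wf_com.simps using assms
  by (intro conjI wf_act_on) (metis fst_conv nth_mem subsetD)+

lemma wf_push [simp]: "i < n \<Longrightarrow> x \<in> stack_alphabet \<Longrightarrow> wf_com n (push i x)"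
  unfolding push_def by (rule wf_push_read)

lemma wf_copy [simp]: "i < n \<Longrightarrow> j < n \<Longrightarrow> wf_com n (copy i j)"
  unfolding copy_def by (rule wf_push_read) (metis nth_mem subsetD)+

lemma wf_move [simp]: "i < n \<Longrightarrow> j < n \<Longrightarrow> wf_com n (move i j)"
  unfolding move_def by simp

fun continuations :: "com \<Rightarrow> com list \<Rightarrow> com list set" where
  "continuations (Act f) k = {Act f # k}"
| "continuations (a ;; b) k = {(a ;; b) # k} \<union> continuations a (b # k) \<union> continuations b k"
| "continuations (Cond P a b) k = {Cond P a b # k} \<union> continuations a k \<union> continuations b k"
| "continuations (Loop P a) k = {Loop P a # k} \<union> continuations a (Loop P a # k)"

lemma finite_continuations: "finite (continuations c k)"
  by (induction c k rule: continuations.induct) auto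

lemma Cons_in_continuations [simp]: "c # k \<in> continuations c k"
  by (cases c) auto

lemma continuations_closed:
  "a # k' \<in> continuations c k \<Longrightarrow> fst (successor a k' ss) \<in> insert k (continuations c k)"
proof (induction c k rule: continuations.induct)
  case (4 P b k)
  then show ?case by (cases "P ss") auto
qed auto

lemma wf_continuations:
  "wf_com n c \<Longrightarrow> list_all (wf_com n) k \<Longrightarrow> k' \<in> continuations c k \<Longrightarrow> list_all (wf_com n) k'"
  by (induction c k rule: continuations.induct) auto

lemma wf_successor:
  assumes "wf_com n c" "length ss = n" "set ss \<subseteq> stack_alphabet"
  shows "length (snd (successor c k ss)) = n \<and> fst ` set (snd (successor c k ss)) \<subseteq> stack_alphabet"
  using assms by (cases c) auto

definition program_points :: "com \<Rightarrow> com list set" where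
  "program_points c = insert [] (continuations c [])"

definition point_state :: "com \<Rightarrow> com list \<Rightarrow> state" where
  "point_state c k = Work (to_nat_on (program_points c) k)"

definition compile :: "nat \<Rightarrow> com \<Rightarrow> machine" where
  "compile n c = \<lparr>tape_count = n,
     states = {Start, Accept, Reject, Query, Yes, No} \<union> point_state c ` program_points c,
     alphabet = stack_alphabet,
     delta = (\<lambda>q ss. case q of
         Start \<Rightarrow> {(point_state c [c], stay ss)}
       | Work j \<Rightarrow> (case from_nat_into (program_points c) j of
           [] \<Rightarrow> {(if ss ! 0 = Bit True then Accept else Reject, stay ss)}
         | a # k \<Rightarrow> {(point_state c (fst (successor a k ss)), snd (successor a k ss))})
       | _ \<Rightarrow> {})\<rparr>"

lemma countable_program_points: "countable (program_points c)"
  by (simp add: program_points_def finite_continuations countable_finite)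

lemma compile_simps [simp]:
  "tape_count (compile n c) = n" "alphabet (compile n c) = stack_alphabet"
  "states (compile n c) =
     {Start, Accept, Reject, Query, Yes, No} \<union> point_state c ` program_points c"
  "delta (compile n c) Start ss = {(point_state c [c], stay ss)}"
  by (simp_all add: compile_def)

lemma delta_compile_point:
  assumes "k \<in> program_points c"
  shows "delta (compile n c) (point_state c k) ss = (case k of
     [] \<Rightarrow> {(if ss ! 0 = Bit True then Accept else Reject, stay ss)}
   | a # k \<Rightarrow> {(point_state c (fst (successor a k ss)), snd (successor a k ss))})"
  using assms by (simp add: compile_def point_state_def countable_program_points)

lemma delta_compile_unique:
  "x \<in> delta (compile n c) q ss \<Longrightarrow> y \<in> delta (compile n c) q ss \<Longrightarrow> x = y"
  by (auto simp: compile_def split: state.splits list.splits)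

lemma deterministic_compile: "deterministic (compile n c)"
  unfolding deterministic_def using delta_compile_unique by blast

lemma oracle_free_compile: "oracle_free (compile n c)"
  unfolding oracle_free_def
  by (auto simp: compile_def point_state_def split: state.splits list.splits if_splits)

lemma successor_in_program_points:
  "a # k \<in> program_points c \<Longrightarrow> fst (successor a k ss) \<in> program_points c"
  using continuations_closed[of a k c "[]"] by (simp add: program_points_def)

lemma wf_delta_compile:
  assumes "wf_com n c" "q \<in> states (compile n c)" "length ss = n" "set ss \<subseteq> stack_alphabet"
    and act: "(q', ws) \<in> delta (compile n c) q ss"
  shows "q' \<in> states (compile n c) \<and> length ws = n \<and> fst ` set ws \<subseteq> stack_alphabet"
proof (cases "\<exists>k\<in>program_points c. q = point_state c k")
  case True
  then obtain k where k: "k \<in> program_points c" "q = point_state c k" by blast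
  show ?thesis
  proof (cases k)
    case Nil
    then show ?thesis using act k delta_compile_point[OF k(1)] assms(3,4) by simp
  next
    case (Cons a k')
    have "wf_com n a"
      using wf_continuations[OF assms(1), of "[]" k] k(1) Cons by (simp add: program_points_def)
    from wf_successor[OF this assms(3,4)] show ?thesis
      using act k Cons delta_compile_point[OF k(1)] successor_in_program_points by auto
  qed
next
  case False
  then have "q = Start"
    using act assms(2) by (auto simp: compile_def)
  then show ?thesis using act assms(3,4) by (simp add: program_points_def)
qed

lemma wf_compile:
  assumes "wf_com n c" "2 \<le> n"
  shows "wf_machine (compile n c)"
  unfolding wf_machine_def compile_simps(1,2)
proof (intro conjI ballI allI impI)
  show "finite (states (compile n c))"
    by (simp add: program_points_def finite_continuations)
  show "{Start, Accept, Reject, Query, Yes, No} \<subseteq> states (compile n c)"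
    by simp
  show "finite stack_alphabet" "{Blank, Bit False, Bit True, Sep} \<subseteq> stack_alphabet"
    by (simp_all add: stack_alphabet_def)
  fix q ss a
  assume "q \<in> states (compile n c)" "length ss = n \<and> set ss \<subseteq> stack_alphabet"
    "a \<in> delta (compile n c) q ss"
  then show "case a of (q', ws) \<Rightarrow>
      q' \<in> states (compile n c) \<and> length ws = n \<and> fst ` set ws \<subseteq> stack_alphabet"
    using wf_delta_compile[OF assms(1), of q ss "fst a" "snd a"]
    by (simp only: prod.collapse split_beta simp_thms)
qed (fact assms(2))

lemma oracle_step_compile:
  assumes "com_step (k, ts) (k', ts')" "k \<in> program_points c"
  shows "k' \<in> program_points c"
    "oracle_step A (compile n c) \<lparr>state = point_state c k, tapes = ts\<rparr>
       \<lparr>state = point_state c k', tapes = ts'\<rparr>"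
proof -
  obtain a k0 ws where step: "k = a # k0" "successor a k0 (map scanned ts) = (k', ws)"
    "ts' = map2 update_tape ws ts"
    using assms(1) by (auto elim: com_step.cases)
  show "k' \<in> program_points c"
    using successor_in_program_points[of a k0 c "map scanned ts"] assms(2) step by simp
  have "delta (compile n c) (point_state c k) (map scanned ts) = {(point_state c k', ws)}"
    using delta_compile_point[OF assms(2)] step by simp
  moreover have "point_state c k \<notin> {Query, Accept, Reject}"
    by (simp add: point_state_def)
  ultimately show "oracle_step A (compile n c) \<lparr>state = point_state c k, tapes = ts\<rparr>
      \<lparr>state = point_state c k', tapes = ts'\<rparr>"
    by (simp add: oracle_step_def moves_def perform_def step(3))
qed

lemma oracle_steps_compile:
  assumes "(com_step ^^ m) (k, ts) (k', ts')" "k \<in> program_points c"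
  shows "(oracle_step A (compile n c) ^^ m) \<lparr>state = point_state c k, tapes = ts\<rparr>
       \<lparr>state = point_state c k', tapes = ts'\<rparr> \<and> k' \<in> program_points c"
  using assms(1)
proof (induction m arbitrary: k' ts')
  case 0
  then show ?case using assms(2) by simp
next
  case (Suc m)
  then obtain k1 ts1 where "(com_step ^^ m) (k, ts) (k1, ts1)" "com_step (k1, ts1) (k', ts')"
    by auto
  with Suc.IH show ?case using oracle_step_compile by (meson relpowp_Suc_I)
qed

lemma right_unique_relpowp:
  fixes r :: "'a \<Rightarrow> 'a \<Rightarrow> bool"
  shows "right_unique r \<Longrightarrow> (r ^^ n) x y \<Longrightarrow> (r ^^ n) x z \<Longrightarrow> y = z"
  by (rule relpowp_right_unique[of r n]) (auto dest: right_uniqueD)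

lemma relpowp_halt_le:
  fixes r :: "'a \<Rightarrow> 'a \<Rightarrow> bool"
  assumes "right_unique r" "(r ^^ n) a b" "\<And>c. \<not> r b c" "(r ^^ m) a c"
  shows "m \<le> n"
proof (rule ccontr)
  assume "\<not> m \<le> n"
  then obtain d where "m = n + Suc d" by (metis add_Suc_right less_imp_Suc_add not_le)
  then obtain y where y: "(r ^^ n) a y" "(r ^^ Suc d) y c"
    using assms(4) by (auto simp: relpowp_add)
  have "b = y"
    by (rule right_unique_relpowp[OF assms(1,2) y(1)])
  then show False using y(2) assms(3) relpowp_Suc_D2 by metis
qed

lemma halted_oracle_step: "state c \<in> {Accept, Reject} \<Longrightarrow> \<not> oracle_step A M c d"
  by (auto simp: oracle_step_def moves_def)

lemma decides_in_time_deterministicI: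
  assumes unique: "right_unique (oracle_step A M)"
    and run: "\<And>x. \<exists>n\<le>T (length x). \<exists>c. (oracle_step A M ^^ n) (input_config M x) c \<and>
      state c = (if x \<in> L then Accept else Reject)"
  shows "decides_in_time A M L T"
  unfolding decides_in_time_def
proof (intro allI conjI impI)
  let ?r = "oracle_step A M"
  fix x
  obtain n c where c: "n \<le> T (length x)" "(?r ^^ n) (input_config M x) c"
    "state c = (if x \<in> L then Accept else Reject)" using run by blast
  have halted_c: "\<not> ?r c d" for d by (rule halted_oracle_step) (simp add: c(3))
  { fix m d assume "(?r ^^ m) (input_config M x) d"
    then have "m \<le> n" by (rule relpowp_halt_le[OF unique c(2) halted_c])
    then show "m \<le> T (length x)" using c(1) by (rule le_trans) }
  have "d = c" if d: "?r\<^sup>*\<^sup>* (input_config M x) d" "state d = Accept" for d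
  proof -
    obtain m where m: "(?r ^^ m) (input_config M x) d" using rtranclp_imp_relpowp[OF d(1)] by blast
    have halted_d: "\<not> ?r d e" for e by (rule halted_oracle_step) (simp add: d(2))
    have "m = n"
      by (rule le_antisym[OF relpowp_halt_le[OF unique c(2) halted_c m]
            relpowp_halt_le[OF unique m halted_d c(2)]])
    then show "d = c"
      using right_unique_relpowp[OF unique] m c(2) by blast
  qed
  moreover have "?r\<^sup>*\<^sup>* (input_config M x) c" by (rule relpowp_imp_rtranclp[OF c(2)])
  moreover have "state c = Accept \<longleftrightarrow> x \<in> L" by (simp add: c(3))
  ultimately show "x \<in> L \<longleftrightarrow> (\<exists>c. ?r\<^sup>*\<^sup>* (input_config M x) c \<and> state c = Accept)"
    by metis
qed

lemma holds_stack_tape_of: "Blank \<notin> set ss \<Longrightarrow> holds_stack (tape_of ss) ss"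
  by (simp add: holds_stack_def tape_of_def)

lemma right_unique_compile: "right_unique (oracle_step A (compile n c))"
  unfolding right_unique_def oracle_step_def moves_def
  by (auto split: if_splits dest: delta_compile_unique)

lemma compile_run:
  assumes "(com_step ^^ m) ([c], tapes (input_config (compile n c) x)) ([], ts)"
  shows "(oracle_step A (compile n c) ^^ (m + 2)) (input_config (compile n c) x)
    \<lparr>state = if map scanned ts ! 0 = Bit True then Accept else Reject, tapes = ts\<rparr>"
proof -
  let ?r = "oracle_step A (compile n c)"
  define ts0 where "ts0 = tapes (input_config (compile n c) x)"
  have input: "input_config (compile n c) x = \<lparr>state = Start, tapes = ts0\<rparr>"
    by (simp add: ts0_def input_config_def)
  have "?r (input_config (compile n c) x) \<lparr>state = point_state c [c], tapes = ts0\<rparr>"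
    unfolding input by (simp add: oracle_step_def moves_def perform_def)
  moreover have "(?r ^^ m) \<lparr>state = point_state c [c], tapes = ts0\<rparr>
      \<lparr>state = point_state c [], tapes = ts\<rparr>"
    using oracle_steps_compile[OF assms] by (simp add: program_points_def ts0_def)
  moreover have "?r \<lparr>state = point_state c [], tapes = ts\<rparr>
      \<lparr>state = if map scanned ts ! 0 = Bit True then Accept else Reject, tapes = ts\<rparr>"
    using delta_compile_point[of "[]" c n "map scanned ts"]
    by (simp add: oracle_step_def moves_def perform_def program_points_def)
      (simp add: point_state_def)
  ultimately show ?thesis
    unfolding add_2_eq_Suc' by (meson relpowp_Suc_I relpowp_Suc_I2)
qed

lemma compile_decides:
  assumes "\<And>x. \<exists>xs s. exec (T (length x)) c (map Bit x # replicate (n - 1) []) (xs # s) \<and>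
      (top_symbol xs = Bit True \<longleftrightarrow> x \<in> L)"
  shows "decides_in_time A (compile n c) L (\<lambda>m. T m + 2)"
proof (rule decides_in_time_deterministicI[OF right_unique_compile])
  fix x
  let ?ts = "tapes (input_config (compile n c) x)"
  obtain xs s where s: "exec (T (length x)) c (map Bit x # replicate (n - 1) []) (xs # s)"
    "top_symbol xs = Bit True \<longleftrightarrow> x \<in> L"
    using assms by blast
  have "list_all2 holds_stack ?ts (map Bit x # replicate (n - 1) [])"
    using holds_stack_tape_of[of "[]"]
    by (auto simp: input_config_def list_all2_conv_all_nth[of _ "replicate _ _"]
        intro: holds_stack_tape_of)
  then obtain ts m where run: "m \<le> T (length x)" "(com_step ^^ m) ([c], ?ts) ([], ts)"
    "list_all2 holds_stack ts (xs # s)"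
    using s(1) unfolding exec_def com_steps_def by blast
  let ?c' = "\<lparr>state = if map scanned ts ! 0 = Bit True then Accept else Reject, tapes = ts\<rparr>"
  have "state ?c' = (if x \<in> L then Accept else Reject)"
    using scanned_stacks[OF run(3)] s(2) by simp
  moreover have "m + 2 \<le> T (length x) + 2" using run(1) by simp
  ultimately show "\<exists>m\<le>T (length x) + 2. \<exists>c'.
      (oracle_step A (compile n c) ^^ m) (input_config (compile n c) x) c' \<and>
      state c' = (if x \<in> L then Accept else Reject)"
    using compile_run[OF run(2), of A] by blast
qed

section \<open>Manipulating binary trees on a stack\<close>

datatype tree = Lf | Nd (left: tree) (right: tree)
  where "left Lf = Lf" | "right Lf = Lf"

fun preorder :: "tree \<Rightarrow> symbol list" where
  "preorder Lf = [Bit False]"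
| "preorder (Nd l r) = Bit True # preorder l @ preorder r"

lemma length_preorder [simp]: "length (preorder t) = 2 * size t + 1"
  by (induction t) auto

lemma set_preorder: "set (preorder t) \<subseteq> range Bit"
  by (induction t) auto

lemma preorder_symbols [simp]: "Blank \<notin> set (preorder t)" "Sep \<notin> set (preorder t)"
  using set_preorder by auto

lemma count_preorder: "count_list (preorder t) (Bit True) = size t"
  by (induction t) auto

lemma
  assumes "x \<noteq> Blank"
  shows exec_push_0: "exec 3 (push 0 x) [a, b, u, d] [x # a, b, u, d]"
    and exec_push_1: "exec 3 (push 1 x) [a, b, u, d] [a, x # b, u, d]"
    and exec_push_2: "exec 3 (push 2 x) [a, b, u, d] [a, b, x # u, d]"
    and exec_push_3: "exec 3 (push 3 x) [a, b, u, d] [a, b, u, x # d]"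
  using exec_push[of 0 "[a, b, u, d]" x] exec_push[of 1 "[a, b, u, d]" x]
    exec_push[of 2 "[a, b, u, d]" x] exec_push[of 3 "[a, b, u, d]" x] assms
  by (simp_all add: eval_nat_numeral)

lemma
  shows exec_pop_0: "exec 1 (pop 0) [x # a, b, u, d] [a, b, u, d]"
    and exec_pop_1: "exec 1 (pop 1) [a, x # b, u, d] [a, b, u, d]"
    and exec_pop_2: "exec 1 (pop 2) [a, b, x # u, d] [a, b, u, d]"
    and exec_pop_3: "exec 1 (pop 3) [a, b, u, x # d] [a, b, u, d]"
  using exec_pop[of 0 "[x # a, b, u, d]"] exec_pop[of 1 "[a, x # b, u, d]"]
    exec_pop[of 2 "[a, b, x # u, d]"] exec_pop[of 3 "[a, b, u, x # d]"]
  by (simp_all add: eval_nat_numeral)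

lemma
  assumes "x \<noteq> Blank"
  shows exec_move_0_1: "exec 5 (move 0 1) [x # a, b, u, d] [a, x # b, u, d]"
    and exec_move_1_0: "exec 5 (move 1 0) [a, x # b, u, d] [x # a, b, u, d]"
    and exec_copy_1_2: "exec 3 (copy 1 2) [a, x # b, u, d] [a, x # b, x # u, d]"
  using exec_move[of 0 "[x # a, b, u, d]" 1 x a] exec_move[of 1 "[a, x # b, u, d]" 0 x b]
    exec_copy[of 1 "[a, x # b, u, d]" 2 x b] assms
  by (simp_all add: eval_nat_numeral)

subsection \<open>Setting a tree aside\<close>

text \<open>Stack 3 counts the trees that are still to be read, in unary above a separator.\<close>

definition count_subtrees :: com where
  "count_subtrees = Cond (\<lambda>ss. ss ! 0 = Bit True) (push 3 (Bit True)) (pop 3)"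

definition stash_loop :: com where
  "stash_loop = Loop (\<lambda>ss. ss ! 3 = Bit True) (count_subtrees ;; move 0 1)"

definition stash :: com where
  "stash = push 1 Sep ;; push 3 Sep ;; push 3 (Bit True) ;; stash_loop ;; pop 3"

definition unstash :: com where
  "unstash = Loop (\<lambda>ss. ss ! 1 \<noteq> Sep) (move 1 0) ;; pop 1"

definition discard :: com where
  "discard = stash ;; Loop (\<lambda>ss. ss ! 1 \<noteq> Sep) (pop 1) ;; pop 1"

definition duplicate :: com where
  "duplicate = stash ;; push 2 Sep ;; Loop (\<lambda>ss. ss ! 1 \<noteq> Sep) (copy 1 2 ;; move 1 0) ;;
     Loop (\<lambda>ss. ss ! 2 \<noteq> Sep) (move 2 1) ;; pop 2 ;; unstash"

lemma wf_stash [simp]: "wf_com 4 stash"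
  by (simp add: stash_def stash_loop_def count_subtrees_def)

lemma wf_unstash [simp]: "wf_com 4 unstash"
  by (simp add: unstash_def)

lemma wf_discard [simp]: "wf_com 4 discard"
  by (simp add: discard_def)

lemma wf_duplicate [simp]: "wf_com 4 duplicate"
  by (simp add: duplicate_def)

lemma exec_stash_loop:
  "exec n stash_loop [a, rev (preorder t) @ b, u, d] s \<Longrightarrow>
   exec (n + (22 * size t + 11)) stash_loop [preorder t @ a, b, u, Bit True # d] s"
proof (induction t arbitrary: a b d n)
  case Lf
  have "exec (3 + 1) count_subtrees [Bit False # a, b, u, Bit True # d] [Bit False # a, b, u, d]"
    unfolding count_subtrees_def by (rule exec_cond) (auto intro: exec_mono[OF exec_pop_3])
  also have "exec 5 (move 0 1) \<dots> [a, Bit False # b, u, d]"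
    by (rule exec_move_0_1) simp
  finally have body: "exec 10 (count_subtrees ;; move 0 1)
      [Bit False # a, b, u, Bit True # d] [a, Bit False # b, u, d]" by simp
  have "exec n stash_loop [a, Bit False # b, u, d] s" using Lf by simp
  from exec_loop_step[OF _ body this[unfolded stash_loop_def]]
  show ?case by (simp add: stash_loop_def add.commute)
next
  case (Nd l r)
  let ?a = "preorder l @ preorder r @ a"
  have "exec (3 + 1) count_subtrees
      [Bit True # ?a, b, u, Bit True # d] [Bit True # ?a, b, u, Bit True # Bit True # d]"
    unfolding count_subtrees_def by (rule exec_cond) (auto intro: exec_push_3)
  also have "exec 5 (move 0 1) \<dots> [?a, Bit True # b, u, Bit True # Bit True # d]"
    by (rule exec_move_0_1) simp
  finally have body: "exec 10 (count_subtrees ;; move 0 1)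
      [Bit True # ?a, b, u, Bit True # d] [?a, Bit True # b, u, Bit True # Bit True # d]" by simp
  have "exec n stash_loop [a, rev (preorder r) @ rev (preorder l) @ Bit True # b, u, d] s"
    using Nd.prems by simp
  from Nd.IH(1)[OF Nd.IH(2)[OF this]]
  have "exec (n + (22 * size r + 11) + (22 * size l + 11)) stash_loop
      [?a, Bit True # b, u, Bit True # Bit True # d] s" .
  from exec_loop_step[OF _ body this[unfolded stash_loop_def]]
  show ?case by (simp add: stash_loop_def algebra_simps)
qed

lemma exec_stash:
  "exec (22 * size t + 26) stash [preorder t @ a, b, u, d] [a, rev (preorder t) @ Sep # b, u, d]"
proof -
  let ?t = "preorder t @ a" and ?t' = "rev (preorder t) @ Sep # b"
  have "exec 3 (push 1 Sep) [?t, b, u, d] [?t, Sep # b, u, d]"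
    by (rule exec_push_1) simp
  also have "exec 3 (push 3 Sep) \<dots> [?t, Sep # b, u, Sep # d]"
    by (rule exec_push_3) simp
  also have "exec 3 (push 3 (Bit True)) \<dots> [?t, Sep # b, u, Bit True # Sep # d]"
    by (rule exec_push_3) simp
  also have "exec (1 + (22 * size t + 11)) stash_loop \<dots> [a, ?t', u, Sep # d]"
    by (rule exec_stash_loop) (simp add: stash_loop_def exec_loop_stop[simplified])
  also have "exec 1 (pop 3) \<dots> [a, ?t', u, d]"
    by (rule exec_pop_3)
  finally show ?thesis by (simp add: stash_def add.commute)
qed

lemma exec_copy_until_Sep:
  assumes "Blank \<notin> set xs" "Sep \<notin> set xs"
  shows "exec (10 * length xs + 1) (Loop (\<lambda>ss. ss ! 1 \<noteq> Sep) (copy 1 2 ;; move 1 0))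
    [a, xs @ Sep # b, u, d] [rev xs @ a, Sep # b, rev xs @ u, d]"
proof -
  let ?S = "\<lambda>ys zs. [rev ys @ a, zs @ Sep # b, rev ys @ u, d]"
  have "exec (length xs * (9 + 1) + 1) (Loop (\<lambda>ss. ss ! 1 \<noteq> Sep) (copy 1 2 ;; move 1 0))
      (?S [] xs) (?S xs [])"
  proof (rule exec_loop_list)
    fix ys z zs assume "xs = ys @ z # zs"
    then have z: "z \<noteq> Blank" "z \<noteq> Sep" using assms by auto
    then show "map top_symbol (?S ys (z # zs)) ! 1 \<noteq> Sep" by simp
    show "exec 9 (copy 1 2 ;; move 1 0) (?S ys (z # zs)) (?S (ys @ [z]) zs)"
      using exec_seq[OF exec_copy_1_2 exec_move_1_0] z by simp
  qed simp
  then show ?thesis by (simp add: mult.commute)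
qed

lemma exec_unstash:
  "exec (12 * size t + 9) unstash [a, rev (preorder t) @ Sep # b, u, d] [preorder t @ a, b, u, d]"
proof -
  let ?r = "rev (preorder t)"
  have "exec (6 * length ?r + 1) (Loop (\<lambda>ss. ss ! 1 \<noteq> Sep) (move 1 0))
      [a, ?r @ Sep # b, u, d] [rev ?r @ a, Sep # b, u, d]"
    using exec_move_until[of 1 "[a, ?r @ Sep # b, u, d]" 0 ?r "Sep # b"] by simp
  also have "exec 1 (pop 1) \<dots> [rev ?r @ a, b, u, d]"
    by (rule exec_pop_1)
  finally show ?thesis by (simp add: unstash_def add.commute)
qed

lemma exec_discard: "exec (26 * size t + 32) discard [preorder t @ a, b, u, d] [a, b, u, d]"
proof -
  let ?r = "rev (preorder t)"
  have "exec (22 * size t + 26) stash [preorder t @ a, b, u, d] [a, ?r @ Sep # b, u, d]"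
    by (rule exec_stash)
  also have "exec (2 * length ?r + 1) (Loop (\<lambda>ss. ss ! 1 \<noteq> Sep) (pop 1)) \<dots> [a, Sep # b, u, d]"
    using exec_pop_until[of 1 "[a, ?r @ Sep # b, u, d]" ?r "Sep # b"] by simp
  also have "exec 1 (pop 1) \<dots> [a, b, u, d]"
    by (rule exec_pop_1)
  finally show ?thesis by (simp add: discard_def add.commute)
qed

lemma exec_duplicate:
  "exec (66 * size t + 62) duplicate
    [preorder t @ a, b, u, d] [preorder t @ preorder t @ a, b, u, d]"
proof -
  let ?p = "preorder t" and ?r = "rev (preorder t)"
  have "exec (22 * size t + 26) stash [?p @ a, b, u, d] [a, ?r @ Sep # b, u, d]"
    by (rule exec_stash)
  also have "exec 3 (push 2 Sep) \<dots> [a, ?r @ Sep # b, Sep # u, d]"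
    by (rule exec_push_2) simp
  also have "exec (10 * length ?r + 1) (Loop (\<lambda>ss. ss ! 1 \<noteq> Sep) (copy 1 2 ;; move 1 0))
      \<dots> [rev ?r @ a, Sep # b, rev ?r @ Sep # u, d]"
    by (rule exec_copy_until_Sep) simp_all
  also have "exec (6 * length (rev ?r) + 1) (Loop (\<lambda>ss. ss ! 2 \<noteq> Sep) (move 2 1))
      \<dots> [rev ?r @ a, rev (rev ?r) @ Sep # b, Sep # u, d]"
    using exec_move_until[of 2 "[rev ?r @ a, Sep # b, rev ?r @ Sep # u, d]" 1 "rev ?r" "Sep # u"]
    by simp
  also have "exec 1 (pop 2) \<dots> [rev ?r @ a, ?r @ Sep # b, u, d]"
    by (simp add: exec_pop_2[simplified])
  also have "exec (12 * size t + 9) unstash \<dots> [?p @ rev ?r @ a, b, u, d]"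
    by (rule exec_unstash)
  finally show ?thesis by (simp add: duplicate_def add.commute)
qed

subsection \<open>Combinators for functions on trees\<close>

definition computes :: "nat \<Rightarrow> com \<Rightarrow> tree \<Rightarrow> tree \<Rightarrow> bool" where
  "computes n c t t' \<longleftrightarrow>
     (\<forall>a b u d. exec n c [preorder t @ a, b, u, d] [preorder t' @ a, b, u, d])"

lemma computesI:
  "(\<And>a b u d. exec n c [preorder t @ a, b, u, d] [preorder t' @ a, b, u, d]) \<Longrightarrow> computes n c t t'"
  unfolding computes_def by blast

lemma computesD: "computes n c t t' \<Longrightarrow> exec n c [preorder t @ a, b, u, d] [preorder t' @ a, b, u, d]"
  unfolding computes_def by blast

lemma computes_mono: "computes m c t t' \<Longrightarrow> m \<le> n \<Longrightarrow> computes n c t t'"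
  unfolding computes_def using exec_mono by blast

lemma computes_seq: "computes m a t t1 \<Longrightarrow> computes n b t1 t2 \<Longrightarrow> computes (m + n + 1) (a ;; b) t t2"
  unfolding computes_def using exec_seq by blast

lemma computes_skip: "computes 1 skip t t"
  unfolding computes_def using exec_skip by blast

definition left_com :: com where
  "left_com = Cond (\<lambda>ss. ss ! 0 = Bit True) (pop 0 ;; stash ;; discard ;; unstash) skip"

definition right_com :: com where
  "right_com = Cond (\<lambda>ss. ss ! 0 = Bit True) (pop 0 ;; discard) skip"

definition pair_com :: "com \<Rightarrow> com \<Rightarrow> com" where
  "pair_com f g = duplicate ;; f ;; stash ;; g ;; unstash ;; push 0 (Bit True)"

definition if_com :: "com \<Rightarrow> com \<Rightarrow> com \<Rightarrow> com" where
  "if_com b f g = duplicate ;; b ;; Cond (\<lambda>ss. ss ! 0 = Bit True) (discard ;; f) (discard ;; g)"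

definition push_all :: "symbol list \<Rightarrow> com" where
  "push_all xs = foldr (\<lambda>x c. c ;; push 0 x) xs skip"

definition const_com :: "tree \<Rightarrow> com" where
  "const_com t = discard ;; push_all (preorder t)"

definition iterate_com :: "com \<Rightarrow> com" where
  "iterate_com f = pop 0 ;; stash ;;
     Loop (\<lambda>ss. ss ! 1 \<noteq> Sep) (Cond (\<lambda>ss. ss ! 1 = Bit True) (pop 1 ;; f) (pop 1)) ;; pop 1"

lemma wf_left_com [simp]: "wf_com 4 left_com"
  by (simp add: left_com_def)

lemma wf_right_com [simp]: "wf_com 4 right_com"
  by (simp add: right_com_def)

lemma wf_pair_com [simp]: "wf_com 4 f \<Longrightarrow> wf_com 4 g \<Longrightarrow> wf_com 4 (pair_com f g)"
  by (simp add: pair_com_def)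

lemma wf_if_com [simp]: "wf_com 4 b \<Longrightarrow> wf_com 4 f \<Longrightarrow> wf_com 4 g \<Longrightarrow> wf_com 4 (if_com b f g)"
  by (simp add: if_com_def)

lemma wf_iterate_com [simp]: "wf_com 4 f \<Longrightarrow> wf_com 4 (iterate_com f)"
  by (simp add: iterate_com_def)

lemma wf_push_all: "set xs \<subseteq> stack_alphabet \<Longrightarrow> wf_com 4 (push_all xs)"
  by (induction xs) (auto simp: push_all_def)

lemma wf_const_com [simp]: "wf_com 4 (const_com t)"
  using set_preorder[of t] by (auto simp: const_com_def intro!: wf_push_all)

lemma computes_left_com: "computes (60 * size t + 72) left_com t (left t)"
proof (rule computesI)
  fix a b u d
  show "exec (60 * size t + 72) left_com
      [preorder t @ a, b, u, d] [preorder (left t) @ a, b, u, d]"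
  proof (cases t)
    case Lf
    have "exec (1 + 1) left_com [Bit False # a, b, u, d] [Bit False # a, b, u, d]"
      unfolding left_com_def by (rule exec_cond) (auto intro: exec_skip[simplified])
    then show ?thesis using Lf by (auto elim: exec_mono)
  next
    case (Nd l r)
    have "exec 1 (pop 0) [preorder t @ a, b, u, d] [preorder l @ preorder r @ a, b, u, d]"
      using exec_pop_0 by (simp add: Nd)
    also have "exec (22 * size l + 26) stash \<dots> [preorder r @ a, rev (preorder l) @ Sep # b, u, d]"
      by (rule exec_stash)
    also have "exec (26 * size r + 32) discard \<dots> [a, rev (preorder l) @ Sep # b, u, d]"
      by (rule exec_discard)
    also have "exec (12 * size l + 9) unstash \<dots> [preorder l @ a, b, u, d]"
      by (rule exec_unstash)
    finally have "exec (60 * size t + 71) (pop 0 ;; stash ;; discard ;; unstash)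
        [preorder t @ a, b, u, d] [preorder (left t) @ a, b, u, d]"
      by (auto simp: Nd elim!: exec_mono)
    then show ?thesis
      unfolding left_com_def using exec_cond[of _ _ "60 * size t + 71"] Nd by fastforce
  qed
qed

lemma computes_right_com: "computes (60 * size t + 72) right_com t (right t)"
proof (rule computesI)
  fix a b u d
  show "exec (60 * size t + 72) right_com
      [preorder t @ a, b, u, d] [preorder (right t) @ a, b, u, d]"
  proof (cases t)
    case Lf
    have "exec (1 + 1) right_com [Bit False # a, b, u, d] [Bit False # a, b, u, d]"
      unfolding right_com_def by (rule exec_cond) (auto intro: exec_skip[simplified])
    then show ?thesis using Lf by (auto elim: exec_mono)
  next
    case (Nd l r)
    have "exec 1 (pop 0) [preorder t @ a, b, u, d] [preorder l @ preorder r @ a, b, u, d]"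
      using exec_pop_0 by (simp add: Nd)
    also have "exec (26 * size l + 32) discard \<dots> [preorder r @ a, b, u, d]"
      by (rule exec_discard)
    finally have "exec (60 * size t + 71) (pop 0 ;; discard)
        [preorder t @ a, b, u, d] [preorder (right t) @ a, b, u, d]"
      by (auto simp: Nd elim!: exec_mono)
    then show ?thesis
      unfolding right_com_def using exec_cond[of _ _ "60 * size t + 71"] Nd by fastforce
  qed
qed

lemma computes_pair_com:
  assumes "computes m f x y" "computes n g x z"
  shows "computes (m + n + 66 * size x + 34 * size y + 105) (pair_com f g) x (Nd y z)"
proof (rule computesI)
  fix a b u d
  have "exec (66 * size x + 62) duplicate
      [preorder x @ a, b, u, d] [preorder x @ preorder x @ a, b, u, d]"
    by (rule exec_duplicate)
  also have "exec m f \<dots> [preorder y @ preorder x @ a, b, u, d]"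
    by (rule computesD[OF assms(1)])
  also have "exec (22 * size y + 26) stash \<dots> [preorder x @ a, rev (preorder y) @ Sep # b, u, d]"
    by (rule exec_stash)
  also have "exec n g \<dots> [preorder z @ a, rev (preorder y) @ Sep # b, u, d]"
    by (rule computesD[OF assms(2)])
  also have "exec (12 * size y + 9) unstash \<dots> [preorder y @ preorder z @ a, b, u, d]"
    by (rule exec_unstash)
  also have "exec 3 (push 0 (Bit True)) \<dots> [preorder (Nd y z) @ a, b, u, d]"
    using exec_push_0[of "Bit True"] by simp
  finally show "exec (m + n + 66 * size x + 34 * size y + 105) (pair_com f g)
      [preorder x @ a, b, u, d] [preorder (Nd y z) @ a, b, u, d]"
    unfolding pair_com_def[symmetric] by (rule exec_mono) simp
qed

lemma exec_push_all:
  "Blank \<notin> set xs \<Longrightarrow> exec (4 * length xs + 1) (push_all xs) [a, b, u, d] [xs @ a, b, u, d]"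
proof (induction xs)
  case Nil
  show ?case by (simp add: push_all_def exec_skip[simplified])
next
  case (Cons x xs)
  then have "exec (4 * length xs + 1) (push_all xs) [a, b, u, d] [xs @ a, b, u, d]" by simp
  also have "exec 3 (push 0 x) \<dots> [x # xs @ a, b, u, d]"
    using Cons.prems by (intro exec_push_0) auto
  finally show ?case by (simp add: push_all_def)
qed

lemma computes_const_com: "computes (26 * size x + 8 * size t + 38) (const_com t) x t"
proof (rule computesI)
  fix a b u d
  have "exec (26 * size x + 32) discard [preorder x @ a, b, u, d] [a, b, u, d]"
    by (rule exec_discard)
  also have "exec (4 * length (preorder t) + 1) (push_all (preorder t)) \<dots> [preorder t @ a, b, u, d]"
    by (rule exec_push_all) simp
  finally show "exec (26 * size x + 8 * size t + 38) (const_com t)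
      [preorder x @ a, b, u, d] [preorder t @ a, b, u, d]"
    by (simp add: const_com_def algebra_simps)
qed

lemma computes_if_com:
  assumes "computes l c x y"
    and "y \<noteq> Lf \<Longrightarrow> computes m f x z" "y = Lf \<Longrightarrow> computes m g x z"
  shows "computes (l + m + 66 * size x + 26 * size y + 98) (if_com c f g) x z"
proof (rule computesI)
  fix a b u d
  have "exec (66 * size x + 62) duplicate
      [preorder x @ a, b, u, d] [preorder x @ preorder x @ a, b, u, d]"
    by (rule exec_duplicate)
  also have "exec l c \<dots> [preorder y @ preorder x @ a, b, u, d]"
    by (rule computesD[OF assms(1)])
  also have "exec (26 * size y + 32 + m + 1 + 1)
      (Cond (\<lambda>ss. ss ! 0 = Bit True) (discard ;; f) (discard ;; g)) \<dots> [preorder z @ a, b, u, d]"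
  proof (rule exec_cond)
    assume "map top_symbol [preorder y @ preorder x @ a, b, u, d] ! 0 = Bit True"
    then have "y \<noteq> Lf" by auto
    then show "exec (26 * size y + 32 + m + 1) (discard ;; f)
        [preorder y @ preorder x @ a, b, u, d] [preorder z @ a, b, u, d]"
      by (intro exec_seq[OF exec_discard computesD] assms(2))
  next
    assume "map top_symbol [preorder y @ preorder x @ a, b, u, d] ! 0 \<noteq> Bit True"
    then have "y = Lf" by (cases y) auto
    then show "exec (26 * size y + 32 + m + 1) (discard ;; g)
        [preorder y @ preorder x @ a, b, u, d] [preorder z @ a, b, u, d]"
      by (intro exec_seq[OF exec_discard computesD] assms(3))
  qed
  finally show "exec (l + m + 66 * size x + 26 * size y + 98) (if_com c f g)
      [preorder x @ a, b, u, d] [preorder z @ a, b, u, d]"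
    by (simp add: if_com_def algebra_simps)
qed

lemma exec_iterate_loop:
  assumes "\<And>i. i < size n \<Longrightarrow> computes m f (h i) (h (Suc i))"
  shows "exec ((2 * size n + 1) * (m + 4) + 1)
    (Loop (\<lambda>ss. ss ! 1 \<noteq> Sep) (Cond (\<lambda>ss. ss ! 1 = Bit True) (pop 1 ;; f) (pop 1)))
    [preorder (h 0) @ a, rev (preorder n) @ Sep # b, u, d]
    [preorder (h (size n)) @ a, Sep # b, u, d]"
proof -
  let ?body = "Cond (\<lambda>ss. ss ! 1 = Bit True) (pop 1 ;; f) (pop 1)"
  let ?S = "\<lambda>ys zs. [preorder (h (count_list ys (Bit True))) @ a, zs @ Sep # b, u, d]"
  have "exec (length (rev (preorder n)) * (m + 2 + 1 + 1) + 1) (Loop (\<lambda>ss. ss ! 1 \<noteq> Sep) ?body)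
      (?S [] (rev (preorder n))) (?S (rev (preorder n)) [])"
  proof (rule exec_loop_list)
    fix ys z zs assume split: "rev (preorder n) = ys @ z # zs"
    then have "z \<in> set (preorder n)" by (metis in_set_conv_decomp set_rev)
    then have "z \<noteq> Sep" by auto
    then show "map top_symbol (?S ys (z # zs)) ! 1 \<noteq> Sep" by simp
    show "exec (m + 2 + 1) ?body (?S ys (z # zs)) (?S (ys @ [z]) zs)"
    proof (rule exec_cond)
      assume "map top_symbol (?S ys (z # zs)) ! 1 = Bit True"
      then have z: "z = Bit True" by simp
      have "count_list ys (Bit True) < size n"
        using arg_cong[OF split, of "\<lambda>xs. count_list xs (Bit True)"] z by (simp add: count_preorder)
      from exec_seq[OF exec_pop_1 computesD[OF assms[OF this]]]
      show "exec (m + 2) (pop 1 ;; f) (?S ys (z # zs)) (?S (ys @ [z]) zs)" using z by simp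
    next
      assume "map top_symbol (?S ys (z # zs)) ! 1 \<noteq> Bit True"
      then show "exec (m + 2) (pop 1) (?S ys (z # zs)) (?S (ys @ [z]) zs)"
        using exec_mono[OF exec_pop_1] by simp
    qed
  qed simp
  then show ?thesis by (auto simp: count_preorder algebra_simps elim!: exec_mono)
qed

lemma computes_iterate_com:
  assumes "\<And>i. i < size n \<Longrightarrow> computes m f (h i) (h (Suc i))"
    and "size n \<le> N"
  shows "computes ((2 * N + 1) * (m + 15) + 21) (iterate_com f) (Nd n (h 0)) (h (size n))"
proof (rule computesI)
  fix a b u d
  have "exec 1 (pop 0)
      [preorder (Nd n (h 0)) @ a, b, u, d] [preorder n @ preorder (h 0) @ a, b, u, d]"
    using exec_pop_0 by simp
  also have "exec (22 * size n + 26) stash \<dots> [preorder (h 0) @ a, rev (preorder n) @ Sep # b, u, d]"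
    by (rule exec_stash)
  also have "exec ((2 * size n + 1) * (m + 4) + 1)
      (Loop (\<lambda>ss. ss ! 1 \<noteq> Sep) (Cond (\<lambda>ss. ss ! 1 = Bit True) (pop 1 ;; f) (pop 1)))
      \<dots> [preorder (h (size n)) @ a, Sep # b, u, d]"
    by (rule exec_iterate_loop) (rule assms(1))
  also have "exec 1 (pop 1) \<dots> [preorder (h (size n)) @ a, b, u, d]"
    by (rule exec_pop_1)
  finally have run: "exec ((2 * size n + 1) * (m + 15) + 21) (iterate_com f)
      [preorder (Nd n (h 0)) @ a, b, u, d] [preorder (h (size n)) @ a, b, u, d]"
    unfolding iterate_com_def[symmetric] by (rule exec_mono) (simp add: algebra_simps)
  have "(2 * size n + 1) * (m + 15) \<le> (2 * N + 1) * (m + 15)"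
    using assms(2) by (intro mult_le_mono1) simp
  then show "exec ((2 * N + 1) * (m + 15) + 21) (iterate_com f)
      [preorder (Nd n (h 0)) @ a, b, u, d] [preorder (h (size n)) @ a, b, u, d]"
    by (intro exec_mono[OF run]) simp
qed

section \<open>Polynomial-time functions\<close>

definition poly_bound :: "(nat \<Rightarrow> nat) \<Rightarrow> bool" where
  "poly_bound p \<longleftrightarrow> mono p \<and> (\<exists>k. \<forall>n. p n \<le> (n + 2) ^ k)"

named_theorems poly_bound_intros

lemma poly_boundI: "mono p \<Longrightarrow> (\<And>n. p n \<le> (n + 2) ^ k) \<Longrightarrow> poly_bound p"
  unfolding poly_bound_def by blast

lemma poly_boundE:
  assumes "poly_bound p"
  obtains k where "mono p" "\<And>n. p n \<le> (n + 2) ^ k"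
  using assms unfolding poly_bound_def by blast

lemma poly_bound_mono: "poly_bound p \<Longrightarrow> m \<le> n \<Longrightarrow> p m \<le> p n"
  unfolding poly_bound_def by (blast dest: monoD)

lemma poly_bound_const [poly_bound_intros]: "poly_bound (\<lambda>n. c)"
proof (rule poly_boundI)
  show "c \<le> (n + 2) ^ c" for n
    using power_mono[of 2 "n + 2" c] less_exp[of c] by simp
qed (simp add: mono_def)

lemma poly_bound_id [poly_bound_intros]: "poly_bound (\<lambda>n. n)"
  by (rule poly_boundI[of _ 1]) (simp_all add: mono_def)

lemma poly_bound_mult [poly_bound_intros]:
  assumes "poly_bound p" "poly_bound q"
  shows "poly_bound (\<lambda>n. p n * q n)"
proof -
  obtain k l where p: "mono p" "\<And>n. p n \<le> (n + 2) ^ k" and q: "mono q" "\<And>n. q n \<le> (n + 2) ^ l"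
    using assms by (elim poly_boundE) blast
  show ?thesis
  proof (rule poly_boundI)
    show "mono (\<lambda>n. p n * q n)" using p(1) q(1) by (simp add: mono_def mult_mono)
    show "p n * q n \<le> (n + 2) ^ (k + l)" for n
      unfolding power_add using p(2) q(2) by (rule mult_mono) simp_all
  qed
qed

lemma poly_bound_add [poly_bound_intros]:
  assumes "poly_bound p" "poly_bound q"
  shows "poly_bound (\<lambda>n. p n + q n)"
proof -
  obtain k l where p: "mono p" "\<And>n. p n \<le> (n + 2) ^ k" and q: "mono q" "\<And>n. q n \<le> (n + 2) ^ l"
    using assms by (elim poly_boundE) blast
  show ?thesis
  proof (rule poly_boundI)
    show "mono (\<lambda>n. p n + q n)" using p(1) q(1) by (simp add: mono_def add_mono)
    fix n
    have "p n \<le> (n + 2) ^ (k + l)" "q n \<le> (n + 2) ^ (k + l)"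
      using p(2)[of n] q(2)[of n] power_increasing[of k "k + l" "n + 2"]
        power_increasing[of l "k + l" "n + 2"] by linarith+
    then have "p n + q n \<le> 2 * (n + 2) ^ (k + l)" by simp
    also have "\<dots> \<le> (n + 2) * (n + 2) ^ (k + l)" by (rule mult_right_mono) simp_all
    finally show "p n + q n \<le> (n + 2) ^ (k + l + 1)" by simp
  qed
qed

lemma poly_bound_Suc [poly_bound_intros]: "poly_bound p \<Longrightarrow> poly_bound (\<lambda>n. Suc (p n))"
  using poly_bound_add[of p "\<lambda>_. 1"] poly_bound_const by simp

lemma poly_bound_power [poly_bound_intros]: "poly_bound p \<Longrightarrow> poly_bound (\<lambda>n. p n ^ k)"
  by (induction k) (auto intro!: poly_bound_intros)

lemma poly_bound_comp:
  assumes "poly_bound p" "poly_bound q"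
  shows "poly_bound (\<lambda>n. p (q n))"
proof -
  obtain k l where p: "mono p" "\<And>n. p n \<le> (n + 2) ^ k" and q: "mono q" "\<And>n. q n \<le> (n + 2) ^ l"
    using assms by (elim poly_boundE) blast
  have "poly_bound (\<lambda>n. ((n + 2) ^ l + 2) ^ k)"
    by (intro poly_bound_intros)
  then obtain m where m: "\<And>n::nat. ((n + 2) ^ l + 2) ^ k \<le> (n + 2) ^ m"
    by (rule poly_boundE) blast
  show ?thesis
  proof (rule poly_boundI)
    show "mono (\<lambda>n. p (q n))" using p(1) q(1) by (simp add: mono_def)
    fix n
    have "p (q n) \<le> (q n + 2) ^ k" by (rule p(2))
    also have "\<dots> \<le> ((n + 2) ^ l + 2) ^ k" using q(2) by (intro power_mono) simp_all
    also have "\<dots> \<le> (n + 2) ^ m" by (rule m)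
    finally show "p (q n) \<le> (n + 2) ^ m" .
  qed
qed

subsection \<open>Encodings\<close>

class enc =
  fixes enc :: "'a \<Rightarrow> tree"
  assumes enc_inject: "enc x = enc y \<Longrightarrow> x = y"
begin

definition esize :: "'a \<Rightarrow> nat" where
  "esize x = size (enc x)"

end

instantiation tree :: enc
begin
definition "enc_tree (t::tree) = t"
instance by standard (simp add: enc_tree_def)
end

instantiation prod :: (enc, enc) enc
begin
definition "enc_prod p = Nd (enc (fst p)) (enc (snd p))"
instance by standard (auto simp: enc_prod_def prod_eq_iff dest: enc_inject)
end

instantiation bool :: enc
begin
definition "enc_bool b = (if b then Nd Lf Lf else Lf)"
instance by standard (auto simp: enc_bool_def split: if_splits)
end

instantiation list :: (enc) enc
begin
primrec enc_list where
  "enc_list [] = Lf"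
| "enc_list (x # xs) = Nd (enc x) (enc_list xs)"
instance
proof
  fix xs ys :: "'a list"
  show "enc xs = enc ys \<Longrightarrow> xs = ys"
    by (induction xs arbitrary: ys) (case_tac ys; auto dest: enc_inject)+
qed
end

instantiation nat :: enc
begin
primrec enc_nat where
  "enc_nat 0 = Lf"
| "enc_nat (Suc n) = Nd Lf (enc_nat n)"
instance
proof
  fix m n :: nat
  show "enc m = enc n \<Longrightarrow> m = n"
    by (induction m arbitrary: n) (case_tac n; auto)+
qed
end

definition int_view :: "int \<Rightarrow> bool \<times> nat" where
  "int_view i = (0 \<le> i, nat (if 0 \<le> i then i else - i - 1))"

instantiation int :: enc
begin
definition "enc_int i = enc (int_view i)"
instance by standard (auto simp: enc_int_def int_view_def dest!: enc_inject split: if_splits)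
end

instantiation symbol :: enc
begin
definition "enc_symbol s = enc (case s of Blank \<Rightarrow> (0, 0) | Bit b \<Rightarrow> (1, of_bool b) | Sep \<Rightarrow> (2, 0)
   | Sym n \<Rightarrow> (3::nat, n::nat))"
instance
  by standard
    (auto simp: enc_symbol_def of_bool_def dest!: enc_inject split: symbol.splits if_splits)
end

instantiation state :: enc
begin
definition "enc_state q = enc (case q of Start \<Rightarrow> (0, 0) | Accept \<Rightarrow> (1, 0) | Reject \<Rightarrow> (2, 0)
   | Query \<Rightarrow> (3, 0) | Yes \<Rightarrow> (4, 0) | No \<Rightarrow> (5, 0) | Work n \<Rightarrow> (6::nat, n::nat))"
instance by standard (auto simp: enc_state_def dest!: enc_inject split: state.splits)
end

instantiation direction :: enc
begin
definition "enc_direction d = enc (case d of Lft \<Rightarrow> 0 | Stay \<Rightarrow> 1 | Rgt \<Rightarrow> (2::nat))"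
instance by standard (unfold enc_direction_def, drule enc_inject, auto split: direction.splits)
end

lemma enc_tree [simp]: "enc (t::tree) = t"
  by (simp add: enc_tree_def)

lemma enc_Pair [simp]: "enc (x, y) = Nd (enc x) (enc y)"
  by (simp add: enc_prod_def)

lemma enc_bool_eq_Lf [simp]: "enc b = Lf \<longleftrightarrow> \<not> b"
  by (simp add: enc_bool_def)

lemma enc_nat_eq_Lf [simp]: "enc (n::nat) = Lf \<longleftrightarrow> n = 0"
  by (cases n) auto

lemma esize_Pair [simp]: "esize (a, b) = Suc (esize a + esize b)"
  by (simp add: esize_def)

lemma esize_prod: "esize p = Suc (esize (fst p) + esize (snd p))"
  by (cases p) simp

lemma esize_Nil [simp]: "esize [] = 0"
  by (simp add: esize_def)

lemma esize_Cons [simp]: "esize (x # xs) = Suc (esize x + esize xs)"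
  by (simp add: esize_def)

lemma esize_bool_le: "esize (b::bool) \<le> 1"
  by (simp add: esize_def enc_bool_def)

lemma esize_append [simp]: "esize (xs @ ys) = esize xs + esize ys"
  by (induction xs) auto

lemma esize_member: "x \<in> set xs \<Longrightarrow> esize x < esize xs"
  by (induction xs) auto

lemma length_le_esize: "length xs \<le> esize xs"
  by (induction xs) auto

lemma esize_list_le: "(\<And>x. x \<in> set xs \<Longrightarrow> esize x \<le> m) \<Longrightarrow> esize xs \<le> length xs * Suc m"
proof (induction xs)
  case (Cons x xs)
  have "esize x \<le> m" "esize xs \<le> length xs * Suc m" using Cons by auto
  then show ?case by simp
qed simp

lemma esize_drop_le: "esize (drop i xs) \<le> esize xs"
  using esize_append[of "take i xs" "drop i xs"] by simp

lemma esize_nat [simp]: "esize (n::nat) = n"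
  by (induction n) (auto simp: esize_def)

lemma esize_int_le: "esize (i::int) \<le> 2 + nat \<bar>i\<bar>"
proof -
  have "esize i = esize (int_view i)"
    by (simp only: esize_def enc_int_def)
  then show ?thesis using esize_bool_le[of "0 \<le> i"] by (auto simp: int_view_def)
qed

subsection \<open>Functions computable in polynomial time\<close>

text \<open>The time bound is a polynomial in an arbitrary measure \<open>t\<close> of the argument. Polynomial time
  is the case of its size; a larger measure describes, say, exponential time.\<close>

definition poly_computable :: "('a \<Rightarrow> nat) \<Rightarrow> 'a::enc set \<Rightarrow> ('a \<Rightarrow> 'b::enc) \<Rightarrow> bool" where
  "poly_computable t D f \<longleftrightarrow> (\<exists>c p. wf_com 4 c \<and> poly_bound p \<and>
     (\<forall>x\<in>D. esize (f x) \<le> p (t x) \<and> computes (p (t x)) c (enc x) (enc (f x))))"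

abbreviation polytime_on :: "'a::enc set \<Rightarrow> ('a \<Rightarrow> 'b::enc) \<Rightarrow> bool" where
  "polytime_on \<equiv> poly_computable esize"

abbreviation polytime :: "('a::enc \<Rightarrow> 'b::enc) \<Rightarrow> bool" where
  "polytime \<equiv> polytime_on UNIV"

named_theorems polytime_intros

lemma poly_computableI:
  assumes "wf_com 4 c" "poly_bound p" "poly_bound q"
    and "\<And>x. x \<in> D \<Longrightarrow> computes (p (t x)) c (enc x) (enc (f x))"
    and "\<And>x. x \<in> D \<Longrightarrow> esize (f x) \<le> q (t x)"
  shows "poly_computable t D f"
proof -
  have "poly_bound (\<lambda>n. p n + q n)" using assms(2,3) by (rule poly_bound_add)
  moreover have "esize (f x) \<le> p (t x) + q (t x) \<and>
      computes (p (t x) + q (t x)) c (enc x) (enc (f x))" if "x \<in> D" for x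
    using computes_mono[OF assms(4)[OF that]] assms(5)[OF that] by simp
  ultimately show ?thesis unfolding poly_computable_def using assms(1) by blast
qed

lemma poly_computableE:
  assumes "poly_computable t D f"
  obtains c p where "wf_com 4 c" "poly_bound p" "\<And>x. x \<in> D \<Longrightarrow> esize (f x) \<le> p (t x)"
    "\<And>x. x \<in> D \<Longrightarrow> computes (p (t x)) c (enc x) (enc (f x))"
  using assms unfolding poly_computable_def by blast

lemma poly_computable_esizeE:
  assumes "poly_computable t D f"
  obtains p where "poly_bound p" "\<And>x. x \<in> D \<Longrightarrow> esize (f x) \<le> p (t x)"
  using assms by (elim poly_computableE) blast

lemma poly_computable_subset: "poly_computable t E f \<Longrightarrow> D \<subseteq> E \<Longrightarrow> poly_computable t D f"
  unfolding poly_computable_def by blast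

lemma poly_computable_measure_mono:
  assumes "poly_computable t D f" "\<And>x. x \<in> D \<Longrightarrow> t x \<le> t' x"
  shows "poly_computable t' D f"
proof -
  obtain c p where c: "wf_com 4 c" "poly_bound p" "\<And>x. x \<in> D \<Longrightarrow> esize (f x) \<le> p (t x)"
    "\<And>x. x \<in> D \<Longrightarrow> computes (p (t x)) c (enc x) (enc (f x))"
    using assms(1) by (rule poly_computableE) blast
  have "p (t x) \<le> p (t' x)" if "x \<in> D" for x
    using poly_bound_mono[OF c(2)] assms(2)[OF that] .
  then show ?thesis
    using c le_trans computes_mono by (intro poly_computableI[of c p p]) blast+
qed

lemma poly_computable_recode:
  assumes "poly_computable t D f" "\<And>x. x \<in> D \<Longrightarrow> enc (g x) = enc (f x)"
  shows "poly_computable t D g"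
  using assms(1) unfolding poly_computable_def by (auto simp: esize_def assms(2))

lemma poly_computable_cong:
  "poly_computable t D f \<Longrightarrow> (\<And>x. x \<in> D \<Longrightarrow> g x = f x) \<Longrightarrow> poly_computable t D g"
  by (rule poly_computable_recode) auto

lemma polytime_id [polytime_intros]: "polytime_on D (\<lambda>x. x)"
  by (rule poly_computableI[of skip "\<lambda>_. 1" "\<lambda>n. n"])
    (auto intro: computes_skip[simplified] poly_bound_intros)

lemma polytime_const [polytime_intros]: "polytime_on D (\<lambda>x. c)"
  by (rule poly_computableI[of "const_com (enc c)" "\<lambda>n. 26 * n + 8 * esize c + 38" "\<lambda>_. esize c"])
    (auto intro!: poly_bound_intros simp: computes_const_com esize_def)

lemma poly_computable_comp:
  assumes "polytime_on E f" "poly_computable t D g" "\<And>x. x \<in> D \<Longrightarrow> g x \<in> E"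
  shows "poly_computable t D (\<lambda>x. f (g x))"
proof -
  obtain c p where c: "wf_com 4 c" "poly_bound p" "\<And>x. x \<in> E \<Longrightarrow> esize (f x) \<le> p (esize x)"
    "\<And>x. x \<in> E \<Longrightarrow> computes (p (esize x)) c (enc x) (enc (f x))"
    using assms(1) by (rule poly_computableE) blast
  obtain c' p' where c': "wf_com 4 c'" "poly_bound p'" "\<And>x. x \<in> D \<Longrightarrow> esize (g x) \<le> p' (t x)"
    "\<And>x. x \<in> D \<Longrightarrow> computes (p' (t x)) c' (enc x) (enc (g x))"
    using assms(2) by (rule poly_computableE) blast
  have bound: "p (esize (g x)) \<le> p (p' (t x))" if "x \<in> D" for x
    using poly_bound_mono[OF c(2) c'(3)[OF that]] .
  show ?thesis
  proof (rule poly_computableI)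
    show "wf_com 4 (c' ;; c)" using c c' by simp
    show "poly_bound (\<lambda>n. p' n + p (p' n) + 1)" "poly_bound (\<lambda>n. p (p' n))"
      by (intro poly_bound_intros poly_bound_comp[OF c(2)] c'(2))+
    fix x assume x: "x \<in> D"
    have "computes (p (p' (t x))) c (enc (g x)) (enc (f (g x)))"
      using computes_mono[OF c(4)[OF assms(3)[OF x]] bound[OF x]] .
    from computes_seq[OF c'(4)[OF x] this]
    show "computes (p' (t x) + p (p' (t x)) + 1) (c' ;; c) (enc x) (enc (f (g x)))" .
    show "esize (f (g x)) \<le> p (p' (t x))"
      using c(3)[OF assms(3)[OF x]] bound[OF x] by (rule le_trans)
  qed
qed

lemma polytime_comp: "polytime f \<Longrightarrow> polytime_on D g \<Longrightarrow> polytime_on D (\<lambda>x. f (g x))"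
  by (rule poly_computable_comp) auto

lemma polytime_Pair [polytime_intros]:
  assumes "polytime_on D f" "polytime_on D g"
  shows "polytime_on D (\<lambda>x. (f x, g x))"
proof -
  obtain cf p where f: "wf_com 4 cf" "poly_bound p" "\<And>x. x \<in> D \<Longrightarrow> esize (f x) \<le> p (esize x)"
    "\<And>x. x \<in> D \<Longrightarrow> computes (p (esize x)) cf (enc x) (enc (f x))"
    using assms(1) by (rule poly_computableE) blast
  obtain cg q where g: "wf_com 4 cg" "poly_bound q" "\<And>x. x \<in> D \<Longrightarrow> esize (g x) \<le> q (esize x)"
    "\<And>x. x \<in> D \<Longrightarrow> computes (q (esize x)) cg (enc x) (enc (g x))"
    using assms(2) by (rule poly_computableE) blast
  show ?thesis
  proof (rule poly_computableI)
    show "wf_com 4 (pair_com cf cg)" using f g by simp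
    show "poly_bound (\<lambda>n. p n + q n + 66 * n + 34 * p n + 105)" "poly_bound (\<lambda>n. Suc (p n + q n))"
      by (intro poly_bound_intros f g)+
    fix x assume x: "x \<in> D"
    show "computes (p (esize x) + q (esize x) + 66 * esize x + 34 * p (esize x) + 105)
        (pair_com cf cg) (enc x) (enc (f x, g x))"
      unfolding enc_Pair using f(3)[OF x]
      by (intro computes_mono[OF computes_pair_com[OF f(4)[OF x] g(4)[OF x]]]) (simp add: esize_def)
    show "esize (f x, g x) \<le> Suc (p (esize x) + q (esize x))"
      using f(3)[OF x] g(3)[OF x] by simp
  qed
qed

lemma polytime_comp2:
  assumes "polytime (\<lambda>p. h (fst p) (snd p))" "polytime_on D f" "polytime_on D g"
  shows "polytime_on D (\<lambda>x. h (f x) (g x))"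
  using polytime_comp[OF assms(1) polytime_Pair[OF assms(2,3)]] by simp

lemma polytime_comp3:
  assumes "polytime (\<lambda>p. h (fst p) (fst (snd p)) (snd (snd p)))"
    and "polytime_on D f" "polytime_on D g" "polytime_on D k"
  shows "polytime_on D (\<lambda>x. h (f x) (g x) (k x))"
  using polytime_comp[OF assms(1) polytime_Pair[OF assms(2) polytime_Pair[OF assms(3,4)]]] by simp

lemma polytime_enc [polytime_intros]: "polytime_on D f \<Longrightarrow> polytime_on D (\<lambda>x. enc (f x))"
  by (erule poly_computable_recode) simp

lemma size_left_le: "size (left t) \<le> size t"
  by (cases t) auto

lemma size_right_le: "size (right t) \<le> size t"
  by (cases t) auto

lemma polytime_left [polytime_intros]: "polytime_on D f \<Longrightarrow> polytime_on D (\<lambda>x. left (f x))"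
proof (erule polytime_comp[rotated])
  show "polytime left"
    by (rule poly_computableI[of left_com "\<lambda>n. 60 * n + 72" "\<lambda>n. n"])
      (auto intro!: poly_bound_intros computes_left_com simp: esize_def size_left_le)
qed

lemma polytime_right [polytime_intros]: "polytime_on D f \<Longrightarrow> polytime_on D (\<lambda>x. right (f x))"
proof (erule polytime_comp[rotated])
  show "polytime right"
    by (rule poly_computableI[of right_com "\<lambda>n. 60 * n + 72" "\<lambda>n. n"])
      (auto intro!: poly_bound_intros computes_right_com simp: esize_def size_right_le)
qed

lemma polytime_fst [polytime_intros]: "polytime_on D f \<Longrightarrow> polytime_on D (\<lambda>x. fst (f x))"
  by (rule poly_computable_recode[OF polytime_left[OF polytime_enc[of D f]]])
    (simp_all add: enc_prod_def)

lemma polytime_snd [polytime_intros]: "polytime_on D f \<Longrightarrow> polytime_on D (\<lambda>x. snd (f x))"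
  by (rule poly_computable_recode[OF polytime_right[OF polytime_enc[of D f]]])
    (simp_all add: enc_prod_def)

lemma polytime_Cons [polytime_intros]:
  "polytime_on D f \<Longrightarrow> polytime_on D g \<Longrightarrow> polytime_on D (\<lambda>x. f x # g x)"
  by (rule poly_computable_recode[OF polytime_Pair[of D f g]]) auto

lemma polytime_Nd [polytime_intros]:
  "polytime_on D f \<Longrightarrow> polytime_on D g \<Longrightarrow> polytime_on D (\<lambda>x. Nd (f x) (g x))"
  by (rule poly_computable_recode[OF polytime_Pair[of D f g]]) auto

lemma polytime_Suc [polytime_intros]: "polytime_on D f \<Longrightarrow> polytime_on D (\<lambda>x. Suc (f x))"
  by (rule poly_computable_recode[OF polytime_Pair[OF polytime_const[of D Lf], of f]]) auto

subsection \<open>Case distinctions\<close>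

lemma polytime_if_Lf:
  assumes "polytime_on D t"
    and "polytime_on {x \<in> D. enc (t x) \<noteq> Lf} f" "polytime_on {x \<in> D. enc (t x) = Lf} g"
  shows "polytime_on D (\<lambda>x. if enc (t x) \<noteq> Lf then f x else g x)"
proof -
  obtain c p where c: "wf_com 4 c" "poly_bound p" "\<And>x. x \<in> D \<Longrightarrow> esize (t x) \<le> p (esize x)"
    "\<And>x. x \<in> D \<Longrightarrow> computes (p (esize x)) c (enc x) (enc (t x))"
    using assms(1) by (rule poly_computableE) blast
  obtain cf q where f: "wf_com 4 cf" "poly_bound q"
    "\<And>x. x \<in> {x \<in> D. enc (t x) \<noteq> Lf} \<Longrightarrow> esize (f x) \<le> q (esize x)"
    "\<And>x. x \<in> {x \<in> D. enc (t x) \<noteq> Lf} \<Longrightarrow> computes (q (esize x)) cf (enc x) (enc (f x))"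
    using assms(2) by (rule poly_computableE) blast
  obtain cg r where g: "wf_com 4 cg" "poly_bound r"
    "\<And>x. x \<in> {x \<in> D. enc (t x) = Lf} \<Longrightarrow> esize (g x) \<le> r (esize x)"
    "\<And>x. x \<in> {x \<in> D. enc (t x) = Lf} \<Longrightarrow> computes (r (esize x)) cg (enc x) (enc (g x))"
    using assms(3) by (rule poly_computableE) blast
  show ?thesis
  proof (rule poly_computableI)
    show "wf_com 4 (if_com c cf cg)" using c f g by simp
    show "poly_bound (\<lambda>n. p n + (q n + r n) + 66 * n + 26 * p n + 98)" "poly_bound (\<lambda>n. q n + r n)"
      by (intro poly_bound_intros c f g)+
    fix x assume x: "x \<in> D"
    let ?v = "if enc (t x) \<noteq> Lf then f x else g x" and ?m = "q (esize x) + r (esize x)"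
    have "computes ?m cf (enc x) (enc ?v)" if "enc (t x) \<noteq> Lf"
      using computes_mono[OF f(4)] x that by simp
    moreover have "computes ?m cg (enc x) (enc ?v)" if "enc (t x) = Lf"
      using computes_mono[OF g(4)] x that by simp
    ultimately have "computes (p (esize x) + ?m + 66 * size (enc x) + 26 * size (enc (t x)) + 98)
        (if_com c cf cg) (enc x) (enc ?v)"
      by (rule computes_if_com[OF c(4)[OF x]])
    then show "computes (p (esize x) + ?m + 66 * esize x + 26 * p (esize x) + 98)
        (if_com c cf cg) (enc x) (enc ?v)"
      using c(3)[OF x] by (elim computes_mono) (simp add: esize_def)
    show "esize ?v \<le> ?m"
      using x f(3)[of x] g(3)[of x] by auto
  qed
qed

lemma polytime_if [polytime_intros]:
  assumes "polytime_on D b" "polytime_on D f" "polytime_on D g"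
  shows "polytime_on D (\<lambda>x. if b x then f x else g x)"
proof -
  have "polytime_on {x \<in> D. enc (b x) \<noteq> Lf} f" "polytime_on {x \<in> D. enc (b x) = Lf} g"
    using assms(2,3) by (auto elim: poly_computable_subset)
  from polytime_if_Lf[OF assms(1) this] show ?thesis by simp
qed

lemma polytime_not [polytime_intros]: "polytime_on D b \<Longrightarrow> polytime_on D (\<lambda>x. \<not> b x)"
  by (rule poly_computable_cong[OF
        polytime_if[OF _ polytime_const[of _ False] polytime_const[of _ True]]]) auto

lemma polytime_conj [polytime_intros]:
  "polytime_on D b \<Longrightarrow> polytime_on D b' \<Longrightarrow> polytime_on D (\<lambda>x. b x \<and> b' x)"
  by (rule poly_computable_cong[OF polytime_if[OF _ _ polytime_const[of _ False]], of _ b b']) auto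

lemma polytime_disj [polytime_intros]:
  "polytime_on D b \<Longrightarrow> polytime_on D b' \<Longrightarrow> polytime_on D (\<lambda>x. b x \<or> b' x)"
  by (rule poly_computable_cong[OF polytime_if[OF _ polytime_const[of _ True]], of _ b b']) auto

text \<open>If the scrutinee is not encoded by a leaf, then it has the same encoding as the pair \<open>s x\<close>
  of the arguments of its constructor.\<close>

lemma polytime_case:
  assumes t: "polytime_on D t" and f: "polytime_on D f" and g: "polytime (\<lambda>p. g (fst p) (snd p))"
    and leaf: "\<And>x. enc (t x) = Lf \<Longrightarrow> h x = f x"
    and node: "\<And>x. enc (t x) \<noteq> Lf \<Longrightarrow> enc (s x) = enc (t x) \<and> h x = g x (s x)"
  shows "polytime_on D h"
proof -
  let ?E = "{x \<in> D. enc (t x) \<noteq> Lf}"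
  have "polytime_on ?E (\<lambda>x. (x, t x))"
    by (intro polytime_intros poly_computable_subset[OF t]) auto
  then have "polytime_on ?E (\<lambda>x. (x, s x))"
    by (rule poly_computable_recode) (use node in auto)
  from polytime_comp[OF g this] have "polytime_on ?E (\<lambda>x. g x (s x))" by simp
  moreover have "polytime_on {x \<in> D. enc (t x) = Lf} f"
    by (rule poly_computable_subset[OF f]) auto
  ultimately have "polytime_on D (\<lambda>x. if enc (t x) \<noteq> Lf then g x (s x) else f x)"
    by (rule polytime_if_Lf[OF t])
  then show ?thesis
    by (rule poly_computable_cong) (use leaf node in auto)
qed

lemma polytime_case_tree [polytime_intros]:
  assumes "polytime_on D t" "polytime_on D f"
    and "polytime (\<lambda>p. g (fst p) (fst (snd p)) (snd (snd p)))"
  shows "polytime_on D (\<lambda>x. case t x of Lf \<Rightarrow> f x | Nd l r \<Rightarrow> g x l r)"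
  by (rule polytime_case[OF assms(1,2), where s = "\<lambda>x. (left (t x), right (t x))"
        and g = "\<lambda>x s. g x (fst s) (snd s)"])
    (use assms(3) in \<open>auto split: tree.splits\<close>)

lemma polytime_case_list [polytime_intros]:
  assumes "polytime_on D t" "polytime_on D f"
    and "polytime (\<lambda>p. g (fst p) (fst (snd p)) (snd (snd p)))"
  shows "polytime_on D (\<lambda>x. case t x of [] \<Rightarrow> f x | y # ys \<Rightarrow> g x y ys)"
  by (rule polytime_case[OF assms(1,2), where s = "\<lambda>x. (hd (t x), tl (t x))"
        and g = "\<lambda>x s. g x (fst s) (snd s)"])
    (use assms(3) in \<open>auto split: list.splits\<close>)

lemma polytime_case_nat [polytime_intros]:
  assumes "polytime_on D t" "polytime_on D f" "polytime (\<lambda>p. g (fst p) (snd p))"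
  shows "polytime_on D (\<lambda>x. case t x of 0 \<Rightarrow> f x | Suc n \<Rightarrow> g x n)"
proof (rule polytime_case[OF assms(1,2), where s = "\<lambda>x. (Lf, t x - 1)" and g = "\<lambda>x s. g x (snd s)"])
  show "polytime (\<lambda>p. g (fst p) (snd (snd p)))"
    by (rule polytime_comp2[OF assms(3)]) (intro polytime_intros)+
qed (auto split: nat.splits simp: gr0_conv_Suc)

lemma polytime_tl [polytime_intros]: "polytime_on D f \<Longrightarrow> polytime_on D (\<lambda>x. tl (f x))"
  unfolding tl_def by (intro polytime_intros)

subsection \<open>Iteration\<close>

lemma poly_computable_iterate:
  fixes f :: "'b::enc \<Rightarrow> 'b" and n :: "'a::enc \<Rightarrow> 'c::enc"
  assumes f: "polytime f" and start: "poly_computable t D (\<lambda>x. (n x, s x))" and q: "poly_bound q"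
    and le: "\<And>x i. x \<in> D \<Longrightarrow> i \<le> esize (n x) \<Longrightarrow> esize ((f ^^ i) (s x)) \<le> q (t x)"
  shows "poly_computable t D (\<lambda>x. (f ^^ esize (n x)) (s x))"
proof -
  obtain c p where c: "wf_com 4 c" "poly_bound p" "\<And>x. x \<in> D \<Longrightarrow> esize (n x, s x) \<le> p (t x)"
    "\<And>x. x \<in> D \<Longrightarrow> computes (p (t x)) c (enc x) (enc (n x, s x))"
    using start by (rule poly_computableE) blast
  obtain cf r where cf: "wf_com 4 cf" "poly_bound r"
    "\<And>x. computes (r (esize x)) cf (enc x) (enc (f x))"
    using f by (rule poly_computableE) blast
  show ?thesis
  proof (rule poly_computableI[OF _ _ q])
    show "wf_com 4 (c ;; iterate_com cf)" using c cf by simp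
    show "poly_bound (\<lambda>m. p m + ((2 * p m + 1) * (r (q m) + 15) + 21) + 1)"
      by (intro poly_bound_intros poly_bound_comp[OF cf(2)] c(2) q)
    fix x assume x: "x \<in> D"
    have step: "computes (r (q (t x))) cf (enc ((f ^^ i) (s x))) (enc ((f ^^ Suc i) (s x)))"
      if "i < size (enc (n x))" for i
      using computes_mono[OF cf(3)[of "(f ^^ i) (s x)"]]
        poly_bound_mono[OF cf(2) le[OF x, of i]] that by (simp add: esize_def)
    have "size (enc (n x)) \<le> p (t x)" using c(3)[OF x] by (simp add: esize_def)
    from computes_iterate_com[of "enc (n x)" _ cf "\<lambda>i. enc ((f ^^ i) (s x))", OF step this]
    have "computes ((2 * p (t x) + 1) * (r (q (t x)) + 15) + 21) (iterate_com cf)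
        (enc (n x, s x)) (enc ((f ^^ esize (n x)) (s x)))"
      by (simp add: esize_def)
    from computes_seq[OF c(4)[OF x] this]
    show "computes (p (t x) + ((2 * p (t x) + 1) * (r (q (t x)) + 15) + 21) + 1)
        (c ;; iterate_com cf) (enc x) (enc ((f ^^ esize (n x)) (s x)))" .
    show "esize ((f ^^ esize (n x)) (s x)) \<le> q (t x)" using le[OF x] by simp
  qed
qed

lemma polytime_iterate:
  fixes f :: "'a::enc \<Rightarrow> 'b::enc \<Rightarrow> 'b" and n :: "'a \<Rightarrow> 'c::enc"
  assumes f: "polytime (\<lambda>p. f (fst p) (snd p))" and n: "polytime_on D n" and s: "polytime_on D s"
    and q: "poly_bound q"
    and le: "\<And>x i. x \<in> D \<Longrightarrow> i \<le> esize (n x) \<Longrightarrow> esize ((f x ^^ i) (s x)) \<le> q (esize x)"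
  shows "polytime_on D (\<lambda>x. (f x ^^ esize (n x)) (s x))"
proof -
  let ?g = "\<lambda>p. (fst p, f (fst p) (snd p))"
  have g: "(?g ^^ i) (x, y) = (x, (f x ^^ i) y)" for i x y
    by (induction i) auto
  have "polytime_on D (\<lambda>x. (?g ^^ esize (n x)) (x, s x))"
  proof (rule poly_computable_iterate)
    show "polytime ?g" "polytime_on D (\<lambda>x. (n x, x, s x))"
      by (intro polytime_intros f n s)+
    show "poly_bound (\<lambda>m. Suc (m + q m))" by (intro poly_bound_intros q)
    show "esize ((?g ^^ i) (x, s x)) \<le> Suc (esize x + q (esize x))"
      if "x \<in> D" "i \<le> esize (n x)" for x i
      using le[OF that] by (simp add: g)
  qed
  then have "polytime_on D (\<lambda>x. snd ((?g ^^ esize (n x)) (x, s x)))"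
    by (rule polytime_snd)
  then show ?thesis by (simp add: g)
qed

lemma polytime_funpow:
  fixes f :: "'a::enc \<Rightarrow> 'b::enc \<Rightarrow> 'b"
  assumes "polytime (\<lambda>p. f (fst p) (snd p))" "polytime_on D n" "polytime_on D s" "poly_bound q"
    and "\<And>x i. x \<in> D \<Longrightarrow> i \<le> n x \<Longrightarrow> esize ((f x ^^ i) (s x)) \<le> q (esize x)"
  shows "polytime_on D (\<lambda>x. (f x ^^ n x) (s x))"
  using polytime_iterate[OF assms(1-4)] assms(5) by simp

subsection \<open>Lists\<close>

lemma polytime_fold:
  assumes g: "polytime (\<lambda>p. g (fst p) (fst (snd p)) (snd (snd p)))"
    and xs: "polytime_on D xs" and s: "polytime_on D s" and q: "poly_bound q"
    and le: "\<And>x i. x \<in> D \<Longrightarrow> esize (fold (g x) (take i (xs x)) (s x)) \<le> q (esize x)"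
  shows "polytime_on D (\<lambda>x. fold (g x) (xs x) (s x))"
proof -
  define h where "h = (\<lambda>x p. case fst p of [] \<Rightarrow> p | y # ys \<Rightarrow> (ys, g x y (snd p)))"
  have h: "(h x ^^ i) (ys, a) = (drop i ys, fold (g x) (take i ys) a)" for x i ys a
  proof (induction i arbitrary: ys a)
    case (Suc i)
    then show ?case
      unfolding funpow_Suc_right comp_apply by (cases ys) (simp_all add: h_def)
  qed simp
  obtain p where p: "poly_bound p" "\<And>x. x \<in> D \<Longrightarrow> esize (xs x) \<le> p (esize x)"
    using xs by (rule poly_computable_esizeE) blast
  have "polytime_on D (\<lambda>x. (h x ^^ esize (xs x)) (xs x, s x))"
  proof (rule polytime_iterate)
    show "polytime (\<lambda>p. h (fst p) (snd p))"
      unfolding h_def by (intro polytime_intros polytime_comp3[OF g])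
    show "polytime_on D (\<lambda>x. (xs x, s x))" by (intro polytime_intros xs s)
    show "poly_bound (\<lambda>n. Suc (p n + q n))" by (intro poly_bound_intros p q)
    show "esize ((h x ^^ i) (xs x, s x)) \<le> Suc (p (esize x) + q (esize x))" if "x \<in> D" for x i
      using le[OF that, of i] p(2)[OF that] esize_drop_le[of i "xs x"] by (simp add: h)
  qed (rule xs)
  then have "polytime_on D (\<lambda>x. snd ((h x ^^ esize (xs x)) (xs x, s x)))"
    by (rule polytime_snd)
  then show ?thesis by (simp add: h length_le_esize)
qed

lemma polytime_fold_add:
  assumes g: "polytime (\<lambda>p. g (fst p) (fst (snd p)) (snd (snd p)))"
    and xs: "polytime_on D xs" and s: "polytime_on D s" and q: "poly_bound q"
    and le: "\<And>x y a. esize (g x y a) \<le> esize a + q (esize x + esize y)"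
  shows "polytime_on D (\<lambda>x. fold (g x) (xs x) (s x))"
proof -
  obtain p where p: "poly_bound p" "\<And>x. x \<in> D \<Longrightarrow> esize (xs x) \<le> p (esize x)"
    using xs by (rule poly_computable_esizeE) blast
  obtain r where r: "poly_bound r" "\<And>x. x \<in> D \<Longrightarrow> esize (s x) \<le> r (esize x)"
    using s by (rule poly_computable_esizeE) blast
  let ?q = "\<lambda>n. q (n + p n)"
  have fold_le: "esize (fold (g x) ys a) \<le> esize a + length ys * ?q (esize x)"
    if "set ys \<subseteq> set (xs x)" "x \<in> D" for x a ys
    using that
  proof (induction ys arbitrary: a)
    case (Cons y ys)
    have "esize y \<le> p (esize x)"
      using esize_member[of y "xs x"] p(2)[of x] Cons.prems by fastforce
    then have "esize (g x y a) \<le> esize a + ?q (esize x)"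
      using le[of x y a] poly_bound_mono[OF q, of "esize x + esize y" "esize x + p (esize x)"]
      by simp
    moreover have "esize (fold (g x) ys (g x y a)) \<le> esize (g x y a) + length ys * ?q (esize x)"
      using Cons by auto
    ultimately show ?case by simp
  qed simp
  show ?thesis
  proof (rule polytime_fold[OF g xs s])
    show "poly_bound (\<lambda>n. r n + p n * ?q n)"
      by (intro poly_bound_intros poly_bound_comp[OF q] p r)
    fix x i assume x: "x \<in> D"
    let ?ys = "take i (xs x)"
    have "esize (fold (g x) ?ys (s x)) \<le> esize (s x) + length ?ys * ?q (esize x)"
      by (rule fold_le[OF set_take_subset x])
    also have "length ?ys \<le> p (esize x)"
      using length_le_esize[of "xs x"] p(2)[OF x] by simp
    finally show "esize (fold (g x) ?ys (s x)) \<le> r (esize x) + p (esize x) * ?q (esize x)"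
      using r(2)[OF x] by simp
  qed
qed

lemma polytime_rev_append:
  assumes "polytime_on D xs" "polytime_on D ys"
  shows "polytime_on D (\<lambda>x. rev (xs x) @ ys x)"
proof -
  have "polytime_on D (\<lambda>x. fold Cons (xs x) (ys x))"
    by (rule polytime_fold_add[where g = "\<lambda>_. Cons" and q = Suc])
      (auto intro!: polytime_intros assms poly_bound_intros)
  then show ?thesis by (simp add: fold_Cons_rev)
qed

lemma polytime_rev [polytime_intros]: "polytime_on D xs \<Longrightarrow> polytime_on D (\<lambda>x. rev (xs x))"
  using polytime_rev_append[of D xs "\<lambda>_. []"] by (simp add: polytime_const)

lemma polytime_append [polytime_intros]:
  "polytime_on D xs \<Longrightarrow> polytime_on D ys \<Longrightarrow> polytime_on D (\<lambda>x. xs x @ ys x)"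
  using polytime_rev_append[OF polytime_rev] by simp

lemma polytime_foldr:
  assumes "polytime (\<lambda>p. g (fst p) (fst (snd p)) (snd (snd p)))"
    and "polytime_on D xs" "polytime_on D s" "poly_bound q"
    and "\<And>x i. x \<in> D \<Longrightarrow> esize (foldr (g x) (drop i (xs x)) (s x)) \<le> q (esize x)"
  shows "polytime_on D (\<lambda>x. foldr (g x) (xs x) (s x))"
  unfolding foldr_conv_fold
  by (rule polytime_fold[OF assms(1) polytime_rev[OF assms(2)] assms(3,4)])
    (use assms(5) in \<open>simp add: take_rev foldr_conv_fold\<close>)

lemma polytime_foldr_add:
  assumes "polytime (\<lambda>p. g (fst p) (fst (snd p)) (snd (snd p)))"
    and "polytime_on D xs" "polytime_on D s" "poly_bound q"
    and "\<And>x y a. esize (g x y a) \<le> esize a + q (esize x + esize y)"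
  shows "polytime_on D (\<lambda>x. foldr (g x) (xs x) (s x))"
  unfolding foldr_conv_fold
  by (rule polytime_fold_add[OF assms(1) polytime_rev[OF assms(2)] assms(3-5)])

lemma polytime_map [polytime_intros]:
  assumes f: "polytime (\<lambda>p. f (fst p) (snd p))" and xs: "polytime_on D xs"
  shows "polytime_on D (\<lambda>x. map (f x) (xs x))"
proof -
  obtain p where p: "poly_bound p" "\<And>x. esize (f (fst x) (snd x)) \<le> p (esize x)"
    using f by (rule poly_computable_esizeE) blast
  have "polytime_on D (\<lambda>x. foldr (\<lambda>y. Cons (f x y)) (xs x) [])"
  proof (rule polytime_foldr_add[where g = "\<lambda>x y. Cons (f x y)"])
    show "polytime (\<lambda>p. f (fst p) (fst (snd p)) # snd (snd p))"
      by (intro polytime_intros polytime_comp2[OF f])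
    show "poly_bound (\<lambda>n. Suc (p (Suc n)))"
      by (intro poly_bound_intros poly_bound_comp[OF p(1)])
    show "esize (f x y # a) \<le> esize a + Suc (p (Suc (esize x + esize y)))" for x y a
      using p(2)[of "(x, y)"] by simp
  qed (intro polytime_intros xs)+
  moreover have "foldr (\<lambda>y. Cons (f x y)) ys [] = map (f x) ys" for x ys
    by (induction ys) auto
  ultimately show ?thesis by simp
qed

lemma polytime_concat [polytime_intros]:
  assumes "polytime_on D xs"
  shows "polytime_on D (\<lambda>x. concat (xs x))"
  unfolding concat_conv_foldr
  by (rule polytime_foldr_add[where g = "\<lambda>_. append" and q = "\<lambda>n. n"])
    (auto intro!: polytime_intros assms poly_bound_intros)

lemma polytime_ex_list [polytime_intros]:
  assumes f: "polytime (\<lambda>p. f (fst p) (snd p))" and xs: "polytime_on D xs"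
  shows "polytime_on D (\<lambda>x. \<exists>y\<in>set (xs x). f x y)"
proof -
  have "polytime_on D (\<lambda>x. foldr (\<lambda>y a. f x y \<or> a) (xs x) False)"
  proof (rule polytime_foldr[where g = "\<lambda>x y a. f x y \<or> a"])
    show "polytime (\<lambda>p. f (fst p) (fst (snd p)) \<or> snd (snd p))"
      by (intro polytime_intros polytime_comp2[OF f])
    show "poly_bound (\<lambda>n. 1)" by (intro poly_bound_intros)
  qed (auto intro: polytime_intros xs esize_bool_le[simplified])
  moreover have "foldr (\<lambda>y a. f x y \<or> a) ys False \<longleftrightarrow> (\<exists>y\<in>set ys. f x y)" for x ys
    by (induction ys) auto
  ultimately show ?thesis by simp
qed

lemma polytime_length [polytime_intros]:
  assumes "polytime_on D xs"
  shows "polytime_on D (\<lambda>x. length (xs x))"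
proof -
  have "polytime_on D (\<lambda>x. foldr (\<lambda>_. Suc) (xs x) 0)"
    by (rule polytime_foldr_add[where g = "\<lambda>_ _. Suc" and q = "\<lambda>_. 1"])
      (auto intro!: polytime_intros assms poly_bound_intros)
  moreover have "foldr (\<lambda>_. Suc) ys 0 = length ys" for ys :: "'b list"
    by (induction ys) auto
  ultimately show ?thesis by simp
qed

lemma polytime_takeWhile [polytime_intros]:
  assumes P: "polytime P" and xs: "polytime_on D xs"
  shows "polytime_on D (\<lambda>x. takeWhile P (xs x))"
proof -
  have "polytime_on D (\<lambda>x. foldr (\<lambda>y a. if P y then y # a else []) (xs x) [])"
  proof (rule polytime_foldr_add[where g = "\<lambda>_ y a. if P y then y # a else []"])
    show "polytime (\<lambda>p. if P (fst (snd p)) then fst (snd p) # snd (snd p) else [])"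
      for p :: "'b \<times> 'a \<times> 'a list"
      by (intro polytime_intros polytime_comp[OF P])
    show "poly_bound Suc" by (intro poly_bound_intros)
  qed (auto intro: polytime_intros xs)
  moreover have "foldr (\<lambda>y a. if P y then y # a else []) ys [] = takeWhile P ys" for ys
    by (induction ys) auto
  ultimately show ?thesis by simp
qed

lemma polytime_drop [polytime_intros]:
  assumes "polytime_on D n" "polytime_on D xs"
  shows "polytime_on D (\<lambda>x. drop (n x) (xs x))"
proof -
  have tl_funpow: "(tl ^^ i) ys = drop i ys" for i and ys :: "'b list"
    by (induction i) (simp_all add: drop_Suc tl_drop)
  obtain p where p: "poly_bound p" "\<And>x. x \<in> D \<Longrightarrow> esize (xs x) \<le> p (esize x)"
    using assms(2) by (rule poly_computable_esizeE) blast
  have "polytime_on D (\<lambda>x. (tl ^^ n x) (xs x))"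
  proof (rule polytime_funpow[where f = "\<lambda>_. tl", OF _ assms p(1)])
    show "esize ((tl ^^ i) (xs x)) \<le> p (esize x)" if "x \<in> D" for x i
      using esize_drop_le[of i "xs x"] p(2)[OF that] by (simp add: tl_funpow)
  qed (intro polytime_intros)
  then show ?thesis by (simp add: tl_funpow)
qed

lemma polytime_dropWhile [polytime_intros]:
  "polytime P \<Longrightarrow> polytime_on D xs \<Longrightarrow> polytime_on D (\<lambda>x. dropWhile P (xs x))"
  unfolding dropWhile_eq_drop by (intro polytime_intros)

lemma polytime_zip [polytime_intros]:
  assumes "polytime_on D xs" "polytime_on D ys"
  shows "polytime_on D (\<lambda>x. zip (xs x) (ys x))"
proof -
  define h :: "'b \<Rightarrow> ('b \<times> 'c) list \<times> 'c list \<Rightarrow> ('b \<times> 'c) list \<times> 'c list"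
    where "h = (\<lambda>y p. case snd p of [] \<Rightarrow> p | z # zs \<Rightarrow> ((y, z) # fst p, zs))"
  have h: "fst (fold h us (a, vs)) = rev (zip us vs) @ a" for us vs a
  proof (induction us arbitrary: a vs)
    case (Cons u us)
    have exhausted: "fold h zs (a, []) = (a, [])" for zs
      by (induction zs) (simp_all add: h_def)
    show ?case
      using Cons exhausted by (cases vs) (simp_all add: h_def)
  qed simp
  have "polytime_on D (\<lambda>x. fold h (xs x) ([], ys x))"
  proof (rule polytime_fold_add[where g = "\<lambda>_. h"])
    show "polytime (\<lambda>p. h (fst (snd p)) (snd (snd p)))"
      for p :: "'a \<times> 'b \<times> ('b \<times> 'c) list \<times> 'c list"
      unfolding h_def by (intro polytime_intros)
    show "poly_bound (\<lambda>n. n + 2)" by (intro poly_bound_intros)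
    show "esize (h y a) \<le> esize a + (esize x + esize y + 2)" for x :: 'a and y a
      by (cases a) (auto simp: h_def split: list.splits)
  qed (intro polytime_intros assms)+
  then have "polytime_on D (\<lambda>x. rev (fst (fold h (xs x) ([], ys x))))" by (intro polytime_intros)
  then show ?thesis by (simp add: h)
qed

lemma polytime_upt [polytime_intros]:
  assumes "polytime_on D n"
  shows "polytime_on D (\<lambda>x. [0..<n x])"
proof (rule polytime_comp[OF _ assms])
  have grow: "((\<lambda>ks. ks @ [length ks]) ^^ i) [] = [0..<i]" for i
    by (induction i) simp_all
  have "polytime (\<lambda>n. ((\<lambda>ks. ks @ [length ks]) ^^ n) [])"
  proof (rule polytime_funpow[where f = "\<lambda>_ ks. ks @ [length ks]"])
    show "poly_bound (\<lambda>n. n * Suc n)" by (intro poly_bound_intros)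
    fix i n :: nat assume i: "i \<le> n"
    have "esize [0..<i] \<le> length [0..<i] * Suc n"
      using i by (intro esize_list_le) simp
    also have "\<dots> \<le> esize n * Suc (esize n)"
      unfolding length_upt esize_nat using i by (intro mult_le_mono1) simp
    finally show "esize (((\<lambda>ks. ks @ [length ks]) ^^ i) []) \<le> esize n * Suc (esize n)"
      unfolding grow .
  qed (intro polytime_intros)+
  then show "polytime (\<lambda>n. [0..<n])" unfolding grow .
qed

subsection \<open>Natural numbers and integers\<close>

lemma polytime_add [polytime_intros]:
  assumes "polytime_on D f" "polytime_on D g"
  shows "polytime_on D (\<lambda>x. f x + g x :: nat)"
proof -
  obtain p where p: "poly_bound p" "\<And>x. x \<in> D \<Longrightarrow> esize (f x) \<le> p (esize x)"
    using assms(1) by (rule poly_computable_esizeE) blast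
  obtain q where q: "poly_bound q" "\<And>x. x \<in> D \<Longrightarrow> esize (g x) \<le> q (esize x)"
    using assms(2) by (rule poly_computable_esizeE) blast
  have "polytime_on D (\<lambda>x. (Suc ^^ f x) (g x))"
  proof (rule polytime_funpow[where f = "\<lambda>_. Suc", OF _ assms])
    show "poly_bound (\<lambda>n. p n + q n)" by (intro poly_bound_intros p q)
    show "esize ((Suc ^^ i) (g x)) \<le> p (esize x) + q (esize x)" if "x \<in> D" "i \<le> f x" for x i
      using p(2)[OF that(1)] q(2)[OF that(1)] that(2) by simp
  qed (intro polytime_intros)
  then show ?thesis by simp
qed

lemma polytime_mult [polytime_intros]:
  assumes "polytime_on D f" "polytime_on D g"
  shows "polytime_on D (\<lambda>x. f x * g x :: nat)"
proof (rule polytime_comp2[OF _ assms])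
  have funpow_plus: "((+) m ^^ i) 0 = i * m" for i m :: nat
    by (induction i) simp_all
  have "polytime (\<lambda>p :: nat \<times> nat. ((+) (snd p) ^^ fst p) 0)"
  proof (rule polytime_funpow)
    show "poly_bound (\<lambda>n. n * n)" by (intro poly_bound_intros)
    show "esize (((+) (snd p) ^^ i) 0) \<le> esize p * esize p"
      if "i \<le> fst p" for p :: "nat \<times> nat" and i
      unfolding funpow_plus esize_nat using that esize_prod[of p] by (intro mult_le_mono) simp_all
  qed (intro polytime_intros)+
  then show "polytime (\<lambda>p :: nat \<times> nat. fst p * snd p)" unfolding funpow_plus .
qed

lemma polytime_power [polytime_intros]:
  "polytime_on D f \<Longrightarrow> polytime_on D (\<lambda>x. f x ^ k :: nat)"
  by (induction k) (auto intro: polytime_intros)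

lemma polytime_diff [polytime_intros]:
  assumes "polytime_on D f" "polytime_on D g"
  shows "polytime_on D (\<lambda>x. f x - g x :: nat)"
proof (rule polytime_comp2[OF _ assms])
  let ?pred = "\<lambda>m. case m of 0 \<Rightarrow> 0 | Suc k \<Rightarrow> k"
  have funpow_pred: "(?pred ^^ i) m = m - i" for m i :: nat
    by (induction i) (auto split: nat.splits)
  have "polytime (\<lambda>p :: nat \<times> nat. (?pred ^^ snd p) (fst p))"
  proof (rule polytime_funpow[where f = "\<lambda>_. ?pred"])
    show "poly_bound (\<lambda>n. n)" by (intro poly_bound_intros)
    show "esize ((?pred ^^ i) (fst p)) \<le> esize p" for p :: "nat \<times> nat" and i
      unfolding funpow_pred using esize_prod[of p] by simp
  qed (intro polytime_intros)+
  then show "polytime (\<lambda>p :: nat \<times> nat. fst p - snd p)" unfolding funpow_pred .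
qed

lemma polytime_int_view [polytime_intros]: "polytime_on D f \<Longrightarrow> polytime_on D (\<lambda>x. int_view (f x))"
  by (erule poly_computable_recode) (simp add: enc_int_def)

lemma polytime_of_int_view:
  "polytime_on D f \<Longrightarrow> (\<And>x. x \<in> D \<Longrightarrow> int_view (g x) = f x) \<Longrightarrow> polytime_on D g"
  by (erule poly_computable_recode) (simp add: enc_int_def)

lemma polytime_int [polytime_intros]:
  assumes "polytime_on D f"
  shows "polytime_on D (\<lambda>x. int (f x))"
  by (rule polytime_of_int_view[OF polytime_Pair[OF polytime_const[of D True] assms]])
    (simp add: int_view_def)

lemma polytime_int_add_1 [polytime_intros]:
  assumes "polytime_on D f"
  shows "polytime_on D (\<lambda>x. f x + 1 :: int)"
proof (rule polytime_of_int_view)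
  show "polytime_on D (\<lambda>x. if fst (int_view (f x)) then (True, Suc (snd (int_view (f x))))
      else (case snd (int_view (f x)) of 0 \<Rightarrow> (True, 0) | Suc n \<Rightarrow> (False, n)))"
    by (intro polytime_intros assms)
qed (auto simp: int_view_def nat_add_distrib split: nat.splits)

lemma polytime_int_minus_1 [polytime_intros]:
  assumes "polytime_on D f"
  shows "polytime_on D (\<lambda>x. f x - 1 :: int)"
proof (rule polytime_of_int_view)
  show "polytime_on D (\<lambda>x. if fst (int_view (f x))
      then (case snd (int_view (f x)) of 0 \<Rightarrow> (False, 0) | Suc n \<Rightarrow> (True, n))
      else (False, Suc (snd (int_view (f x)))))"
    by (intro polytime_intros assms)
qed (auto simp: int_view_def split: nat.splits)

subsection \<open>Equality and finite tables\<close>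

text \<open>Two trees are compared with a list of pairs of subtrees that have yet to agree; the
  comparison gets stuck at a pair whose roots differ.\<close>

definition match_step :: "(tree \<times> tree) list \<Rightarrow> (tree \<times> tree) list" where
  "match_step ps = (case ps of [] \<Rightarrow> [] | p # qs \<Rightarrow>
     (case fst p of
        Lf \<Rightarrow> (case snd p of Lf \<Rightarrow> qs | Nd l r \<Rightarrow> ps)
      | Nd a b \<Rightarrow> (case snd p of Lf \<Rightarrow> ps | Nd l r \<Rightarrow> (a, l) # (b, r) # qs)))"

definition all_match :: "(tree \<times> tree) list \<Rightarrow> bool" where
  "all_match ps \<longleftrightarrow> list_all (\<lambda>p. fst p = snd p) ps"

lemma polytime_match_step: "polytime match_step"
  unfolding match_step_def by (intro polytime_intros)

lemma all_match_step: "all_match (match_step ps) \<longleftrightarrow> all_match ps"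
  by (auto simp: match_step_def all_match_def split: list.splits tree.splits)

lemma all_match_steps: "all_match ((match_step ^^ i) ps) \<longleftrightarrow> all_match ps"
  by (induction i) (simp_all add: all_match_step)

lemma esize_match_step_le: "esize (match_step ps) \<le> esize ps"
  by (auto simp: match_step_def esize_def split: list.splits tree.splits)

lemma esize_match_steps_le: "esize ((match_step ^^ i) ps) \<le> esize ps"
  by (induction i) (simp_all add: le_trans[OF esize_match_step_le])

lemma match_steps_eq_Nil:
  "all_match ps \<Longrightarrow> (\<Sum>p\<leftarrow>ps. 2 * size (fst p) + 1) \<le> i \<Longrightarrow> (match_step ^^ i) ps = []"
proof (induction i arbitrary: ps)
  case 0
  then show ?case by (cases ps) simp_all
next
  case (Suc i)
  then have "(\<Sum>p\<leftarrow>match_step ps. 2 * size (fst p) + 1) \<le> i"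
    by (auto simp: match_step_def all_match_def split: list.splits tree.splits)
  then show ?case
    unfolding funpow_Suc_right comp_apply using Suc by (simp add: all_match_step)
qed

lemma polytime_eq [polytime_intros]:
  assumes "polytime_on D f" "polytime_on D g"
  shows "polytime_on D (\<lambda>x. f x = g x)"
proof -
  let ?s = "\<lambda>x. [(enc (f x), enc (g x))]" and ?n = "\<lambda>x. Nd (enc (f x)) (enc (f x))"
  let ?r = "\<lambda>x. (match_step ^^ esize (?n x)) (?s x)"
  have s: "polytime_on D ?s" by (intro polytime_intros assms)
  obtain p where p: "poly_bound p" "\<And>x. x \<in> D \<Longrightarrow> esize (?s x) \<le> p (esize x)"
    using s by (rule poly_computable_esizeE) blast
  have "polytime_on D ?r"
  proof (rule polytime_iterate[where f = "\<lambda>_. match_step", OF _ _ s p(1)])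
    show "polytime (\<lambda>p. match_step (snd p))" for p :: "'a \<times> (tree \<times> tree) list"
      by (intro polytime_comp[OF polytime_match_step] polytime_intros)
    show "esize ((match_step ^^ i) (?s x)) \<le> p (esize x)" if "x \<in> D" for x i
      using esize_match_steps_le p(2)[OF that] by (rule le_trans)
  qed (intro polytime_intros assms)
  then have "polytime_on D (\<lambda>x. case ?r x of [] \<Rightarrow> True | _ # _ \<Rightarrow> False)"
    by (intro polytime_intros)
  moreover have "(case ps of [] \<Rightarrow> True | _ # _ \<Rightarrow> False) \<longleftrightarrow> ps = []" for ps :: "(tree \<times> tree) list"
    by (simp split: list.split)
  moreover have "?r x = [] \<longleftrightarrow> f x = g x" for x
  proof
    assume "?r x = []"
    then have "all_match (?s x)"
      using all_match_steps[of "esize (?n x)" "?s x"] by (simp add: all_match_def)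
    then show "f x = g x" by (auto simp: all_match_def dest: enc_inject)
  next
    assume "f x = g x"
    then show "?r x = []"
      by (intro match_steps_eq_Nil) (simp_all add: all_match_def esize_def)
  qed
  ultimately show ?thesis by simp
qed

lemma polytime_le [polytime_intros]:
  assumes "polytime_on D f" "polytime_on D g"
  shows "polytime_on D (\<lambda>x. f x \<le> (g x :: nat))"
proof -
  have "polytime_on D (\<lambda>x. f x - g x = 0)" by (intro polytime_intros assms)
  then show ?thesis by simp
qed

lemma polytime_table:
  fixes f :: "'a::enc \<Rightarrow> 'b::enc"
  assumes "finite S"
  obtains g where "polytime g" "\<And>x. x \<in> S \<Longrightarrow> g x = f x" "range g \<subseteq> insert d (f ` S)"
proof -
  have "\<exists>g. polytime g \<and> (\<forall>x\<in>S. g x = f x) \<and> range g \<subseteq> insert d (f ` S)"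
    using assms
  proof (induction S)
    case empty
    show ?case using polytime_const[of UNIV d] by (intro exI[of _ "\<lambda>_. d"]) auto
  next
    case (insert a S)
    then obtain g where g: "polytime g" "\<forall>x\<in>S. g x = f x" "range g \<subseteq> insert d (f ` S)" by blast
    have "polytime (\<lambda>x. if x = a then f a else g x)" by (intro polytime_intros g)
    moreover have "range (\<lambda>x. if x = a then f a else g x) \<subseteq> insert d (f ` insert a S)"
      using g(3) by auto
    ultimately show ?case using g(2) by (intro exI[of _ "\<lambda>x. if x = a then f a else g x"]) auto
  qed
  then show ?thesis using that by blast
qed

subsection \<open>Indexed access to lists\<close>

lemma polytime_take [polytime_intros]:
  assumes "polytime_on D n" "polytime_on D xs"
  shows "polytime_on D (\<lambda>x. take (n x) (xs x))"
proof -
  have "take i ys = rev (drop (length ys - i) (rev ys))" for i and ys :: "'b list"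
    by (simp add: rev_take[symmetric])
  then show ?thesis using assms by (simp only:) (intro polytime_intros)
qed

lemma polytime_nth_default [polytime_intros]:
  assumes "polytime_on D n" "polytime_on D xs"
  shows "polytime_on D (\<lambda>x. nth_default d (xs x) (n x))"
proof -
  have "nth_default d ys i = (case drop i ys of [] \<Rightarrow> d | y # _ \<Rightarrow> y)" for i ys
    by (auto simp: nth_default_def nth_via_drop split: list.split)
  then show ?thesis using assms by (simp only:) (intro polytime_intros)
qed

lemma polytime_list_update [polytime_intros]:
  assumes "polytime_on D n" "polytime_on D xs" "polytime_on D y"
  shows "polytime_on D (\<lambda>x. (xs x)[n x := y x])"
proof -
  have "ys[i := z] = (if Suc i \<le> length ys then take i ys @ z # drop (Suc i) ys else ys)"
    for i z and ys :: "'b list"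
    by (simp add: upd_conv_take_nth_drop list_update_beyond not_le)
  then show ?thesis using assms by (simp only:) (intro polytime_intros)
qed

section \<open>Binary arithmetic\<close>

abbreviation nat_of_bits :: "bool list \<Rightarrow> nat" where
  "nat_of_bits \<equiv> horner_sum of_bool 2"

lemma nat_of_bits_less: "nat_of_bits xs < 2 ^ length xs"
  by (induction xs) (auto simp: of_bool_def)

lemma nat_of_bits_append: "nat_of_bits (xs @ ys) = nat_of_bits xs + 2 ^ length xs * nat_of_bits ys"
  by (simp add: horner_sum_append)

lemma nat_of_bits_zeros [simp]: "nat_of_bits (map (\<lambda>_. False) ys) = 0"
  by (induction ys) auto

lemma nat_of_bits_eq_0: "nat_of_bits xs = 0 \<longleftrightarrow> (\<forall>x\<in>set xs. \<not> x)"
  by (induction xs) auto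

lemma nat_of_bits_mult_less: "nat_of_bits xs * nat_of_bits ys < 2 ^ (length xs + length ys)"
  unfolding power_add using nat_of_bits_less by (intro mult_strict_mono) auto

lemma esize_bits_le: "esize (xs :: bool list) \<le> 2 * length xs"
  using esize_list_le[of xs 1] esize_bool_le by simp

subsection \<open>Addition, subtraction and comparison\<close>

text \<open>Addition with carry, or subtraction with borrow if \<open>s\<close> is set, on the length of the first
  argument.\<close>

primrec ripple :: "bool \<Rightarrow> bool list \<Rightarrow> bool list \<Rightarrow> bool \<Rightarrow> bool list \<times> bool" where
  "ripple s [] ys c = ([], c)"
| "ripple s (x # xs) ys c =
     (let y = (ys \<noteq> [] \<and> hd ys);
          r = ripple s xs (tl ys) (((x \<noteq> s) \<and> (y \<or> c)) \<or> (y \<and> c))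
      in ((x \<noteq> (y \<noteq> c)) # fst r, snd r))"

lemma length_ripple [simp]: "length (fst (ripple s xs ys c)) = length xs"
  by (induction xs arbitrary: ys c) (simp_all add: Let_def)

lemma ripple_add:
  "nat_of_bits (fst (ripple False xs ys c)) + 2 ^ length xs * of_bool (snd (ripple False xs ys c)) =
   of_bool c + nat_of_bits xs + nat_of_bits (take (length xs) ys)"
proof (induction xs arbitrary: ys c)
  case (Cons x xs)
  show ?case
  proof (cases ys)
    case Nil
    show ?thesis using Cons[of "[]" "x \<and> c"] by (cases x; cases c) (simp_all add: Nil Let_def)
  next
    case (Cons y zs)
    show ?thesis using Cons.IH[of zs "x \<and> (y \<or> c) \<or> y \<and> c"]
      by (cases x; cases y; cases c) (simp_all add: Cons Let_def)
  qed
qed simp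

lemma ripple_sub:
  "nat_of_bits (fst (ripple True xs ys c)) + of_bool c + nat_of_bits (take (length xs) ys) =
   nat_of_bits xs + 2 ^ length xs * of_bool (snd (ripple True xs ys c))"
proof (induction xs arbitrary: ys c)
  case (Cons x xs)
  show ?case
  proof (cases ys)
    case Nil
    show ?thesis using Cons[of "[]" "\<not> x \<and> c"] by (cases x; cases c) (simp_all add: Nil Let_def)
  next
    case (Cons y zs)
    show ?thesis using Cons.IH[of zs "\<not> x \<and> (y \<or> c) \<or> y \<and> c"]
      by (cases x; cases y; cases c) (simp_all add: Cons Let_def)
  qed
qed simp

definition ripple_step ::
    "bool \<Rightarrow> bool \<Rightarrow> bool list \<times> bool list \<times> bool \<Rightarrow> bool list \<times> bool list \<times> bool" where
  "ripple_step s x p =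
     (case fst (snd p) of
        [] \<Rightarrow> ((x \<noteq> snd (snd p)) # fst p, [], (x \<noteq> s) \<and> snd (snd p))
      | y # ys \<Rightarrow> ((x \<noteq> (y \<noteq> snd (snd p))) # fst p, ys,
          ((x \<noteq> s) \<and> (y \<or> snd (snd p))) \<or> (y \<and> snd (snd p))))"

lemma fold_ripple_step:
  "fold (ripple_step s) xs (a, ys, c) =
   (rev (fst (ripple s xs ys c)) @ a, drop (length xs) ys, snd (ripple s xs ys c))"
proof (induction xs arbitrary: a ys c)
  case (Cons x xs)
  show ?case by (cases ys) (simp_all add: ripple_step_def Cons[unfolded ripple_step_def] Let_def)
qed simp

lemma polytime_ripple [polytime_intros]:
  assumes "polytime_on D f" "polytime_on D g"
  shows "polytime_on D (\<lambda>x. ripple s (f x) (g x) c)"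
proof -
  have "polytime_on D (\<lambda>x. fold (ripple_step s) (f x) ([], g x, c))"
  proof (rule polytime_fold_add[where g = "\<lambda>_. ripple_step s"])
    show "polytime (\<lambda>p. ripple_step s (fst (snd p)) (snd (snd p)))"
      for p :: "'a \<times> bool \<times> bool list \<times> bool list \<times> bool"
      unfolding ripple_step_def by (intro polytime_intros)
    show "poly_bound (\<lambda>n. 3)" by (intro poly_bound_intros)
    have two_bits: "esize b + esize b' \<le> 2" for b b' :: bool
      using esize_bool_le[of b] esize_bool_le[of b'] by linarith
    show "esize (ripple_step s y p) \<le> esize p + 3" for y p
      by (cases p) (auto simp: ripple_step_def intro!: le_trans[OF two_bits] split: list.split)
  qed (intro polytime_intros assms)+
  then have "polytime_on D (\<lambda>x. (rev (fst (fold (ripple_step s) (f x) ([], g x, c))),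
      snd (snd (fold (ripple_step s) (f x) ([], g x, c)))))"
    by (intro polytime_intros)
  then show ?thesis by (simp add: fold_ripple_step)
qed

definition add_bits :: "bool list \<Rightarrow> bool list \<Rightarrow> bool list" where
  "add_bits xs ys = (let r = ripple False (xs @ map (\<lambda>_. False) ys) ys False in fst r @ [snd r])"

definition sub_bits :: "bool list \<Rightarrow> bool list \<Rightarrow> bool list" where
  "sub_bits xs ys = fst (ripple True xs ys False)"

definition less_bits :: "bool list \<Rightarrow> bool list \<Rightarrow> bool" where
  "less_bits xs ys = snd (ripple True (xs @ map (\<lambda>_. False) ys) ys False)"

lemma nat_of_bits_add: "nat_of_bits (add_bits xs ys) = nat_of_bits xs + nat_of_bits ys"
  using ripple_add[of "xs @ map (\<lambda>_. False) ys" ys False]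
  by (simp add: add_bits_def Let_def nat_of_bits_append)

lemma length_add_bits: "length (add_bits xs ys) = length xs + length ys + 1"
  by (simp add: add_bits_def Let_def)

lemma length_sub_bits [simp]: "length (sub_bits xs ys) = length xs"
  by (simp add: sub_bits_def)

lemma less_bits_iff: "less_bits xs ys \<longleftrightarrow> nat_of_bits xs < nat_of_bits ys"
proof -
  let ?xs = "xs @ map (\<lambda>_. False) ys"
  have "nat_of_bits (fst (ripple True ?xs ys False)) + nat_of_bits ys =
      nat_of_bits xs + 2 ^ length ?xs * of_bool (less_bits xs ys)"
    using ripple_sub[of ?xs ys False] by (simp add: less_bits_def nat_of_bits_append)
  moreover have "nat_of_bits (fst (ripple True ?xs ys False)) < 2 ^ length ?xs"
    using nat_of_bits_less[of "fst (ripple True ?xs ys False)"] by simp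
  ultimately show ?thesis by (cases "less_bits xs ys") auto
qed

lemma nat_of_bits_take:
  assumes "nat_of_bits ys < 2 ^ n"
  shows "nat_of_bits (take n ys) = nat_of_bits ys"
proof (cases "n \<le> length ys")
  case True
  have split: "nat_of_bits ys = nat_of_bits (take n ys) + 2 ^ n * nat_of_bits (drop n ys)"
    using nat_of_bits_append[of "take n ys" "drop n ys"] True by simp
  then have "2 ^ n * nat_of_bits (drop n ys) < 2 ^ n * 1" using assms by linarith
  then have "nat_of_bits (drop n ys) = 0" by (simp only: mult_less_cancel1) simp
  with split show ?thesis by simp
qed simp

lemma nat_of_bits_sub:
  assumes "nat_of_bits ys \<le> nat_of_bits xs"
  shows "nat_of_bits (sub_bits xs ys) = nat_of_bits xs - nat_of_bits ys"
proof -
  have "nat_of_bits (take (length xs) ys) = nat_of_bits ys"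
    by (rule nat_of_bits_take[OF le_less_trans[OF assms nat_of_bits_less]])
  then have "nat_of_bits (sub_bits xs ys) + nat_of_bits ys =
      nat_of_bits xs + 2 ^ length xs * of_bool (snd (ripple True xs ys False))"
    using ripple_sub[of xs ys False] by (simp add: sub_bits_def)
  moreover have "nat_of_bits (sub_bits xs ys) < 2 ^ length xs"
    using nat_of_bits_less[of "sub_bits xs ys"] by simp
  ultimately show ?thesis
    using assms by (cases "snd (ripple True xs ys False)") auto
qed

lemma polytime_add_bits [polytime_intros]:
  "polytime_on D f \<Longrightarrow> polytime_on D g \<Longrightarrow> polytime_on D (\<lambda>x. add_bits (f x) (g x))"
  unfolding add_bits_def Let_def by (intro polytime_intros)

lemma polytime_sub_bits [polytime_intros]:
  "polytime_on D f \<Longrightarrow> polytime_on D g \<Longrightarrow> polytime_on D (\<lambda>x. sub_bits (f x) (g x))"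
  unfolding sub_bits_def by (intro polytime_intros)

lemma polytime_less_bits [polytime_intros]:
  "polytime_on D f \<Longrightarrow> polytime_on D g \<Longrightarrow> polytime_on D (\<lambda>x. less_bits (f x) (g x))"
  unfolding less_bits_def by (intro polytime_intros)

subsection \<open>Multiplication and division\<close>

definition mult_bits :: "bool list \<Rightarrow> bool list \<Rightarrow> bool list" where
  "mult_bits xs ys = foldr (\<lambda>y a. add_bits (False # a) (if y then xs else [])) ys []"

lemma nat_of_bits_mult: "nat_of_bits (mult_bits xs ys) = nat_of_bits xs * nat_of_bits ys"
  by (induction ys) (auto simp: mult_bits_def nat_of_bits_add algebra_simps)

lemma length_mult_bits_le: "length (mult_bits xs ys) \<le> length ys * (length xs + 2)"
  by (induction ys) (auto simp: mult_bits_def length_add_bits)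

lemma polytime_mult_bits [polytime_intros]:
  assumes "polytime_on D f" "polytime_on D g"
  shows "polytime_on D (\<lambda>x. mult_bits (f x) (g x))"
proof (rule polytime_comp2[OF _ assms])
  show "polytime (\<lambda>p. mult_bits (fst p) (snd p))"
    unfolding mult_bits_def
  proof (rule polytime_foldr[where g = "\<lambda>p y a. add_bits (False # a) (if y then fst p else [])"])
    show "poly_bound (\<lambda>n. 2 * (n * (n + 2)))" by (intro poly_bound_intros)
    fix p :: "bool list \<times> bool list" and i
    have "length (mult_bits (fst p) (drop i (snd p)))
        \<le> length (drop i (snd p)) * (length (fst p) + 2)"
      by (rule length_mult_bits_le)
    also have "\<dots> \<le> esize p * (esize p + 2)"
      using length_le_esize[of "fst p"] length_le_esize[of "snd p"] esize_prod[of p]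
      by (intro mult_le_mono) auto
    finally show "esize (foldr (\<lambda>y a. add_bits (False # a) (if y then fst p else []))
          (drop i (snd p)) [])
        \<le> 2 * (esize p * (esize p + 2))"
      using esize_bits_le[of "mult_bits (fst p) (drop i (snd p))"] by (simp add: mult_bits_def)
  qed (intro polytime_intros)+
qed

definition divmod_step :: "bool list \<Rightarrow> bool \<Rightarrow> bool list \<times> bool list \<Rightarrow> bool list \<times> bool list" where
  "divmod_step d x p = (if less_bits (x # snd p) d then (False # fst p, x # snd p)
     else (True # fst p, sub_bits (x # snd p) d))"

definition divmod_bits :: "bool list \<Rightarrow> bool list \<Rightarrow> bool list \<times> bool list" where
  "divmod_bits xs d = foldr (divmod_step d) xs ([], [])"

lemma divmod_step_correct:
  assumes "p' = divmod_step d x p" "nat_of_bits (snd p) < nat_of_bits d"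
  shows "nat_of_bits (fst p') * nat_of_bits d + nat_of_bits (snd p') =
      of_bool x + 2 * (nat_of_bits (fst p) * nat_of_bits d + nat_of_bits (snd p)) \<and>
    nat_of_bits (snd p') < nat_of_bits d"
proof (cases "less_bits (x # snd p) d")
  case True
  then show ?thesis using assms(1) by (auto simp: divmod_step_def less_bits_iff)
next
  case False
  then have le: "nat_of_bits d \<le> nat_of_bits (x # snd p)" by (simp add: less_bits_iff)
  have "nat_of_bits (snd p') = nat_of_bits (x # snd p) - nat_of_bits d"
    "nat_of_bits (fst p') = 1 + 2 * nat_of_bits (fst p)"
    using False nat_of_bits_sub[OF le] assms(1) by (simp_all add: divmod_step_def)
  then show ?thesis using le assms(2) by (auto simp: algebra_simps of_bool_def split: if_splits)
qed

lemma divmod_bits_invariant: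
  assumes "0 < nat_of_bits d"
  shows "nat_of_bits (fst (divmod_bits xs d)) * nat_of_bits d +
      nat_of_bits (snd (divmod_bits xs d)) = nat_of_bits xs \<and>
    nat_of_bits (snd (divmod_bits xs d)) < nat_of_bits d"
proof (induction xs)
  case Nil
  show ?case using assms by (simp add: divmod_bits_def)
next
  case (Cons x xs)
  have "divmod_bits (x # xs) d = divmod_step d x (divmod_bits xs d)"
    by (simp add: divmod_bits_def)
  from divmod_step_correct[OF this] show ?case using Cons by simp
qed

lemma nat_of_bits_divmod:
  assumes "0 < nat_of_bits d"
  shows "nat_of_bits (fst (divmod_bits xs d)) = nat_of_bits xs div nat_of_bits d"
    and "nat_of_bits (snd (divmod_bits xs d)) = nat_of_bits xs mod nat_of_bits d"
  using divmod_bits_invariant[OF assms, of xs]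
  by (metis add.commute div_mult_self3 div_less add_0 assms less_not_refl,
      metis mod_mult_self3 mod_less)

lemma length_divmod_bits [simp]:
  "length (fst (divmod_bits xs d)) = length xs" "length (snd (divmod_bits xs d)) = length xs"
  by (induction xs) (auto simp: divmod_bits_def divmod_step_def)

lemma polytime_divmod_bits [polytime_intros]:
  assumes "polytime_on D f" "polytime_on D g"
  shows "polytime_on D (\<lambda>x. divmod_bits (f x) (g x))"
proof (rule polytime_comp2[OF _ assms])
  show "polytime (\<lambda>p. divmod_bits (fst p) (snd p))"
    unfolding divmod_bits_def
  proof (rule polytime_foldr[where g = "\<lambda>p. divmod_step (snd p)"])
    show "polytime (\<lambda>p. divmod_step (snd (fst p)) (fst (snd p)) (snd (snd p)))"
      for p :: "(bool list \<times> bool list) \<times> bool \<times> bool list \<times> bool list"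
      unfolding divmod_step_def by (intro polytime_intros)
    show "poly_bound (\<lambda>n. 1 + 4 * n)" by (intro poly_bound_intros)
    fix p :: "bool list \<times> bool list" and i
    let ?r = "divmod_bits (drop i (fst p)) (snd p)"
    have "length (fst ?r) \<le> esize p" "length (snd ?r) \<le> esize p"
      using length_le_esize[of "fst p"] esize_prod[of p] by simp_all
    then show "esize (foldr (divmod_step (snd p)) (drop i (fst p)) ([], [])) \<le> 1 + 4 * esize p"
      using esize_bits_le[of "fst ?r"] esize_bits_le[of "snd ?r"] esize_prod[of ?r]
      unfolding divmod_bits_def by simp
  qed (intro polytime_intros)+
qed

subsection \<open>Greatest common divisors\<close>

definition euclid_step :: "nat \<times> nat \<Rightarrow> nat \<times> nat" where
  "euclid_step p = (if snd p = 0 then p else (snd p, fst p mod snd p))"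

text \<open>A step from \<open>a \<ge> b\<close> at least halves the product of the two numbers.\<close>

lemma euclid_steps_ordered:
  "b \<le> a \<Longrightarrow> a * b < 2 ^ n \<Longrightarrow> (euclid_step ^^ n) (a, b) = (gcd a b, 0)"
proof (induction n arbitrary: a b)
  case 0
  then show ?case by auto
next
  case (Suc n)
  show ?case
  proof (cases "b = 0")
    case True
    then have "euclid_step (a, b) = (a, b)" by (simp add: euclid_step_def)
    then show ?thesis
      using Suc.IH[of 0 a] True unfolding funpow_Suc_right comp_apply by simp
  next
    case False
    have "1 \<le> a div b" using Suc.prems(1) False by (simp add: div_greater_zero_iff Suc_le_eq)
    then have "b + a mod b \<le> a"
      using div_mult_mod_eq[of a b] mult_le_mono1[of 1 "a div b" b] by linarith
    moreover have less: "a mod b < b" using False by simp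
    ultimately have "2 * (a mod b) \<le> a" by linarith
    then have "2 * (b * (a mod b)) \<le> a * b"
      using mult_le_mono1[of "2 * (a mod b)" a b] by (simp add: mult.commute mult.left_commute)
    then have "b * (a mod b) < 2 ^ n" using Suc.prems(2) unfolding power_Suc by linarith
    then have "(euclid_step ^^ n) (b, a mod b) = (gcd b (a mod b), 0)"
      using Suc.IH[of "a mod b" b] less by simp
    then show ?thesis
      unfolding funpow_Suc_right comp_apply using False
      by (simp add: euclid_step_def gcd_red_nat[of a b])
  qed
qed

lemma euclid_steps:
  assumes "a * b < 2 ^ n"
  shows "(euclid_step ^^ Suc n) (a, b) = (gcd a b, 0)"
proof (cases "b = 0")
  case True
  then have "euclid_step (a, b) = (a, b)" by (simp add: euclid_step_def)
  then show ?thesis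
    using euclid_steps_ordered[of 0 a n] True unfolding funpow_Suc_right comp_apply by simp
next
  case False
  have "b * (a mod b) \<le> a * b"
    using mult_le_mono2[OF mod_less_eq_dividend[of a b], of b] by (simp add: mult.commute)
  then have "b * (a mod b) < 2 ^ n" using assms by (rule le_less_trans)
  then have "(euclid_step ^^ n) (b, a mod b) = (gcd b (a mod b), 0)"
    using False by (intro euclid_steps_ordered) auto
  then show ?thesis
    unfolding funpow_Suc_right comp_apply using False
    by (simp add: euclid_step_def gcd_red_nat[of a b])
qed

definition gcd_step :: "bool list \<times> bool list \<Rightarrow> bool list \<times> bool list" where
  "gcd_step p = (if \<exists>y\<in>set (snd p). y then (snd p, snd (divmod_bits (fst p) (snd p))) else p)"

definition gcd_bits :: "bool list \<Rightarrow> bool list \<Rightarrow> bool list" where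
  "gcd_bits xs ys = fst ((gcd_step ^^ Suc (length xs + length ys)) (xs, ys))"

lemma gcd_step_euclid:
  "map_prod nat_of_bits nat_of_bits (gcd_step p) = euclid_step (map_prod nat_of_bits nat_of_bits p)"
proof (cases "nat_of_bits (snd p) = 0")
  case True
  then show ?thesis by (auto simp: gcd_step_def euclid_step_def nat_of_bits_eq_0)
next
  case False
  then have "\<exists>y\<in>set (snd p). y" by (simp add: nat_of_bits_eq_0)
  with False show ?thesis using nat_of_bits_divmod[of "snd p"]
    by (simp add: gcd_step_def euclid_step_def map_prod_def split_beta)
qed

lemma nat_of_bits_gcd: "nat_of_bits (gcd_bits xs ys) = gcd (nat_of_bits xs) (nat_of_bits ys)"
proof -
  let ?n = "Suc (length xs + length ys)"
  have "map_prod nat_of_bits nat_of_bits ((gcd_step ^^ n) p) =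
      (euclid_step ^^ n) (map_prod nat_of_bits nat_of_bits p)" for n p
    by (induction n) (simp_all add: gcd_step_euclid)
  from this[of ?n "(xs, ys)"]
  have "map_prod nat_of_bits nat_of_bits ((gcd_step ^^ ?n) (xs, ys)) =
      (gcd (nat_of_bits xs) (nat_of_bits ys), 0)"
    using euclid_steps[OF nat_of_bits_mult_less] by (simp only: map_prod_simp)
  then show ?thesis unfolding gcd_bits_def by (metis fst_conv fst_map_prod)
qed

lemma length_gcd_steps_le:
  "length (fst p) \<le> m \<Longrightarrow> length (snd p) \<le> m \<Longrightarrow>
   length (fst ((gcd_step ^^ n) p)) \<le> m \<and> length (snd ((gcd_step ^^ n) p)) \<le> m"
  by (induction n) (auto simp: gcd_step_def)

lemma polytime_gcd_bits [polytime_intros]: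
  assumes "polytime_on D f" "polytime_on D g"
  shows "polytime_on D (\<lambda>x. gcd_bits (f x) (g x))"
proof (rule polytime_comp2[OF _ assms])
  have "polytime (\<lambda>p. (gcd_step ^^ Suc (length (fst p) + length (snd p))) (fst p, snd p))"
  proof (rule polytime_funpow[where f = "\<lambda>_. gcd_step"])
    show "polytime (\<lambda>p. gcd_step (snd p))"
      for p :: "(bool list \<times> bool list) \<times> bool list \<times> bool list"
      unfolding gcd_step_def by (intro polytime_intros)
    show "poly_bound (\<lambda>n. 1 + 4 * n)" by (intro poly_bound_intros)
    fix p :: "bool list \<times> bool list" and i
    let ?r = "(gcd_step ^^ i) (fst p, snd p)"
    have "length (fst ?r) \<le> esize p" "length (snd ?r) \<le> esize p"
      using length_gcd_steps_le[of "(fst p, snd p)" "esize p" i]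
        length_le_esize[of "fst p"] length_le_esize[of "snd p"] esize_prod[of p] by auto
    then show "esize ?r \<le> 1 + 4 * esize p"
      using esize_bits_le[of "fst ?r"] esize_bits_le[of "snd ?r"] esize_prod[of ?r] by simp
  qed (intro polytime_intros)+
  then show "polytime (\<lambda>p. gcd_bits (fst p) (snd p))"
    unfolding gcd_bits_def by (rule polytime_fst)
qed

subsection \<open>Fractions in lowest terms\<close>

definition strip_bits :: "bool list \<Rightarrow> bool list" where
  "strip_bits xs = foldr (\<lambda>x a. if a = [] \<and> \<not> x then [] else x # a) xs []"

lemma strip_bits_eq_binary: "strip_bits xs = binary (nat_of_bits xs)"
proof (induction xs)
  case Nil
  show ?case by (simp add: strip_bits_def binary.simps)
next
  case (Cons x xs)
  have "strip_bits (x # xs) = (if strip_bits xs = [] \<and> \<not> x then [] else x # strip_bits xs)"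
    by (simp add: strip_bits_def)
  also have "\<dots> = binary (nat_of_bits (x # xs))"
    unfolding Cons using binary.simps[of "nat_of_bits xs"] binary.simps[of "nat_of_bits (x # xs)"]
    by (cases x) (auto split: if_splits)
  finally show ?case .
qed

lemma polytime_strip_bits [polytime_intros]:
  assumes "polytime_on D f"
  shows "polytime_on D (\<lambda>x. strip_bits (f x))"
  unfolding strip_bits_def
  by (rule polytime_foldr_add[where g = "\<lambda>_ x a. if a = [] \<and> \<not> x then [] else x # a"
        and q = "\<lambda>n. n + 1"])
    (auto intro!: polytime_intros poly_bound_intros assms)

lemma nat_of_bits_binary: "nat_of_bits (binary n) = n"
proof (induction n rule: less_induct)
  case (less n)
  show ?case
  proof (cases "n = 0")
    case False
    then have "nat_of_bits (binary (n div 2)) = n div 2" using less[of "n div 2"] by simp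
    then show ?thesis
      using False by (subst binary.simps) (simp add: mod2_eq_if[symmetric] of_bool_odd_eq_mod_2)
  qed (simp add: binary.simps)
qed

lemma length_binary_le: "n < 2 ^ k \<Longrightarrow> length (binary n) \<le> k"
proof (induction k arbitrary: n)
  case 0
  then show ?case by (simp add: binary.simps)
next
  case (Suc k)
  show ?case
  proof (cases "n = 0")
    case False
    have "n div 2 < 2 ^ k" using Suc.prems by (simp add: less_mult_imp_div_less mult.commute)
    then show ?thesis using Suc.IH False by (subst binary.simps) simp
  qed (simp add: binary.simps)
qed

type_synonym fraction = "bool list \<times> bool list"

definition rat_of_bits :: "fraction \<Rightarrow> rat" where
  "rat_of_bits p = of_nat (nat_of_bits (fst p)) / of_nat (nat_of_bits (snd p))"

text \<open>The subtraction of the numerators is truncated, so the result is meaningful only if \<open>q\<close> does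
  not exceed \<open>p\<close>.\<close>

definition diff_fractions :: "fraction \<Rightarrow> fraction \<Rightarrow> fraction" where
  "diff_fractions p q =
     (let n = sub_bits (mult_bits (fst p) (snd q)) (mult_bits (fst q) (snd p));
          d = mult_bits (snd p) (snd q);
          g = gcd_bits n d
      in (strip_bits (fst (divmod_bits n g)), strip_bits (fst (divmod_bits d g))))"

lemma polytime_diff_fractions [polytime_intros]:
  "polytime_on D f \<Longrightarrow> polytime_on D g \<Longrightarrow> polytime_on D (\<lambda>x. diff_fractions (f x) (g x))"
  unfolding diff_fractions_def Let_def by (intro polytime_intros)

lemma rat_of_bits_le_iff:
  assumes "0 < nat_of_bits (snd p)" "0 < nat_of_bits (snd q)"
  shows "rat_of_bits q \<le> rat_of_bits p \<longleftrightarrow>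
    nat_of_bits (fst q) * nat_of_bits (snd p) \<le> nat_of_bits (fst p) * nat_of_bits (snd q)"
proof -
  have "rat_of_bits q \<le> rat_of_bits p \<longleftrightarrow>
      rat_of_nat (nat_of_bits (fst q)) * of_nat (nat_of_bits (snd p)) \<le>
      of_nat (nat_of_bits (fst p)) * of_nat (nat_of_bits (snd q))"
    using assms by (simp add: rat_of_bits_def field_simps)
  then show ?thesis by (simp only: of_nat_mult[symmetric] of_nat_le_iff)
qed

definition fraction_of :: "rat \<Rightarrow> fraction" where
  "fraction_of r = map_prod (binary \<circ> nat) (binary \<circ> nat) (quotient_of r)"

lemma fraction_of_denominator_pos [simp]: "0 < nat_of_bits (snd (fraction_of r))"
  using quotient_of_denom_pos'[of r] by (simp add: fraction_of_def nat_of_bits_binary)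

lemma rat_of_bits_fraction_of:
  assumes "0 \<le> r"
  shows "rat_of_bits (fraction_of r) = r"
proof -
  obtain p q where pq: "quotient_of r = (p, q)" by (metis surj_pair)
  have r: "r = of_int p / of_int q" and "0 < q"
    using quotient_of_div[OF pq] quotient_of_denom_pos[OF pq] by simp_all
  then have "0 \<le> p" using assms by (simp add: zero_le_divide_iff)
  then have "rat_of_bits (fraction_of r) = of_int p / of_int q"
    using \<open>0 < q\<close> by (simp add: fraction_of_def rat_of_bits_def nat_of_bits_binary pq)
  then show ?thesis using r by simp
qed

lemma fraction_of_divide:
  assumes "0 < d"
  shows "fraction_of (of_nat n / of_nat d) = (binary (n div gcd n d), binary (d div gcd n d))"
proof -
  have "of_nat n / of_nat d = Fract (int n) (int d)" by (simp add: Fract_of_int_quotient)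
  then have "quotient_of (of_nat n / of_nat d) = Rat.normalize (int n, int d)"
    by (simp add: quotient_of_Fract)
  also have "\<dots> = (int (n div gcd n d), int (d div gcd n d))"
    using assms by (simp add: Rat.normalize_def Let_def zdiv_int gcd_int_int_eq)
  finally show ?thesis by (simp add: fraction_of_def)
qed

lemma length_fraction_of_divide_le:
  assumes "n < 2 ^ k" "0 < d" "d < 2 ^ l"
  shows "length (fst (fraction_of (of_nat n / of_nat d))) \<le> k"
    "length (snd (fraction_of (of_nat n / of_nat d))) \<le> l"
  using assms
  by (auto simp: fraction_of_divide intro!: length_binary_le le_less_trans[OF div_le_dividend])

context
  fixes p q :: fraction
  assumes denominators: "0 < nat_of_bits (snd p)" "0 < nat_of_bits (snd q)"
    and le: "rat_of_bits q \<le> rat_of_bits p"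
begin

lemma rat_of_bits_diff:
  "rat_of_bits p - rat_of_bits q =
    of_nat (nat_of_bits (fst p) * nat_of_bits (snd q) - nat_of_bits (fst q) * nat_of_bits (snd p)) /
    of_nat (nat_of_bits (snd p) * nat_of_bits (snd q))"
  using denominators le[unfolded rat_of_bits_le_iff[OF denominators]]
  by (simp add: rat_of_bits_def of_nat_diff field_simps)

lemma diff_fractions_eq: "diff_fractions p q = fraction_of (rat_of_bits p - rat_of_bits q)"
proof -
  define ns ds where "ns = sub_bits (mult_bits (fst p) (snd q)) (mult_bits (fst q) (snd p))"
    and "ds = mult_bits (snd p) (snd q)"
  have numerator: "nat_of_bits ns =
      nat_of_bits (fst p) * nat_of_bits (snd q) - nat_of_bits (fst q) * nat_of_bits (snd p)"
    using le[unfolded rat_of_bits_le_iff[OF denominators]]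
    by (simp add: ns_def nat_of_bits_sub nat_of_bits_mult)
  have denominator: "nat_of_bits ds = nat_of_bits (snd p) * nat_of_bits (snd q)"
    by (simp add: ds_def nat_of_bits_mult)
  have pos: "0 < nat_of_bits ds" using denominators by (simp add: denominator)
  then have "0 < nat_of_bits (gcd_bits ns ds)" by (simp add: nat_of_bits_gcd)
  then have "diff_fractions p q = fraction_of (of_nat (nat_of_bits ns) / of_nat (nat_of_bits ds))"
    unfolding fraction_of_divide[OF pos]
    by (simp add: diff_fractions_def Let_def ns_def[symmetric] ds_def[symmetric]
        strip_bits_eq_binary nat_of_bits_divmod nat_of_bits_gcd)
  then show ?thesis by (simp only: rat_of_bits_diff numerator denominator)
qed

lemma length_diff_fractions_le:
  "length (fst (diff_fractions p q)) \<le> length (fst p) + length (snd q)"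
  "length (snd (diff_fractions p q)) \<le> length (snd p) + length (snd q)"
proof -
  note length_le = length_fraction_of_divide_le[OF le_less_trans[OF diff_le_self
        nat_of_bits_mult_less[of "fst p" "snd q"]] _ nat_of_bits_mult_less[of "snd p" "snd q"]]
  show "length (fst (diff_fractions p q)) \<le> length (fst p) + length (snd q)"
    "length (snd (diff_fractions p q)) \<le> length (snd p) + length (snd q)"
    unfolding diff_fractions_eq rat_of_bits_diff
    by (rule length_le, use denominators in simp)+
qed

end

section \<open>Simulating machines in polynomial time\<close>

subsection \<open>Finitely represented tapes\<close>

text \<open>A tape is represented by the history of its write operations, latest first, and the head
  position.\<close>

type_synonym fin_tape = "(int \<times> symbol) list \<times> int"

abbreviation fin_blank :: fin_tape where
  "fin_blank \<equiv> ([], 0)"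

definition lookup :: "(int \<times> symbol) list \<Rightarrow> int \<Rightarrow> symbol" where
  "lookup ws i = (case map_of ws i of None \<Rightarrow> Blank | Some s \<Rightarrow> s)"

definition abs_tape :: "fin_tape \<Rightarrow> tape" where
  "abs_tape r = (lookup (fst r), snd r)"

definition fin_scanned :: "fin_tape \<Rightarrow> symbol" where
  "fin_scanned r = lookup (fst r) (snd r)"

definition fin_update_tape :: "symbol \<times> direction \<Rightarrow> fin_tape \<Rightarrow> fin_tape" where
  "fin_update_tape w r = ((snd r, fst w) # fst r, shift (snd w) (snd r))"

definition fin_tape_of :: "symbol list \<Rightarrow> fin_tape" where
  "fin_tape_of ss = (zip (map int [0..<length ss]) ss, 0)"

definition fin_block :: "(symbol \<Rightarrow> bool) \<Rightarrow> fin_tape \<Rightarrow> symbol list" where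
  "fin_block P r = takeWhile P (map (\<lambda>i. lookup (fst r) (int i)) [0..<length (fst r)])"

lemma lookup_Nil [simp]: "lookup [] = (\<lambda>_. Blank)"
  by (simp add: lookup_def fun_eq_iff)

lemma lookup_Cons: "lookup (w # ws) i = (if fst w = i then snd w else lookup ws i)"
  by (auto simp: lookup_def)

lemma lookup_eq_Blank: "i \<notin> fst ` set ws \<Longrightarrow> lookup ws i = Blank"
  by (simp add: lookup_def map_of_eq_None_iff[THEN iffD2])

lemma lookup_in: "lookup ws i \<in> insert Blank (snd ` set ws)"
  by (auto simp: lookup_def image_iff split: option.splits dest!: map_of_SomeD) force

lemma scanned_abs_tape [simp]: "scanned (abs_tape r) = fin_scanned r"
  by (simp add: scanned_def abs_tape_def fin_scanned_def)

lemma update_abs_tape: "update_tape w (abs_tape r) = abs_tape (fin_update_tape w r)"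
  by (auto simp: update_tape_def abs_tape_def fin_update_tape_def lookup_Cons)

lemma abs_fin_tape_of: "abs_tape (fin_tape_of ss) = tape_of ss"
proof -
  have "lookup (zip (map int [0..<length ss]) ss) i =
      (if 0 \<le> i \<and> i < int (length ss) then ss ! nat i else Blank)" for i
  proof (cases "0 \<le> i \<and> i < int (length ss)")
    case True
    then have "map_of (zip (map int [0..<length ss]) ss)
        (map int [0..<length ss] ! nat i) = Some (ss ! nat i)"
      by (intro map_of_zip_nth) (auto simp: distinct_map)
    moreover have "map int [0..<length ss] ! nat i = i" using True by (simp add: nat_less_iff)
    ultimately show ?thesis using True by (simp add: lookup_def)
  next
    case False
    then have "i \<notin> fst ` set (zip (map int [0..<length ss]) ss)"
      by (auto dest!: set_zip_leftD)
    then show ?thesis using False lookup_eq_Blank by auto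
  qed
  then show ?thesis by (auto simp: abs_tape_def fin_tape_of_def tape_of_def)
qed

lemma abs_fin_blank [simp]: "abs_tape fin_blank = blank_tape"
  using abs_fin_tape_of[of "[]"] by (simp add: fin_tape_of_def)

lemma block_abs_tape:
  assumes "\<not> P Blank"
  shows "block P (abs_tape r) = fin_block P r"
proof -
  let ?s = "\<lambda>i. lookup (fst r) (int i)" and ?L = "length (fst r)"
  define n where "n = (LEAST i. \<not> P (?s i))"
  have prefix_le: "m \<le> ?L" if "\<And>i. i < m \<Longrightarrow> P (?s i)" for m
  proof -
    have "int ` {..<m} \<subseteq> fst ` set (fst r)"
      using that assms lookup_eq_Blank by (metis image_subsetI lessThan_iff)
    then have "card (int ` {..<m}) \<le> card (fst ` set (fst r))" by (intro card_mono) auto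
    then show ?thesis
      using card_image_le[of "set (fst r)" fst] card_length[of "fst r"] by (simp add: card_image)
  qed
  have below: "P (?s i)" if "i < n" for i
    using that not_less_Least unfolding n_def by blast
  have "\<exists>i. \<not> P (?s i)" using prefix_le[of "Suc ?L"] by auto
  then have "\<not> P (?s n)" unfolding n_def by (rule LeastI_ex)
  then have "fin_block P r = take n (map ?s [0..<?L])"
    unfolding fin_block_def using below by (intro takeWhile_eq_take_P_nth) simp_all
  also have "\<dots> = map ?s [0..<n]"
    using prefix_le[OF below] by (simp add: take_map take_upt)
  finally show ?thesis by (simp add: block_def abs_tape_def n_def)
qed

lemma length_fin_block_le: "length (fin_block P r) \<le> length (fst r)"
  unfolding fin_block_def using length_takeWhile_le[of P]
  by (metis length_map length_upt minus_nat.diff_0)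

lemma polytime_lookup [polytime_intros]:
  assumes "polytime_on D f" "polytime_on D g"
  shows "polytime_on D (\<lambda>x. lookup (f x) (g x))"
proof (rule polytime_comp2[OF _ assms])
  have "polytime (\<lambda>p :: (int \<times> symbol) list \<times> int.
      foldr (\<lambda>w a. if fst w = snd p then snd w else a) (fst p) Blank)"
    by (rule polytime_foldr_add[where g = "\<lambda>p w a. if fst w = snd p then snd w else a"
          and q = "\<lambda>n. n"])
      (auto intro!: polytime_intros poly_bound_intros simp: esize_prod)
  moreover have "foldr (\<lambda>w a. if fst w = i then snd w else a) ws Blank = lookup ws i" for i ws
    by (induction ws) (auto simp: lookup_Cons)
  ultimately show "polytime (\<lambda>p. lookup (fst p) (snd p))" by simp
qed

lemma polytime_shift [polytime_intros]:
  assumes "polytime_on D f" "polytime_on D g"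
  shows "polytime_on D (\<lambda>x. shift (f x) (g x))"
proof -
  have "shift d i = (if d = Lft then i - 1 else if d = Rgt then i + 1 else i)" for d i
    by (cases d) auto
  then show ?thesis using assms by (simp only:) (intro polytime_intros)
qed

lemma polytime_fin_scanned [polytime_intros]:
  "polytime_on D f \<Longrightarrow> polytime_on D (\<lambda>x. fin_scanned (f x))"
  unfolding fin_scanned_def by (intro polytime_intros)

lemma polytime_fin_update_tape [polytime_intros]:
  "polytime_on D f \<Longrightarrow> polytime_on D g \<Longrightarrow> polytime_on D (\<lambda>x. fin_update_tape (f x) (g x))"
  unfolding fin_update_tape_def by (intro polytime_intros)

lemma polytime_fin_tape_of [polytime_intros]:
  "polytime_on D f \<Longrightarrow> polytime_on D (\<lambda>x. fin_tape_of (f x))"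
  unfolding fin_tape_of_def by (intro polytime_intros)

lemma polytime_fin_block:
  assumes "polytime P" "polytime_on D f"
  shows "polytime_on D (\<lambda>x. fin_block P (f x))"
  by (rule polytime_comp[OF _ assms(2)]) (unfold fin_block_def, intro polytime_intros assms(1))

subsection \<open>Finitely represented configurations\<close>

type_synonym fin_config = "state \<times> fin_tape list"

definition represents :: "'c config_scheme \<Rightarrow> fin_config \<Rightarrow> bool" where
  "represents c r \<longleftrightarrow> state c = fst r \<and> tapes c = map abs_tape (snd r)"

definition abs_config :: "fin_config \<Rightarrow> config" where
  "abs_config r = \<lparr>state = fst r, tapes = map abs_tape (snd r)\<rparr>"

definition fin_perform :: "action \<Rightarrow> fin_config \<Rightarrow> fin_config" where
  "fin_perform a r = (fst a, map (\<lambda>p. fin_update_tape (fst p) (snd p)) (zip (snd a) (snd r)))"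

definition fin_query_word :: "fin_config \<Rightarrow> bool list" where
  "fin_query_word r = map (\<lambda>s. s = Bit True)
     (fin_block (\<lambda>s. s = Bit False \<or> s = Bit True) (nth_default fin_blank (snd r) 1))"

definition fin_answer :: "bool \<Rightarrow> fin_config \<Rightarrow> fin_config" where
  "fin_answer b r = (if b then Yes else No, (snd r)[1 := fin_blank])"

definition fin_input :: "nat \<Rightarrow> bool list \<Rightarrow> fin_config" where
  "fin_input k x = (Start, fin_tape_of (map Bit x) # replicate (k - 1) fin_blank)"

lemma represents_abs_config: "represents (abs_config r) r"
  by (simp add: represents_def abs_config_def)

lemma perform_represented:
  assumes "represents c r"
  shows "perform a c = c\<lparr>state := fst (fin_perform a r),
    tapes := map abs_tape (snd (fin_perform a r))\<rparr>"
proof -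
  have "map2 update_tape ws (map abs_tape rs) =
      map abs_tape (map (\<lambda>p. fin_update_tape (fst p) (snd p)) (zip ws rs))" for ws rs
    by (rule nth_equalityI) (auto simp: update_abs_tape)
  with assms show ?thesis by (simp add: perform_def fin_perform_def represents_def)
qed

lemma query_word_represented:
  assumes "represents c r" "1 < length (snd r)"
  shows "query_word c = fin_query_word r"
proof -
  have bits: "(\<lambda>s. s \<in> range Bit) = (\<lambda>s. s = Bit False \<or> s = Bit True)"
    by (auto simp: fun_eq_iff)
  have "tapes c ! 1 = abs_tape (nth_default fin_blank (snd r) 1)"
    using assms by (simp add: represents_def nth_default_nth)
  then show ?thesis
    unfolding query_word_def tape_word_def bits by (simp add: fin_query_word_def block_abs_tape)
qed

lemma answer_represented:
  assumes "represents c r" "1 < length (snd r)"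
  shows "represents (answer A c) (fin_answer (fin_query_word r \<in> A) r)"
  using assms query_word_represented[OF assms]
  by (simp add: answer_def fin_answer_def represents_def map_update)

lemma abs_fin_input: "abs_config (fin_input (tape_count M) x) = input_config M x"
  by (simp add: abs_config_def fin_input_def input_config_def abs_fin_tape_of)

lemma polytime_fin_perform [polytime_intros]:
  "polytime_on D f \<Longrightarrow> polytime_on D g \<Longrightarrow> polytime_on D (\<lambda>x. fin_perform (f x) (g x))"
  unfolding fin_perform_def by (intro polytime_intros)

lemma polytime_fin_query_word [polytime_intros]:
  "polytime_on D f \<Longrightarrow> polytime_on D (\<lambda>x. fin_query_word (f x))"
  unfolding fin_query_word_def by (intro polytime_intros polytime_fin_block)

lemma polytime_fin_answer [polytime_intros]:
  "polytime_on D f \<Longrightarrow> polytime_on D g \<Longrightarrow> polytime_on D (\<lambda>x. fin_answer (f x) (g x))"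
  unfolding fin_answer_def by (intro polytime_intros)

lemma polytime_Bit [polytime_intros]:
  assumes "polytime_on D f"
  shows "polytime_on D (\<lambda>x. Bit (f x))"
proof -
  have "polytime_on D (\<lambda>x. if f x then Bit True else Bit False)" by (intro polytime_intros assms)
  then show ?thesis by (rule poly_computable_cong) auto
qed

lemma polytime_fin_input [polytime_intros]:
  "polytime_on D f \<Longrightarrow> polytime_on D (\<lambda>x. fin_input k (f x))"
  unfolding fin_input_def by (intro polytime_intros)

subsection \<open>Configurations of bounded size\<close>

definition bounded_tape :: "symbol set \<Rightarrow> nat \<Rightarrow> fin_tape \<Rightarrow> bool" where
  "bounded_tape \<Gamma> n r \<longleftrightarrow> length (fst r) \<le> n \<and> nat \<bar>snd r\<bar> \<le> n \<and>
     (\<forall>w\<in>set (fst r). nat \<bar>fst w\<bar> \<le> n \<and> snd w \<in> \<Gamma>)"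

definition bounded_config :: "'a machine_scheme \<Rightarrow> nat \<Rightarrow> fin_config \<Rightarrow> bool" where
  "bounded_config M n r \<longleftrightarrow> fst r \<in> states M \<and> length (snd r) = tape_count M \<and>
     (\<forall>t\<in>set (snd r). bounded_tape (alphabet M) n t)"

lemma bounded_tape_mono: "bounded_tape \<Gamma> m r \<Longrightarrow> m \<le> n \<Longrightarrow> bounded_tape \<Gamma> n r"
  unfolding bounded_tape_def by (meson le_trans)

lemma bounded_config_mono: "bounded_config M m r \<Longrightarrow> m \<le> n \<Longrightarrow> bounded_config M n r"
  unfolding bounded_config_def using bounded_tape_mono by blast

lemma bounded_fin_blank [simp]: "bounded_tape \<Gamma> n fin_blank"
  by (simp add: bounded_tape_def)

lemma bounded_fin_tape_of:
  assumes "set ss \<subseteq> \<Gamma>"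
  shows "bounded_tape \<Gamma> (length ss) (fin_tape_of ss)"
  unfolding bounded_tape_def
proof (intro conjI ballI)
  fix w assume "w \<in> set (fst (fin_tape_of ss))"
  then have "(fst w, snd w) \<in> set (zip (map int [0..<length ss]) ss)"
    by (simp add: fin_tape_of_def)
  from set_zip_leftD[OF this] set_zip_rightD[OF this]
  show "nat \<bar>fst w\<bar> \<le> length ss" "snd w \<in> \<Gamma>" using assms by auto
qed (simp_all add: fin_tape_of_def)

lemma bounded_fin_update_tape:
  assumes "bounded_tape \<Gamma> n r" "fst w \<in> \<Gamma>"
  shows "bounded_tape \<Gamma> (Suc n) (fin_update_tape w r)"
proof -
  have "nat \<bar>shift d i\<bar> \<le> Suc n" if "nat \<bar>i\<bar> \<le> n" for d i using that by (cases d) auto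
  then show ?thesis using assms by (fastforce simp: bounded_tape_def fin_update_tape_def)
qed

lemma fin_scanned_in_alphabet:
  "bounded_tape \<Gamma> n r \<Longrightarrow> Blank \<in> \<Gamma> \<Longrightarrow> fin_scanned r \<in> \<Gamma>"
  using lookup_in[of "fst r" "snd r"] by (auto simp: bounded_tape_def fin_scanned_def)

lemma length_fin_query_word_le:
  assumes "bounded_config M n r"
  shows "length (fin_query_word r) \<le> n"
proof -
  have "bounded_tape (alphabet M) n (nth_default fin_blank (snd r) 1)"
    using assms by (simp add: nth_default_def bounded_config_def)
  then show ?thesis
    using length_fin_block_le le_trans
    unfolding fin_query_word_def bounded_tape_def length_map by blast
qed

lemma esize_bounded_tape_le:
  assumes "bounded_tape \<Gamma> n r" "\<And>s. s \<in> \<Gamma> \<Longrightarrow> esize s \<le> A"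
  shows "esize r \<le> Suc (n * Suc (Suc (2 + n + A)) + (2 + n))"
proof -
  have "esize w \<le> Suc (2 + n + A)" if "w \<in> set (fst r)" for w
  proof -
    have "nat \<bar>fst w\<bar> \<le> n" "esize (snd w) \<le> A"
      using that assms by (auto simp: bounded_tape_def)
    then show ?thesis using esize_prod[of w] esize_int_le[of "fst w"] by linarith
  qed
  then have "esize (fst r) \<le> length (fst r) * Suc (Suc (2 + n + A))" by (rule esize_list_le)
  also have "\<dots> \<le> n * Suc (Suc (2 + n + A))"
    using assms(1) by (intro mult_le_mono1) (simp add: bounded_tape_def)
  finally show ?thesis
    using esize_prod[of r] esize_int_le[of "snd r"] assms(1) by (simp add: bounded_tape_def)
qed

lemma bounded_config_esizeE:
  assumes "wf_machine M"
  obtains q where "poly_bound q" "\<And>n r. bounded_config M n r \<Longrightarrow> esize r \<le> q n"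
proof -
  define S where "S = Max (esize ` states M)"
  define A where "A = Max (esize ` alphabet M)"
  have S: "esize q \<le> S" if "q \<in> states M" for q
    using that assms by (simp add: S_def wf_machine_def)
  have A: "esize s \<le> A" if "s \<in> alphabet M" for s
    using that assms by (simp add: A_def wf_machine_def)
  let ?t = "\<lambda>n. Suc (n * Suc (Suc (2 + n + A)) + (2 + n))"
  have "esize r \<le> Suc (S + tape_count M * Suc (?t n))" if r: "bounded_config M n r" for n r
  proof -
    have "esize t \<le> ?t n" if "t \<in> set (snd r)" for t
      using r that A
      by (intro esize_bounded_tape_le[of "alphabet M"]) (simp_all add: bounded_config_def)
    then have "esize (snd r) \<le> length (snd r) * Suc (?t n)" by (rule esize_list_le)
    then show ?thesis
      using r S[of "fst r"] esize_prod[of r] unfolding bounded_config_def by simp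
  qed
  moreover have "poly_bound (\<lambda>n. Suc (S + tape_count M * Suc (?t n)))"
    by (intro poly_bound_intros)
  ultimately show ?thesis using that by blast
qed

lemma bounded_fin_answer:
  assumes "wf_machine M" "bounded_config M n r"
  shows "bounded_config M n (fin_answer b r)"
  using assms set_update_subset_insert[of "snd r" 1 fin_blank]
  by (auto simp: bounded_config_def fin_answer_def wf_machine_def)

lemma Bit_in_alphabet: "wf_machine M \<Longrightarrow> Bit b \<in> alphabet M"
  by (cases b) (simp_all add: wf_machine_def)

lemma bounded_fin_input:
  assumes "wf_machine M"
  shows "bounded_config M (length x) (fin_input (tape_count M) x)"
  using assms bounded_fin_tape_of[of "map Bit x" "alphabet M"] Bit_in_alphabet[OF assms]
  by (auto simp: bounded_config_def fin_input_def wf_machine_def)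

subsection \<open>Transition tables\<close>

lemma wf_delta:
  assumes "wf_machine M" "q \<in> states M" "length ss = tape_count M" "set ss \<subseteq> alphabet M"
    "a \<in> delta M q ss"
  shows "fst a \<in> states M" "length (snd a) = tape_count M" "fst ` set (snd a) \<subseteq> alphabet M"
proof -
  have "\<forall>(q', ws)\<in>delta M q ss. q' \<in> states M \<and> length ws = tape_count M \<and>
      fst ` set ws \<subseteq> alphabet M"
    using assms(1-4) unfolding wf_machine_def by simp
  from bspec[OF this assms(5)]
  show "fst a \<in> states M" "length (snd a) = tape_count M" "fst ` set (snd a) \<subseteq> alphabet M"
    by (simp_all add: split_beta)
qed

lemma UNIV_direction: "UNIV = {Lft, Stay, Rgt}"
  using direction.exhaust by auto

lemma finite_delta:
  assumes "wf_machine M" "q \<in> states M" "length ss = tape_count M" "set ss \<subseteq> alphabet M"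
  shows "finite (delta M q ss)"
proof (rule finite_subset)
  let ?writes = "{ws. set ws \<subseteq> alphabet M \<times> (UNIV :: direction set) \<and> length ws = tape_count M}"
  show "delta M q ss \<subseteq> states M \<times> ?writes"
    using wf_delta[OF assms] by (fastforce simp: mem_Times_iff)
  show "finite (states M \<times> ?writes)"
    using assms(1) by (intro finite_cartesian_product finite_lists_length_eq)
      (auto simp: wf_machine_def UNIV_direction)
qed

locale tabulated_machine =
  fixes M :: "'a machine_scheme" and table :: "state \<times> symbol list \<Rightarrow> action list"
  assumes wf: "wf_machine M" and polytime_table: "polytime table"
    and set_table: "q \<in> states M \<Longrightarrow> length ss = tape_count M \<Longrightarrow> set ss \<subseteq> alphabet M \<Longrightarrow>
      set (table (q, ss)) = delta M q ss"
    and distinct_table: "distinct (table y)"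

lemma tabulated_machineE:
  assumes "wf_machine M"
  obtains table b where "tabulated_machine M table" "\<And>y. length (table y) \<le> b"
proof -
  let ?S = "states M \<times> {ss. set ss \<subseteq> alphabet M \<and> length ss = tape_count M}"
  have fin: "finite ?S" using assms by (auto simp: wf_machine_def finite_lists_length_eq)
  have "\<forall>y\<in>?S. \<exists>l. set l = delta M (fst y) (snd y) \<and> distinct l"
    using finite_delta[OF assms] finite_distinct_list by auto
  then obtain f where f: "\<forall>y\<in>?S. set (f y) = delta M (fst y) (snd y) \<and> distinct (f y)"
    by (rule bchoice[THEN exE])
  obtain table where table: "polytime table" "\<And>y. y \<in> ?S \<Longrightarrow> table y = f y"
    "range table \<subseteq> insert [] (f ` ?S)"
    using polytime_table[OF fin, of f "[]"] by blast
  have "tabulated_machine M table"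
  proof
    fix y
    have "table y \<in> insert [] (f ` ?S)" using table(3) by (rule subsetD) (rule rangeI)
    then show "distinct (table y)"
      by (rule insertE) (use f in auto)
  qed (use assms table(1,2) f in auto)
  moreover have "finite (range table)"
    using table(3) by (rule finite_subset) (simp only: finite.insertI finite_imageI fin)
  then have "length (table y) \<le> Max (length ` range table)" for y by simp
  ultimately show ?thesis using that by blast
qed

context tabulated_machine
begin

definition fin_moves :: "fin_config \<Rightarrow> fin_config list" where
  "fin_moves r = (if fst r = Query \<or> fst r = Accept \<or> fst r = Reject then []
     else map (\<lambda>a. fin_perform a r) (table (fst r, map fin_scanned (snd r))))"

lemma scanned_in_domain:
  assumes "bounded_config M n r"
  shows "fst r \<in> states M" "length (map fin_scanned (snd r)) = tape_count M"
    "set (map fin_scanned (snd r)) \<subseteq> alphabet M"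
  using assms wf fin_scanned_in_alphabet by (fastforce simp: bounded_config_def wf_machine_def)+

lemma set_fin_moves:
  assumes "bounded_config M n r"
  shows "set (fin_moves r) = (if fst r \<in> {Query, Accept, Reject} then {}
     else (\<lambda>a. fin_perform a r) ` delta M (fst r) (map fin_scanned (snd r)))"
  using set_table[OF scanned_in_domain[OF assms]] by (simp add: fin_moves_def)

lemma fin_movesE:
  assumes "bounded_config M n r" "r' \<in> set (fin_moves r)"
  obtains a where "r' = fin_perform a r" "fst a \<in> states M" "length (snd a) = tape_count M"
    "fst ` set (snd a) \<subseteq> alphabet M"
proof -
  obtain a where "a \<in> delta M (fst r) (map fin_scanned (snd r))" "r' = fin_perform a r"
    using assms(2) set_fin_moves[OF assms(1)] by (auto split: if_splits)
  then show ?thesis using that wf_delta[OF wf scanned_in_domain[OF assms(1)]] by blast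
qed

lemma bounded_tape_fin_moves_nth:
  assumes "bounded_config M n r" "r' \<in> set (fin_moves r)" "i < tape_count M"
    and "bounded_tape (alphabet M) m (snd r ! i)"
  shows "bounded_tape (alphabet M) (Suc m) (snd r' ! i)"
proof -
  obtain a where a: "r' = fin_perform a r" "length (snd a) = tape_count M"
    "fst ` set (snd a) \<subseteq> alphabet M"
    using assms(1,2) by (rule fin_movesE)
  have "snd r' ! i = fin_update_tape (snd a ! i) (snd r ! i)"
    using a(1,2) assms(1,3) by (simp add: fin_perform_def bounded_config_def)
  moreover have "fst (snd a ! i) \<in> alphabet M"
    using a(2,3) assms(3) by (auto simp: image_subset_iff)
  ultimately show ?thesis using bounded_fin_update_tape[OF assms(4)] by simp
qed

lemma bounded_fin_moves:
  assumes "bounded_config M n r" "r' \<in> set (fin_moves r)"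
  shows "bounded_config M (Suc n) r'"
proof -
  obtain a where a: "r' = fin_perform a r" "fst a \<in> states M" "length (snd a) = tape_count M"
    using assms by (rule fin_movesE)
  have len: "length (snd r') = tape_count M"
    using a(1,3) assms(1) by (simp add: fin_perform_def bounded_config_def)
  have "bounded_tape (alphabet M) (Suc n) (snd r' ! i)" if "i < tape_count M" for i
    using bounded_tape_fin_moves_nth[OF assms that] assms(1) that by (simp add: bounded_config_def)
  then show ?thesis
    using a(1,2) len
    by (simp add: bounded_config_def all_set_conv_all_nth) (simp add: fin_perform_def)
qed

lemma moves_represented:
  assumes "bounded_config M n r" "represents c r"
  shows "moves M c = (\<lambda>r'. c\<lparr>state := fst r', tapes := map abs_tape (snd r')\<rparr>) ` set (fin_moves r)"
proof -
  have "map scanned (tapes c) = map fin_scanned (snd r)" "state c = fst r"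
    using assms(2) by (auto simp: represents_def)
  then show ?thesis
    unfolding set_fin_moves[OF assms(1)] moves_def
    by (simp add: image_image perform_represented[OF assms(2)])
qed

lemma length_fin_moves_deterministic:
  assumes "deterministic M" "bounded_config M n r"
  shows "length (fin_moves r) \<le> 1"
proof -
  let ?l = "table (fst r, map fin_scanned (snd r))"
  have "\<forall>a\<in>set ?l. \<forall>a'\<in>set ?l. a = a'"
    using assms(1) scanned_in_domain[OF assms(2)] set_table[OF scanned_in_domain[OF assms(2)]]
    unfolding deterministic_def by blast
  then have "card (set ?l) \<le> 1" using card_le_Suc0_iff_eq[OF finite_set, of ?l] by simp
  then show ?thesis using distinct_card[OF distinct_table] by (simp add: fin_moves_def)
qed

lemma polytime_fin_moves:
  assumes "polytime_on D f"
  shows "polytime_on D (\<lambda>x. fin_moves (f x))"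
proof (rule polytime_comp[OF _ assms])
  show "polytime fin_moves"
    unfolding fin_moves_def by (intro polytime_intros polytime_comp[OF polytime_table])
qed

end

section \<open>Exponential time as padded polynomial time\<close>

definition pad_decidable :: "language \<Rightarrow> bool" where
  "pad_decidable L \<longleftrightarrow> (\<exists>F c. polytime F \<and>
     (\<forall>x (P::nat). 2 ^ (length x ^ c + c) \<le> P \<longrightarrow> F (x, P) = (x \<in> L)))"

lemma pad_decidableI:
  assumes "polytime F" "\<And>x P. 2 ^ (length x ^ c + c) \<le> P \<Longrightarrow> F (x, P::nat) = (x \<in> L)"
  shows "pad_decidable L"
  using assms unfolding pad_decidable_def by blast

lemma pad_decidableE:
  assumes "pad_decidable L"
  obtains F c where "polytime F" "\<And>x P. 2 ^ (length x ^ c + c) \<le> P \<Longrightarrow> F (x, P::nat) = (x \<in> L)"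
  using assms unfolding pad_decidable_def by blast

lemma poly_bound_exponent:
  assumes "poly_bound p"
  obtains e where "\<And>n. p n \<le> n ^ e + e"
proof -
  obtain k where k: "\<And>n. p n \<le> (n + 2) ^ k" using assms by (rule poly_boundE) blast
  let ?e = "2 * k + 3 ^ k"
  have "p n \<le> n ^ ?e + ?e" for n
  proof (cases "n \<le> 1")
    case True
    then have "(n + 2) ^ k \<le> 3 ^ k" by (intro power_mono) auto
    then show ?thesis using k[of n] by linarith
  next
    case False
    then have "2 * n \<le> n * n" by (intro mult_le_mono1) simp
    then have "n + 2 \<le> n ^ 2" using False unfolding power2_eq_square by linarith
    then have "(n + 2) ^ k \<le> (n ^ 2) ^ k" by (intro power_mono) auto
    also have "\<dots> = n ^ (2 * k)" by (simp add: power_mult)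
    also have "\<dots> \<le> n ^ ?e" using False by (intro power_increasing) auto
    finally show ?thesis using k[of n] by linarith
  qed
  then show ?thesis using that by blast
qed

lemma poly_bound_exponential:
  assumes "poly_bound p"
  obtains e where "\<And>n. p (2 * n + 2 ^ (n ^ c + c)) \<le> 2 ^ (n ^ e + e)"
proof -
  obtain k where k: "\<And>n. p n \<le> (n + 2) ^ k" using assms by (rule poly_boundE) blast
  have "poly_bound (\<lambda>n. (n + (n ^ c + c) + 3) * k)" by (intro poly_bound_intros)
  then obtain e where e: "\<And>n. (n + (n ^ c + c) + 3) * k \<le> n ^ e + e"
    by (rule poly_bound_exponent) blast
  have "p (2 * n + 2 ^ (n ^ c + c)) \<le> 2 ^ (n ^ e + e)" for n
  proof -
    let ?N = "n ^ c + c"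
    have "n + 1 < 2 ^ (n + 1)" by (rule less_exp)
    then have "2 * n + 2 \<le> 2 ^ (n + 2)" by simp
    also have "\<dots> \<le> 2 ^ (n + ?N + 2)" by (intro power_increasing) auto
    finally have "2 * n + 2 \<le> 2 ^ (n + ?N + 2)" .
    moreover have "(2::nat) ^ ?N \<le> 2 ^ (n + ?N + 2)" by (intro power_increasing) auto
    ultimately have "2 * n + 2 ^ ?N + 2 \<le> 2 * 2 ^ (n + ?N + 2)" by linarith
    also have "\<dots> = 2 ^ (n + ?N + 3)" by (simp add: eval_nat_numeral)
    finally have "2 * n + 2 ^ ?N + 2 \<le> 2 ^ (n + ?N + 3)" .
    then have "(2 * n + 2 ^ ?N + 2) ^ k \<le> (2 ^ (n + ?N + 3)) ^ k" by (intro power_mono) auto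
    also have "\<dots> = 2 ^ ((n + ?N + 3) * k)" by (simp only: power_mult)
    also have "\<dots> \<le> 2 ^ (n ^ e + e)" using e[of n] by (intro power_increasing) auto
    finally show ?thesis using k[of "2 * n + 2 ^ ?N"] by linarith
  qed
  then show ?thesis using that by blast
qed

lemma decides_in_time_mono:
  assumes "decides_in_time A M L T" "\<And>n. T n \<le> T' n"
  shows "decides_in_time A M L T'"
  using assms unfolding decides_in_time_def by (meson le_trans)

subsection \<open>From padded polynomial time to exponential time\<close>

definition load_com :: com where
  "load_com = Loop (\<lambda>ss. ss ! 0 \<noteq> Blank) (move 0 1) ;; push 0 (Bit False) ;;
     Loop (\<lambda>ss. ss ! 1 \<noteq> Blank)
       (Cond (\<lambda>ss. ss ! 1 = Bit True)
          (push_all (Bit True # preorder (enc True)))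
          (push_all (Bit True # preorder (enc False))) ;;
        pop 1)"

lemma wf_load_com [simp]: "wf_com 4 load_com"
  by (simp add: load_com_def wf_push_all enc_bool_def)

lemma exec_load_com:
  "exec (27 * length x + 7) load_com [map Bit x, [], [], []] [preorder (enc x), [], [], []]"
proof -
  let ?bit = "Cond (\<lambda>ss. ss ! 1 = Bit True)
     (push_all (Bit True # preorder (enc True))) (push_all (Bit True # preorder (enc False)))"
  let ?S = "\<lambda>(ys::bool list) zs. [preorder (enc (rev ys)), map Bit zs, [], []]"
  have "exec (6 * length (map Bit x) + 1) (Loop (\<lambda>ss. ss ! 0 \<noteq> Blank) (move 0 1))
      [map Bit x, [], [], []] [[], rev (map Bit x), [], []]"
    using exec_move_until[of 0 "[map Bit x, [], [], []]" 1 "map Bit x" "[]"] by auto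
  also have "exec 3 (push 0 (Bit False)) \<dots> (?S [] (rev x))"
    using exec_push_0[of "Bit False"] by (simp add: rev_map)
  also have "exec (length (rev x) * (20 + 1) + 1) (Loop (\<lambda>ss. ss ! 1 \<noteq> Blank) (?bit ;; pop 1))
      \<dots> (?S (rev x) [])"
  proof (rule exec_loop_list)
    fix ys z zs
    show "map top_symbol (?S ys (z # zs)) ! 1 \<noteq> Blank" by simp
    have "exec (17 + 1) ?bit (?S ys (z # zs))
        [preorder (enc (z # rev ys)), map Bit (z # zs), [], []]"
    proof (rule exec_cond)
      assume "map top_symbol (?S ys (z # zs)) ! 1 = Bit True"
      then show "exec 17 (push_all (Bit True # preorder (enc True))) (?S ys (z # zs))
          [preorder (enc (z # rev ys)), map Bit (z # zs), [], []]"
        using exec_push_all[of "Bit True # preorder (enc True)"] by (simp add: enc_bool_def)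
    next
      assume "map top_symbol (?S ys (z # zs)) ! 1 \<noteq> Bit True"
      then have "\<not> z" by simp
      then show "exec 17 (push_all (Bit True # preorder (enc False))) (?S ys (z # zs))
          [preorder (enc (z # rev ys)), map Bit (z # zs), [], []]"
        using exec_mono[OF exec_push_all[of "Bit True # preorder (enc False)"], of 17]
        by (simp add: enc_bool_def)
    qed
    also have "exec 1 (pop 1) \<dots> (?S (ys @ [z]) zs)"
      using exec_pop_1 by simp
    finally show "exec 20 (?bit ;; pop 1) (?S ys (z # zs)) (?S (ys @ [z]) zs)" by simp
  qed simp
  finally show ?thesis
    unfolding load_com_def[symmetric] by (auto elim!: exec_mono)
qed

lemma poly_computable_decides:
  assumes F: "poly_computable (\<lambda>x. t (length x)) UNIV F" and t: "\<And>n. n \<le> t n"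
  obtains M p where "wf_machine M" "deterministic M" "oracle_free M" "poly_bound p"
    "decides_in_time {} M {x. F x} (\<lambda>n. p (t n))"
proof -
  obtain c q where c: "wf_com 4 c" "poly_bound q"
    "\<And>x. computes (q (t (length x))) c (enc x) (enc (F x))"
    using F by (rule poly_computableE) blast
  let ?c = "load_com ;; c" and ?p = "\<lambda>m. 27 * m + 7 + q m + 1 + 2"
  have "decides_in_time {} (compile 4 ?c) {x. F x} (\<lambda>n. 27 * n + 7 + q (t n) + 1 + 2)"
  proof (rule compile_decides)
    fix x
    have "exec (27 * length x + 7) load_com [map Bit x, [], [], []] [preorder (enc x), [], [], []]"
      by (rule exec_load_com)
    also have "exec (q (t (length x))) c \<dots> [preorder (enc (F x)), [], [], []]"
      using computesD[OF c(3), of x "[]" "[]" "[]" "[]"] by simp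
    finally have "exec (27 * length x + 7 + q (t (length x)) + 1) ?c
        (map Bit x # replicate (4 - 1) []) [preorder (enc (F x)), [], [], []]"
      by (simp add: numeral_3_eq_3)
    moreover have "top_symbol (preorder (enc (F x))) = Bit True \<longleftrightarrow> x \<in> {x. F x}"
      by (simp add: enc_bool_def)
    ultimately show "\<exists>xs s. exec (27 * length x + 7 + q (t (length x)) + 1) ?c
        (map Bit x # replicate (4 - 1) []) (xs # s) \<and> (top_symbol xs = Bit True \<longleftrightarrow> x \<in> {x. F x})"
      by blast
  qed
  then have "decides_in_time {} (compile 4 ?c) {x. F x} (\<lambda>n. ?p (t n))"
    by (rule decides_in_time_mono) (use t in simp)
  moreover have "poly_bound ?p" by (intro poly_bound_intros c)
  ultimately show ?thesis
    using that[of "compile 4 ?c" ?p] c(1)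
    by (simp add: wf_compile deterministic_compile oracle_free_compile)
qed

lemma poly_computable_exponential_pad:
  "poly_computable (\<lambda>x. 2 * length x + 2 ^ (length x ^ c + c)) UNIV
     (\<lambda>x :: bool list. (x, 2 ^ (length x ^ c + c) :: nat))"
proof -
  let ?N = "\<lambda>x :: bool list. length x ^ c + c"
    and ?double = "\<lambda>p :: bool list \<times> nat. (fst p, snd p + snd p)"
  let ?t = "\<lambda>x :: bool list. 2 * length x + 2 ^ ?N x"
  have powers: "(?double ^^ i) (x, 1) = (x, 2 ^ i)" for i x
    by (induction i) simp_all
  have esize_le: "esize x \<le> 2 * length x" for x :: "bool list"
    by (rule esize_bits_le)
  have "poly_computable ?t UNIV (\<lambda>x. (?double ^^ esize (?N x)) (x, 1))"
  proof (rule poly_computable_iterate)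
    show "polytime ?double" by (intro polytime_intros)
    have "polytime (\<lambda>x. (?N x, x, 1::nat))" by (intro polytime_intros)
    then show "poly_computable ?t UNIV (\<lambda>x. (?N x, x, 1::nat))"
      by (rule poly_computable_measure_mono) (simp add: le_trans[OF esize_le])
    show "poly_bound Suc" by (intro poly_bound_intros)
    fix x :: "bool list" and i assume "i \<le> esize (?N x)"
    then have "(2::nat) ^ i \<le> 2 ^ ?N x" by (intro power_increasing) simp_all
    then show "esize ((?double ^^ i) (x, 1)) \<le> Suc (?t x)"
      unfolding powers esize_Pair esize_nat using esize_le[of x] by linarith
  qed
  then show ?thesis unfolding powers by simp
qed

lemma pad_decidable_EXP:
  assumes "pad_decidable L"
  shows "L \<in> EXP"
proof -
  obtain F c where F: "polytime F" "\<And>x P. 2 ^ (length x ^ c + c) \<le> P \<Longrightarrow> F (x, P::nat) = (x \<in> L)"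
    using assms by (rule pad_decidableE) blast
  let ?t = "\<lambda>n::nat. 2 * n + 2 ^ (n ^ c + c)"
  have "poly_computable (\<lambda>x. ?t (length x)) UNIV (\<lambda>x. F (x, 2 ^ (length x ^ c + c)))"
    by (rule poly_computable_comp[OF F(1) poly_computable_exponential_pad]) simp
  then obtain M p where M: "wf_machine M" "deterministic M" "oracle_free M" "poly_bound p"
    "decides_in_time {} M {x. F (x, 2 ^ (length x ^ c + c))} (\<lambda>n. p (?t n))"
    by (rule poly_computable_decides) auto
  obtain e where e: "\<And>n. p (?t n) \<le> 2 ^ (n ^ e + e)"
    using M(4) by (rule poly_bound_exponential) blast
  have "{x. F (x, 2 ^ (length x ^ c + c))} = L" using F(2) by auto
  then have "decides_in_time {} M L (\<lambda>n. 2 ^ (n ^ e + e))"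
    using decides_in_time_mono[OF M(5) e] by simp
  with M(1-3) show ?thesis unfolding EXP_def by blast
qed

subsection \<open>Exhaustive simulation of nondeterministic oracle machines\<close>

definition reachable_in :: "language \<Rightarrow> machine \<Rightarrow> bool list \<Rightarrow> nat \<Rightarrow> config set" where
  "reachable_in A M x m = {c. (oracle_step A M ^^ m) (input_config M x) c}"

lemma reachable_in_0: "reachable_in A M x 0 = {input_config M x}"
  by (auto simp: reachable_in_def)

lemma reachable_in_Suc:
  "reachable_in A M x (Suc m) = (\<Union>c\<in>reachable_in A M x m. {d. oracle_step A M c d})"
  by (auto simp: reachable_in_def)

lemma decides_in_time_iff:
  "decides_in_time A M L T \<longleftrightarrow>
     (\<forall>x. (\<forall>m. \<forall>c\<in>reachable_in A M x m. m \<le> T (length x)) \<and>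
          (x \<in> L \<longleftrightarrow> (\<exists>m. \<exists>c\<in>reachable_in A M x m. state c = Accept)))"
  unfolding decides_in_time_def rtranclp_power reachable_in_def by (rule all_cong1) blast

lemma length_concat_map_le:
  "(\<And>x. x \<in> set xs \<Longrightarrow> length (f x) \<le> b) \<Longrightarrow> length (concat (map f xs)) \<le> b * length xs"
proof (induction xs)
  case (Cons x xs)
  have "length (f x) \<le> b" "length (concat (map f xs)) \<le> b * length xs" using Cons by auto
  then show ?case by simp
qed simp

context tabulated_machine
begin

definition fin_oracle_moves :: "(bool list \<times> nat \<Rightarrow> bool) \<Rightarrow> nat \<Rightarrow> fin_config \<Rightarrow> fin_config list" where
  "fin_oracle_moves F P r =
     (if fst r = Query then [fin_answer (F (fin_query_word r, P)) r] else fin_moves r)"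

text \<open>One level of the breadth-first search. The list of configurations is cut down to nothing when
  it exceeds the padding, which keeps the search polynomial in the size of the padded input.\<close>

definition search_step ::
    "(bool list \<times> nat \<Rightarrow> bool) \<Rightarrow> nat \<Rightarrow> bool \<times> fin_config list \<Rightarrow> bool \<times> fin_config list" where
  "search_step F P s =
     (fst s \<or> (\<exists>r\<in>set (snd s). fst r = Accept),
      let rs = concat (map (fin_oracle_moves F P) (snd s)) in if length rs \<le> P then rs else [])"

definition search ::
    "(bool list \<times> nat \<Rightarrow> bool) \<Rightarrow> nat \<Rightarrow> bool list \<Rightarrow> nat \<Rightarrow> bool \<times> fin_config list" where
  "search F P x i = (search_step F P ^^ i) (False, [fin_input (tape_count M) x])"

lemma search_0 [simp]: "search F P x 0 = (False, [fin_input (tape_count M) x])"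
  by (simp add: search_def)

lemma search_Suc: "search F P x (Suc i) = search_step F P (search F P x i)"
  by (simp add: search_def)

lemma bounded_fin_oracle_moves:
  assumes "bounded_config M n r" "r' \<in> set (fin_oracle_moves F P r)"
  shows "bounded_config M (Suc n) r'"
proof (cases "fst r = Query")
  case True
  then have "bounded_config M n r'"
    using assms(2) bounded_fin_answer[OF wf assms(1)] by (simp add: fin_oracle_moves_def)
  then show ?thesis by (rule bounded_config_mono) simp
next
  case False
  then show ?thesis using assms bounded_fin_moves by (simp add: fin_oracle_moves_def)
qed

lemma search_bounded:
  "length (snd (search F P x i)) \<le> Suc P \<and>
   (\<forall>r\<in>set (snd (search F P x i)). bounded_config M (length x + i) r)"
proof (induction i)
  case 0
  show ?case using bounded_fin_input[OF wf] by simp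
next
  case (Suc i)
  then show ?case
    using bounded_fin_oracle_moves by (auto simp: search_Suc search_step_def Let_def)
qed

lemma polytime_search:
  assumes F: "polytime F"
  shows "polytime (\<lambda>p. fst (search F (snd p) (fst p) (snd p)))"
proof -
  obtain q where q: "poly_bound q" "\<And>n r. bounded_config M n r \<Longrightarrow> esize r \<le> q n"
    using bounded_config_esizeE[OF wf] by blast
  have moves: "polytime (\<lambda>p. fin_oracle_moves F (fst p) (snd p))"
    unfolding fin_oracle_moves_def by (intro polytime_intros polytime_comp[OF F] polytime_fin_moves)
  have "polytime (\<lambda>p. search F (snd p) (fst p) (snd p))"
    unfolding search_def
  proof (rule polytime_funpow[where f = "\<lambda>p. search_step F (snd p)"])
    show "polytime (\<lambda>p. search_step F (snd (fst p)) (snd p))"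
      for p :: "(bool list \<times> nat) \<times> bool \<times> fin_config list"
      unfolding search_step_def Let_def by (intro polytime_intros polytime_comp2[OF moves])
    let ?b = "\<lambda>n. Suc (1 + Suc n * Suc (q (2 * n)))"
    show "poly_bound ?b" by (intro poly_bound_intros poly_bound_comp[OF q(1)])
    fix p :: "bool list \<times> nat" and i assume i: "i \<le> snd p"
    let ?s = "search F (snd p) (fst p) i"
    note bounded = search_bounded[of F "snd p" "fst p" i]
    have le: "length (fst p) + i \<le> 2 * esize p" "snd p \<le> esize p"
      using i length_le_esize[of "fst p"] esize_prod[of p] by simp_all
    have "esize r \<le> q (2 * esize p)" if "r \<in> set (snd ?s)" for r
      using bounded that q(2) poly_bound_mono[OF q(1) le(1)] le_trans by blast
    then have "esize (snd ?s) \<le> length (snd ?s) * Suc (q (2 * esize p))" by (rule esize_list_le)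
    also have "\<dots> \<le> Suc (esize p) * Suc (q (2 * esize p))"
      using bounded le(2) by (intro mult_le_mono1) simp
    finally show "esize ((search_step F (snd p) ^^ i) (False, [fin_input (tape_count M) (fst p)]))
        \<le> ?b (esize p)"
      unfolding search_def[symmetric] using esize_prod[of ?s] esize_bool_le[of "fst ?s"] by linarith
  qed (intro polytime_intros)+
  then show ?thesis by (rule polytime_fst)
qed

end

locale oracle_search = tabulated_machine M table
  for M :: machine and table +
  fixes B L :: language and T :: "nat \<Rightarrow> nat" and b :: nat
    and F :: "bool list \<times> nat \<Rightarrow> bool" and P :: nat and x :: "bool list"
  assumes decides: "decides_in_time B M L T"
    and branching: "bounded_config M n r \<Longrightarrow> length (fin_moves r) \<le> b" and b_pos: "1 \<le> b"
    and time_less: "T (length x) < P" and width_le: "b ^ T (length x) \<le> P"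
    and oracle_correct: "length w \<le> length x + T (length x) \<Longrightarrow> F (w, P) \<longleftrightarrow> w \<in> B"
begin

abbreviation level :: "nat \<Rightarrow> config set" where
  "level \<equiv> reachable_in B M x"

lemma level_time: "c \<in> level i \<Longrightarrow> i \<le> T (length x)"
  using decides unfolding decides_in_time_iff by blast

lemma fin_oracle_moves_correct:
  assumes "bounded_config M n r" "F (fin_query_word r, P) \<longleftrightarrow> fin_query_word r \<in> B"
  shows "abs_config ` set (fin_oracle_moves F P r) = {c. oracle_step B M (abs_config r) c}"
proof (cases "fst r = Query")
  case True
  have "1 < length (snd r)" using assms(1) wf by (simp add: bounded_config_def wf_machine_def)
  then have "answer B (abs_config r) = abs_config (fin_answer (fin_query_word r \<in> B) r)"
    using answer_represented[OF represents_abs_config, of r B]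
    by (simp add: represents_def abs_config_def)
  then show ?thesis
    using True assms(2) by (simp add: fin_oracle_moves_def oracle_step_def abs_config_def)
next
  case False
  have "moves M (abs_config r) = abs_config ` set (fin_moves r)"
    unfolding moves_represented[OF assms(1) represents_abs_config] by (simp add: abs_config_def)
  then show ?thesis using False by (simp add: fin_oracle_moves_def oracle_step_def abs_config_def)
qed

lemma next_level:
  assumes frontier: "abs_config ` set rs = level i"
    and bounded: "\<And>r. r \<in> set rs \<Longrightarrow> bounded_config M (length x + i) r" and len: "length rs \<le> b ^ i"
    and rs': "rs' = concat (map (fin_oracle_moves F P) rs)"
  shows "abs_config ` set rs' = level (Suc i)" "length rs' \<le> b ^ Suc i" "length rs' \<le> P"
proof -
  have correct: "abs_config ` set (fin_oracle_moves F P r) = {c. oracle_step B M (abs_config r) c}"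
    if r: "r \<in> set rs" for r
  proof (rule fin_oracle_moves_correct[OF bounded[OF r]])
    have "i \<le> T (length x)" using frontier r level_time by blast
    then show "F (fin_query_word r, P) \<longleftrightarrow> fin_query_word r \<in> B"
      using length_fin_query_word_le[OF bounded[OF r]] by (intro oracle_correct) simp
  qed
  have "abs_config ` set rs' = (\<Union>r\<in>set rs. abs_config ` set (fin_oracle_moves F P r))"
    by (auto simp: rs')
  also have "\<dots> = (\<Union>c\<in>abs_config ` set rs. {d. oracle_step B M c d})"
    using correct by simp
  also have "\<dots> = level (Suc i)"
    unfolding frontier reachable_in_Suc ..
  finally show reach: "abs_config ` set rs' = level (Suc i)" .
  have "length (fin_oracle_moves F P r) \<le> b" if "r \<in> set rs" for r
    using branching[OF bounded[OF that]] b_pos by (simp add: fin_oracle_moves_def)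
  then have "length rs' \<le> b * length rs"
    unfolding rs' by (rule length_concat_map_le)
  also have "\<dots> \<le> b ^ Suc i" using len by simp
  finally show width: "length rs' \<le> b ^ Suc i" .
  show "length rs' \<le> P"
  proof (cases "rs' = []")
    case False
    then have "abs_config (hd rs') \<in> level (Suc i)"
      unfolding reach[symmetric] by simp
    then have "b ^ Suc i \<le> b ^ T (length x)"
      using level_time b_pos by (intro power_increasing)
    then show ?thesis using width width_le by linarith
  qed simp
qed

lemma search_frontier:
  "abs_config ` set (snd (search F P x i)) = level i \<and> length (snd (search F P x i)) \<le> b ^ i"
proof (induction i)
  case 0
  show ?case by (simp add: abs_fin_input reachable_in_0)
next
  case (Suc i)
  let ?rs = "snd (search F P x i)"
  let ?rs' = "concat (map (fin_oracle_moves F P) ?rs)"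
  have rs': "abs_config ` set ?rs' = level (Suc i)" "length ?rs' \<le> b ^ Suc i" "length ?rs' \<le> P"
    using next_level[of ?rs i ?rs'] Suc search_bounded by blast+
  then have "snd (search F P x (Suc i)) = ?rs'"
    by (simp add: search_Suc search_step_def)
  with rs' show ?case by simp
qed

lemma search_found:
  "fst (search F P x i) \<longleftrightarrow> (\<exists>j<i. \<exists>c\<in>level j. state c = Accept)"
proof (induction i)
  case (Suc i)
  have "(\<exists>r\<in>set (snd (search F P x i)). fst r = Accept) \<longleftrightarrow>
      (\<exists>c\<in>abs_config ` set (snd (search F P x i)). state c = Accept)"
    by (simp add: abs_config_def)
  also have "\<dots> \<longleftrightarrow> (\<exists>c\<in>level i. state c = Accept)" using search_frontier by simp
  finally show ?case using Suc by (auto simp: search_Suc search_step_def less_Suc_eq)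
qed simp

lemma search_correct: "fst (search F P x P) \<longleftrightarrow> x \<in> L"
proof -
  have "x \<in> L \<longleftrightarrow> (\<exists>j. \<exists>c\<in>level j. state c = Accept)"
    using decides unfolding decides_in_time_iff by blast
  also have "\<dots> \<longleftrightarrow> (\<exists>j<P. \<exists>c\<in>level j. state c = Accept)"
    using level_time time_less le_less_trans by blast
  finally show ?thesis by (simp add: search_found)
qed

end

lemma exponent_less: "2 ^ (n ^ c + c) < (2::nat) ^ (n ^ (c + 2) + (c + 2))"
proof -
  have "n ^ c \<le> n ^ (c + 2) + 1"
  proof (cases "n = 0")
    case False
    then have "n ^ c \<le> n ^ (c + 2)" by (intro power_increasing) linarith+
    then show ?thesis by linarith
  qed (simp add: power_0_left)
  then have "n ^ c + c < n ^ (c + 2) + (c + 2)" by simp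
  then show ?thesis by (intro power_strict_increasing) auto
qed

lemma EXP_pad_decidable:
  assumes "L \<in> EXP"
  shows "pad_decidable L"
proof -
  obtain M c where M: "wf_machine M" "deterministic M"
      "decides_in_time {} M L (\<lambda>n. 2 ^ (n ^ c + c))"
    using assms unfolding EXP_def by blast
  obtain table b where "tabulated_machine M table" using tabulated_machineE[OF M(1)] by blast
  then interpret tabulated_machine M table .
  let ?F = "\<lambda>_. False"
  show ?thesis
  proof (rule pad_decidableI)
    show "polytime (\<lambda>p. fst (search ?F (snd p) (fst p) (snd p)))"
      by (intro polytime_search polytime_intros)
    fix x :: "bool list" and P assume "2 ^ (length x ^ (c + 2) + (c + 2)) \<le> (P::nat)"
    then have "2 ^ (length x ^ c + c) < P" using exponent_less[of "length x" c] by linarith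
    then interpret oracle_search M table "{}" L "\<lambda>n. 2 ^ (n ^ c + c)" 1 ?F P x
      by unfold_locales (use M length_fin_moves_deterministic in auto)
    show "fst (search ?F (snd (x, P)) (fst (x, P)) (snd (x, P))) = (x \<in> L)"
      using search_correct by simp
  qed
qed

lemma simulation_paddingE:
  obtains e where
    "\<And>n P. 2 ^ (n ^ e + e) \<le> P \<Longrightarrow> n ^ d + d < P \<and> (2 ^ b) ^ (n ^ d + d) \<le> (P::nat)"
    "\<And>n m P. 2 ^ (n ^ e + e) \<le> P \<Longrightarrow> m \<le> n + (n ^ d + d) \<Longrightarrow> 2 ^ (m ^ c + c) \<le> (P::nat)"
proof -
  let ?T = "\<lambda>n::nat. n ^ d + d"
  let ?p = "\<lambda>n. (b + 1) * ?T n + ((n + ?T n) ^ c + c)"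
  have "poly_bound ?p" by (intro poly_bound_intros)
  then obtain e where e: "\<And>n. ?p n \<le> n ^ e + e" by (rule poly_bound_exponent) blast
  have exp_le: "2 ^ m \<le> P" if "2 ^ (n ^ e + e) \<le> (P::nat)" "m \<le> ?p n" for m n P
    using that power_increasing[of m "n ^ e + e" "2::nat"] e[of n] by linarith
  show ?thesis
  proof (rule that)
    fix n P assume P: "2 ^ (n ^ e + e) \<le> (P::nat)"
    have "2 ^ ?T n \<le> P" by (rule exp_le[OF P]) simp
    then have "?T n < P" using less_exp[of "?T n"] by linarith
    moreover have "2 ^ (b * ?T n) \<le> P" by (rule exp_le[OF P]) (simp add: algebra_simps)
    ultimately show "?T n < P \<and> (2 ^ b) ^ ?T n \<le> P" by (simp only: power_mult)
    fix m assume "m \<le> n + ?T n"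
    then have "m ^ c \<le> (n + ?T n) ^ c" by (intro power_mono) auto
    then show "2 ^ (m ^ c + c) \<le> P" by (intro exp_le[OF P]) linarith
  qed
qed

lemma NP_pad_decidable:
  assumes "pad_decidable B" "L \<in> NP_class B"
  shows "pad_decidable L"
proof -
  obtain F c where F: "polytime F" "\<And>x P. 2 ^ (length x ^ c + c) \<le> P \<Longrightarrow> F (x, P::nat) = (x \<in> B)"
    using assms(1) by (rule pad_decidableE) blast
  obtain M d where M: "wf_machine M" "decides_in_time B M L (\<lambda>n. n ^ d + d)"
    using assms(2) unfolding NP_class_def by blast
  obtain table b where table: "tabulated_machine M table" "\<And>y. length (table y) \<le> b"
    using tabulated_machineE[OF M(1)] by blast
  interpret tabulated_machine M table by (rule table(1))
  have branching: "length (fin_moves r) \<le> 2 ^ b" for r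
  proof -
    have "length (fin_moves r) \<le> b" using table(2) by (simp add: fin_moves_def)
    then show ?thesis using less_exp[of b] by linarith
  qed
  obtain e where e: "\<And>n P. 2 ^ (n ^ e + e) \<le> P \<Longrightarrow> n ^ d + d < P \<and> (2 ^ b) ^ (n ^ d + d) \<le> (P::nat)"
    "\<And>n m P. 2 ^ (n ^ e + e) \<le> P \<Longrightarrow> m \<le> n + (n ^ d + d) \<Longrightarrow> 2 ^ (m ^ c + c) \<le> (P::nat)"
    by (rule simulation_paddingE[where d = d and b = b and c = c]) blast
  show ?thesis
  proof (rule pad_decidableI)
    show "polytime (\<lambda>p. fst (search F (snd p) (fst p) (snd p)))"
      by (intro polytime_search F)
    fix x :: "bool list" and P assume P: "2 ^ (length x ^ e + e) \<le> (P::nat)"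
    interpret oracle_search M table B L "\<lambda>n. n ^ d + d" "2 ^ b" F P x
      by unfold_locales (use M(2) branching e(1)[OF P] F(2)[OF e(2)[OF P]] in simp_all)
    show "fst (search F (snd (x, P)) (fst (x, P)) (snd (x, P))) = (x \<in> L)"
      using search_correct by simp
  qed
qed

lemma EXP_iff_pad_decidable: "L \<in> EXP \<longleftrightarrow> pad_decidable L"
  using EXP_pad_decidable pad_decidable_EXP by blast

lemma EXP_complement:
  assumes "L \<in> EXP"
  shows "- L \<in> EXP"
proof -
  obtain F c where F: "polytime F" "\<And>x P. 2 ^ (length x ^ c + c) \<le> P \<Longrightarrow> F (x, P::nat) = (x \<in> L)"
    using EXP_pad_decidable[OF assms] by (rule pad_decidableE) blast
  have "polytime (\<lambda>p. \<not> F p)" by (intro polytime_intros F)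
  then have "pad_decidable (- L)" by (rule pad_decidableI[where c = c]) (simp add: F(2))
  then show ?thesis by (simp add: EXP_iff_pad_decidable)
qed

lemma NP_class_EXP_subset: "A \<in> EXP \<Longrightarrow> NP_class A \<subseteq> EXP"
  using NP_pad_decidable by (auto simp: EXP_iff_pad_decidable)

lemma Sigma_P_EXP_subset:
  assumes "A \<in> EXP"
  shows "Sigma_P k A \<subseteq> EXP"
proof (induction k)
  case 0
  have "P_class A \<subseteq> NP_class A" unfolding P_class_def NP_class_def by blast
  then show ?case using NP_class_EXP_subset[OF assms] by simp
next
  case (Suc k)
  then show ?case using NP_class_EXP_subset by auto
qed

section \<open>Replacing the empty oracle by an arbitrary one\<close>

text \<open>A machine for the empty oracle treats both answers as No; querying is kept because it blanks
  the query tape. The original state Yes, which a transition may enter without a query, is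
  renamed.\<close>

fun fresh_name :: "state \<Rightarrow> state" where
  "fresh_name Yes = Work 0"
| "fresh_name (Work n) = Work (Suc n)"
| "fresh_name q = q"

fun old_name :: "state \<Rightarrow> state" where
  "old_name Yes = No"
| "old_name (Work 0) = Yes"
| "old_name (Work (Suc n)) = Work n"
| "old_name q = q"

lemma old_fresh_name [simp]: "old_name (fresh_name q) = q"
  by (cases q) auto

lemma old_name_simps [simp]:
  "old_name q = Query \<longleftrightarrow> q = Query" "old_name q = Accept \<longleftrightarrow> q = Accept"
  "old_name q = Reject \<longleftrightarrow> q = Reject"
  by (cases q rule: old_name.cases; auto)+

definition ignore_answers :: "machine \<Rightarrow> machine" where
  "ignore_answers M = M\<lparr>states := insert Yes (fresh_name ` states M),
     delta := (\<lambda>q ss. map_prod fresh_name id ` delta M (old_name q) ss)\<rparr>"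

definition old_config :: "config \<Rightarrow> config" where
  "old_config c = c\<lparr>state := old_name (state c)\<rparr>"

lemma ignore_answers_simps [simp]:
  "tape_count (ignore_answers M) = tape_count M" "alphabet (ignore_answers M) = alphabet M"
  "states (ignore_answers M) = insert Yes (fresh_name ` states M)"
  "delta (ignore_answers M) q ss = map_prod fresh_name id ` delta M (old_name q) ss"
  by (simp_all add: ignore_answers_def)

lemma old_name_in_states:
  "wf_machine M \<Longrightarrow> q \<in> states (ignore_answers M) \<Longrightarrow> old_name q \<in> states M"
  by (auto simp: wf_machine_def)

lemma wf_ignore_answers:
  assumes wf: "wf_machine M"
  shows "wf_machine (ignore_answers M)"
proof -
  have "fresh_name ` {Start, Accept, Reject, Query, No} \<subseteq> fresh_name ` states M"
    using wf by (intro image_mono) (auto simp: wf_machine_def)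
  then have states: "{Start, Accept, Reject, Query, Yes, No} \<subseteq> states (ignore_answers M)" by auto
  show ?thesis
    unfolding wf_machine_def ignore_answers_simps(1,2)
  proof (intro conjI ballI allI impI)
    fix q ss a
    assume q: "q \<in> states (ignore_answers M)"
      and ss: "length ss = tape_count M \<and> set ss \<subseteq> alphabet M"
      and "a \<in> delta (ignore_answers M) q ss"
    then obtain a' where "a' \<in> delta M (old_name q) ss" "a = map_prod fresh_name id a'" by auto
    moreover from this(1) have "fst a' \<in> states M \<and> length (snd a') = tape_count M \<and>
        fst ` set (snd a') \<subseteq> alphabet M"
      using wf_delta[OF wf old_name_in_states[OF wf q]] ss by blast
    ultimately show "case a of (q', ws) \<Rightarrow>
        q' \<in> states (ignore_answers M) \<and> length ws = tape_count M \<and> fst ` set ws \<subseteq> alphabet M"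
      by (simp add: map_prod_def split_beta)
  qed (use wf states in \<open>simp_all add: wf_machine_def\<close>)
qed

lemma deterministic_ignore_answers:
  assumes "wf_machine M" "deterministic M"
  shows "deterministic (ignore_answers M)"
  unfolding deterministic_def ignore_answers_simps(1,2)
proof (intro ballI allI impI)
  fix q ss a a'
  assume "q \<in> states (ignore_answers M)" and ss: "length ss = tape_count M \<and> set ss \<subseteq> alphabet M"
    and a: "a \<in> delta (ignore_answers M) q ss" "a' \<in> delta (ignore_answers M) q ss"
  then have "old_name q \<in> states M" using old_name_in_states[OF assms(1)] by blast
  then have "\<forall>a\<in>delta M (old_name q) ss. \<forall>a'\<in>delta M (old_name q) ss. a = a'"
    using assms(2) ss unfolding deterministic_def by blast
  then show "a = a'" using a by auto
qed

lemma oracle_step_ignore_answers: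
  "old_config ` {d. oracle_step A (ignore_answers M) c d} = {d. oracle_step {} M (old_config c) d}"
proof (cases "state c = Query")
  case True
  then show ?thesis
    by (auto simp: oracle_step_def old_config_def answer_def query_word_def)
next
  case False
  have "old_config (perform (map_prod fresh_name id a) c) = perform a (old_config c)" for a
    by (cases a) (simp add: old_config_def perform_def)
  then have "old_config ` moves (ignore_answers M) c = moves M (old_config c)"
    by (simp add: moves_def image_image) (simp add: old_config_def)
  then show ?thesis using False by (simp add: oracle_step_def) (simp add: old_config_def)
qed

lemma reachable_in_ignore_answers:
  "reachable_in {} M x m = old_config ` reachable_in A (ignore_answers M) x m"
proof (induction m)
  case 0
  show ?case by (simp add: reachable_in_0 old_config_def input_config_def)
next
  case (Suc m)
  show ?case
    by (simp add: reachable_in_Suc Suc image_UN oracle_step_ignore_answers)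
qed

lemma decides_ignore_answers:
  assumes "decides_in_time {} M L T"
  shows "decides_in_time A (ignore_answers M) L T"
proof -
  have "state (old_config c) = Accept \<longleftrightarrow> state c = Accept" for c by (simp add: old_config_def)
  then show ?thesis
    using assms unfolding decides_in_time_iff reachable_in_ignore_answers[where A = A]
    by (simp only: ball_simps bex_simps) simp
qed

lemma Sigma_P_empty_subset: "Sigma_P k {} \<subseteq> Sigma_P k A"
proof (induction k)
  case 0
  have "P_class {} \<subseteq> P_class A"
    using wf_ignore_answers deterministic_ignore_answers decides_ignore_answers
    unfolding P_class_def by blast
  then show ?case by simp
next
  case (Suc k)
  then show ?case by auto
qed

section \<open>Playing against a betting game\<close>

lemma p2_boundedE:
  assumes "p2_bounded t"
  obtains c where "\<And>n. t (2 ^ n) \<le> 2 ^ (n ^ c + c)"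
proof -
  obtain c :: nat where c: "\<And>N. 1 \<le> N \<Longrightarrow> real (t N) \<le> 2 powr (log 2 (real N) ^ c + real c)"
    using assms unfolding p2_bounded_def by blast
  have "t (2 ^ n) \<le> 2 ^ (n ^ c + c)" for n
  proof -
    have "log 2 (real (2 ^ n)) = real n" by (simp add: log_nat_power)
    then have "real (t (2 ^ n)) \<le> 2 powr (real (n ^ c + c))" using c[of "2 ^ n"] by simp
    also have "\<dots> = real (2 ^ (n ^ c + c))" by (subst powr_realpow) simp_all
    finally show ?thesis by (simp only: of_nat_le_iff)
  qed
  then show ?thesis using that by blast
qed

definition bits_of :: "symbol list \<Rightarrow> bool list" where
  "bits_of ss = map (\<lambda>s. s = Bit True) ss"

definition fraction_symbols :: "fraction \<Rightarrow> symbol list" where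
  "fraction_symbols p = map Bit (fst p) @ Sep # map Bit (snd p)"

lemma nat_of_symbols_eq: "nat_of_symbols ss = nat_of_bits (bits_of ss)"
  by (induction ss) (simp_all add: nat_of_symbols_def bits_of_def)

lemma rat_symbols_eq: "rat_symbols r = fraction_symbols (fraction_of r)"
  by (simp add: rat_symbols_def fraction_symbols_def fraction_of_def case_prod_beta)

lemma length_fraction_symbols [simp]:
  "length (fraction_symbols p) = length (fst p) + length (snd p) + 1"
  by (simp add: fraction_symbols_def)

lemma fraction_symbols_in_alphabet:
  "wf_machine M \<Longrightarrow> set (fraction_symbols p) \<subseteq> alphabet M"
  by (auto simp: fraction_symbols_def Bit_in_alphabet) (simp add: wf_machine_def)

subsection \<open>The polynomial-time game simulator\<close>

text \<open>The fraction is the current capital.\<close>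

type_synonym fin_game = "fin_config \<times> fraction"

definition fin_bet :: "fin_config \<Rightarrow> symbol list" where
  "fin_bet r = fin_block (\<lambda>s. s \<noteq> Blank) (nth_default fin_blank (snd r) 2)"

definition fin_bet_sign :: "fin_config \<Rightarrow> bool" where
  "fin_bet_sign r = (case fin_bet r of [] \<Rightarrow> False | s # _ \<Rightarrow> s = Bit True)"

definition fin_bet_amount :: "fin_config \<Rightarrow> fraction" where
  "fin_bet_amount r = (bits_of (takeWhile (\<lambda>s. s \<noteq> Sep) (tl (fin_bet r))),
     bits_of (tl (dropWhile (\<lambda>s. s \<noteq> Sep) (tl (fin_bet r)))))"

definition fin_settle :: "fin_game \<Rightarrow> fin_game" where
  "fin_settle g = (let C = diff_fractions (snd g) (fin_bet_amount (fst g)) in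
     ((if fin_bet_sign (fst g) then No else Yes,
       (snd (fst g))[0 := fin_tape_of (fraction_symbols C), 1 := fin_blank, 2 := fin_blank]), C))"

lemma polytime_fin_bet [polytime_intros]: "polytime_on D f \<Longrightarrow> polytime_on D (\<lambda>x. fin_bet (f x))"
  unfolding fin_bet_def by (intro polytime_fin_block polytime_intros)

lemma polytime_fin_bet_sign [polytime_intros]:
  "polytime_on D f \<Longrightarrow> polytime_on D (\<lambda>x. fin_bet_sign (f x))"
  unfolding fin_bet_sign_def by (intro polytime_intros)

lemma polytime_fin_bet_amount [polytime_intros]:
  "polytime_on D f \<Longrightarrow> polytime_on D (\<lambda>x. fin_bet_amount (f x))"
  unfolding fin_bet_amount_def bits_of_def by (intro polytime_intros)

lemma polytime_fin_settle [polytime_intros]: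
  "polytime_on D f \<Longrightarrow> polytime_on D (\<lambda>x. fin_settle (f x))"
  unfolding fin_settle_def fraction_symbols_def Let_def by (intro polytime_intros)

lemma bet_represented:
  assumes rep: "represents c r" and len: "2 < length (snd r)" and wfb: "bet_well_formed c"
  shows "fin_bet_sign r = bet_sign c" "rat_of_bits (fin_bet_amount r) = bet_amount c"
    "0 < nat_of_bits (snd (fin_bet_amount r))"
    "length (snd (fin_bet_amount r)) \<le> length (fst (snd r ! 2))"
proof -
  have tape: "nth_default fin_blank (snd r) 2 = snd r ! 2" "tapes c ! 2 = abs_tape (snd r ! 2)"
    using rep len by (simp_all add: nth_default_nth represents_def)
  have bet: "tape_contents (tapes c ! 2) = fin_bet r"
    unfolding tape_contents_def fin_bet_def tape by (rule block_abs_tape) simp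
  obtain b ns ds where contents: "fin_bet r = Bit b # map Bit ns @ Sep # map Bit ds"
    and denom: "nat_of_symbols (map Bit ds) > 0"
    using wfb unfolding bet_well_formed_def bet by blast
  show "fin_bet_sign r = bet_sign c" by (simp add: fin_bet_sign_def bet_sign_def bet contents)
  show "rat_of_bits (fin_bet_amount r) = bet_amount c"
    by (simp add: rat_of_bits_def fin_bet_amount_def bet_amount_def rat_of_symbols_def bet
        nat_of_symbols_eq)
  have drop: "dropWhile (\<lambda>s. s \<noteq> Sep) (tl (fin_bet r)) = Sep # map Bit ds"
    unfolding contents by (simp add: dropWhile_append)
  then show "0 < nat_of_bits (snd (fin_bet_amount r))"
    using denom by (simp add: fin_bet_amount_def nat_of_symbols_eq)
  have "length (snd (fin_bet_amount r)) \<le> length (fin_bet r)"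
    by (simp add: fin_bet_amount_def drop bits_of_def) (simp add: contents)
  also have "\<dots> \<le> length (fst (snd r ! 2))"
    unfolding fin_bet_def tape by (rule length_fin_block_le)
  finally show "length (snd (fin_bet_amount r)) \<le> length (fst (snd r ! 2))" .
qed

locale betting = tabulated_machine G table for G :: betting_game and table +
  assumes game: "is_betting_game G"
begin

lemma game_deterministic: "deterministic G" and three_tapes: "3 \<le> tape_count G"
  and initial_capital_pos: "initial_capital G > 0"
  using game by (auto simp: is_betting_game_def)

subsection \<open>The language that makes the game lose every bet\<close>

text \<open>A single step consults the language only on the current query.\<close>

definition losing_step :: "game_config \<Rightarrow> game_config" where
  "losing_step c = game_step (if bet_sign c then {} else UNIV) G c"

definition losing_play :: "nat \<Rightarrow> game_config" where
  "losing_play m = (losing_step ^^ m) (game_start G)"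

definition bets_against :: "bool list \<Rightarrow> game_config \<Rightarrow> bool" where
  "bets_against w c \<longleftrightarrow> state c = Query \<and> query_word c = w \<and> \<not> bet_sign c"

definition losing_language :: language where
  "losing_language = {w. \<exists>m. bets_against w (losing_play m)}"

lemma losing_play_0 [simp]: "losing_play 0 = game_start G"
  by (simp add: losing_play_def)

lemma losing_play_Suc: "losing_play (Suc m) = losing_step (losing_play m)"
  by (simp add: losing_play_def)

lemma game_step_eq_losing_step:
  assumes "state c = Query \<Longrightarrow> query_word c \<in> B \<longleftrightarrow> \<not> bet_sign c"
  shows "game_step B G c = losing_step c"
  using assms
  by (auto simp: losing_step_def game_step_def settle_def answer_def new_capital_def Let_def)

lemma play_eq_losing_play:
  assumes "\<And>i. i < j \<Longrightarrow> state (losing_play i) = Query \<Longrightarrow>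
    query_word (losing_play i) \<in> B \<longleftrightarrow> \<not> bet_sign (losing_play i)"
  shows "i \<le> j \<Longrightarrow> play B G i = losing_play i"
proof (induction i)
  case 0
  show ?case by (simp add: play_def)
next
  case (Suc i)
  then have "play B G (Suc i) = game_step B G (losing_play i)" by (simp add: play_def)
  also have "\<dots> = losing_step (losing_play i)"
    using Suc.prems assms by (intro game_step_eq_losing_step) simp
  finally show ?case by (simp add: losing_play_Suc)
qed

text \<open>Up to a given step the queries are distinct by induction, so some language answers all of them
  so that the bet is lost; against that language the game must not repeat a query.\<close>

lemma losing_play_query_distinct:
  assumes "m < m'" "state (losing_play m) = Query" "state (losing_play m') = Query"
  shows "query_word (losing_play m) \<noteq> query_word (losing_play m')"
  using assms
proof (induction m' arbitrary: m rule: less_induct)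
  case (less m')
  define B where "B = {w. \<exists>m<m'. bets_against w (losing_play m)}"
  have "i = l" if "i < m'" "l < m'" "state (losing_play i) = Query" "state (losing_play l) = Query"
    "query_word (losing_play i) = query_word (losing_play l)" for i l
    using less.IH that by (metis nat_neq_iff)
  then have "query_word (losing_play i) \<in> B \<longleftrightarrow> \<not> bet_sign (losing_play i)"
    if "i < m'" "state (losing_play i) = Query" for i
    using that unfolding B_def bets_against_def by blast
  then have "play B G i = losing_play i" if "i \<le> m'" for i using play_eq_losing_play that by blast
  then show ?case
    using game less.prems unfolding is_betting_game_def by (metis less_imp_le order_refl)
qed

lemma play_losing_language: "play losing_language G m = losing_play m"
proof (rule play_eq_losing_play[OF _ order_refl])
  fix i assume i: "state (losing_play i) = Query"
  have "j = i" if "state (losing_play j) = Query"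
    "query_word (losing_play j) = query_word (losing_play i)" for j
    using losing_play_query_distinct i that by (metis nat_neq_iff)
  then show "query_word (losing_play i) \<in> losing_language \<longleftrightarrow> \<not> bet_sign (losing_play i)"
    using i unfolding losing_language_def bets_against_def by blast
qed

lemma losing_play_bet:
  assumes "state (losing_play m) = Query"
  shows "bet_well_formed (losing_play m)" "0 \<le> bet_amount (losing_play m)"
    "bet_amount (losing_play m) \<le> capital (losing_play m)"
  using game assms play_losing_language unfolding is_betting_game_def by metis+

lemma losing_step_query:
  assumes "state c = Query"
  shows "losing_step c = c\<lparr>state := (if bet_sign c then No else Yes),
    tapes := (tapes c)[0 := tape_of (rat_symbols (capital c - bet_amount c)),
      1 := blank_tape, 2 := blank_tape],
    capital := capital c - bet_amount c,
    elapsed := elapsed c + 1 + length (rat_symbols (capital c - bet_amount c))\<rparr>"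
  using assms
  by (simp add: losing_step_def game_step_def settle_def answer_def new_capital_def Let_def)

lemma losing_step_nonquery:
  assumes "state c \<noteq> Query"
  shows "losing_step c =
    (if moves G c = {} then c else (the_elem (moves G c))\<lparr>elapsed := elapsed c + 1\<rparr>)"
  using assms by (simp add: losing_step_def game_step_def)

lemma elapsed_losing_play_ge:
  "m \<le> elapsed (losing_play m) \<or> (state (losing_play m) \<noteq> Query \<and> moves G (losing_play m) = {})"
proof (induction m)
  case (Suc m)
  then show ?case
    by (cases "state (losing_play m) = Query")
      (auto simp: losing_play_Suc losing_step_query losing_step_nonquery)
qed simp

subsection \<open>Simulating the losing play\<close>

definition fin_game_step :: "fin_game \<Rightarrow> fin_game" where
  "fin_game_step g = (if fst (fst g) = Query then fin_settle g
     else (case fin_moves (fst g) of [] \<Rightarrow> g | r # _ \<Rightarrow> (r, snd g)))"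

definition fin_start :: fin_game where
  "fin_start = ((Start, fin_tape_of (fraction_symbols (fraction_of (initial_capital G))) #
     replicate (tape_count G - 1) fin_blank), fraction_of (initial_capital G))"

definition fin_play :: "nat \<Rightarrow> fin_game" where
  "fin_play m = (fin_game_step ^^ m) fin_start"

definition capital_length :: "nat \<Rightarrow> nat" where
  "capital_length m = length (fst (fraction_of (initial_capital G))) +
     length (snd (fraction_of (initial_capital G))) + m * m"

definition tape_length :: "nat \<Rightarrow> nat" where
  "tape_length m = 2 * capital_length m + 1 + m"

text \<open>The bet tape is blanked in every round and hence is short, which keeps the length of the
  capital from growing faster than quadratically.\<close>

definition tracks :: "nat \<Rightarrow> game_config \<Rightarrow> fin_game \<Rightarrow> bool" where
  "tracks m c g \<longleftrightarrow> represents c (fst g) \<and>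
     0 \<le> capital c \<and> snd g = fraction_of (capital c) \<and>
     length (fst (snd g)) \<le> capital_length m \<and> length (snd (snd g)) \<le> capital_length m \<and>
     bounded_config G (tape_length m) (fst g) \<and> bounded_tape (alphabet G) m (snd (fst g) ! 2)"

lemma capital_length_mono: "m \<le> n \<Longrightarrow> capital_length m \<le> capital_length n"
  by (simp add: capital_length_def mult_le_mono)

lemma capital_length_Suc: "capital_length m + m \<le> capital_length (Suc m)"
  by (simp add: capital_length_def)

lemma tape_length_mono: "m \<le> n \<Longrightarrow> tape_length m \<le> tape_length n"
  using capital_length_mono[of m n] by (simp add: tape_length_def)

lemma tape_length_Suc: "Suc (tape_length m) \<le> tape_length (Suc m)"
  using capital_length_mono[of m "Suc m"] by (simp add: tape_length_def)

lemma tracks_start: "tracks 0 (losing_play 0) fin_start"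
proof -
  have "bounded_tape (alphabet G) (tape_length 0)
      (fin_tape_of (fraction_symbols (fraction_of (initial_capital G))))"
    by (rule bounded_tape_mono[OF bounded_fin_tape_of[OF fraction_symbols_in_alphabet[OF wf]]])
      (simp add: tape_length_def capital_length_def)
  moreover have "Start \<in> states G" using wf by (simp add: wf_machine_def)
  ultimately have "bounded_config G (tape_length 0) (fst fin_start)"
    using three_tapes by (auto simp: bounded_config_def fin_start_def)
  moreover have "snd (fst fin_start) ! 2 = fin_blank"
    using three_tapes by (simp add: fin_start_def nth_Cons numeral_2_eq_2)
  moreover have "represents (game_start G) (fst fin_start)"
    by (simp add: represents_def game_start_def fin_start_def abs_fin_tape_of rat_symbols_eq)
  ultimately show ?thesis
    using initial_capital_pos
    by (simp add: tracks_def game_start_def) (simp add: fin_start_def capital_length_def)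
qed

lemma tracks_length: "tracks m c g \<Longrightarrow> 2 < length (snd (fst g))"
  using three_tapes by (simp add: tracks_def bounded_config_def)

lemma tracks_capital_length:
  assumes "tracks m c g"
  shows "length (fst (snd g)) \<le> capital_length m" "length (snd (snd g)) \<le> capital_length m"
  using assms unfolding tracks_def by blast+

lemma tracks_bet:
  assumes "tracks m c g" "bet_well_formed c"
  shows "fin_bet_sign (fst g) = bet_sign c" "rat_of_bits (fin_bet_amount (fst g)) = bet_amount c"
    "0 < nat_of_bits (snd (fin_bet_amount (fst g)))" "length (snd (fin_bet_amount (fst g))) \<le> m"
proof -
  have rep: "represents c (fst g)" using assms(1) by (simp add: tracks_def)
  note bet = bet_represented[OF rep tracks_length[OF assms(1)] assms(2)]
  show "fin_bet_sign (fst g) = bet_sign c" "rat_of_bits (fin_bet_amount (fst g)) = bet_amount c"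
    "0 < nat_of_bits (snd (fin_bet_amount (fst g)))" by (rule bet)+
  show "length (snd (fin_bet_amount (fst g))) \<le> m"
    using bet(4) assms(1) by (simp add: tracks_def bounded_tape_def)
qed

lemma capital_after_loss:
  assumes tracks: "tracks m c g" and "bet_well_formed c" "bet_amount c \<le> capital c"
    and C: "C = diff_fractions (snd g) (fin_bet_amount (fst g))"
  shows "C = fraction_of (capital c - bet_amount c)"
    "length (fst C) \<le> capital_length (Suc m)" "length (snd C) \<le> capital_length (Suc m)"
proof -
  note bet = tracks_bet[OF tracks assms(2)]
  have cap: "rat_of_bits (snd g) = capital c" and pos: "0 < nat_of_bits (snd (snd g))"
    using tracks by (simp_all add: tracks_def rat_of_bits_fraction_of)
  then have le: "rat_of_bits (fin_bet_amount (fst g)) \<le> rat_of_bits (snd g)"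
    using assms(3) bet(2) by simp
  show "C = fraction_of (capital c - bet_amount c)"
    unfolding C diff_fractions_eq[OF pos bet(3) le] bet(2) cap ..
  show "length (fst C) \<le> capital_length (Suc m)" "length (snd C) \<le> capital_length (Suc m)"
    using length_diff_fractions_le[OF pos bet(3) le] bet(4) tracks_capital_length[OF tracks]
      capital_length_Suc[of m] unfolding C by linarith+
qed

lemma bounded_fin_settle:
  assumes "bounded_config G n (fst g)" "length (fraction_symbols (snd (fin_settle g))) \<le> n"
  shows "bounded_config G n (fst (fin_settle g))"
proof -
  let ?C = "snd (fin_settle g)"
  have settled: "fst (fin_settle g) = (if fin_bet_sign (fst g) then No else Yes,
      (snd (fst g))[0 := fin_tape_of (fraction_symbols ?C), 1 := fin_blank, 2 := fin_blank])"
    by (simp add: fin_settle_def Let_def)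
  have "bounded_tape (alphabet G) n (fin_tape_of (fraction_symbols ?C))"
    by (rule bounded_tape_mono[OF
          bounded_fin_tape_of[OF fraction_symbols_in_alphabet[OF wf]] assms(2)])
  then have "set (snd (fst (fin_settle g))) \<subseteq> {t. bounded_tape (alphabet G) n t}"
    using assms(1) unfolding settled snd_conv
    by (intro set_update_subsetI) (auto simp: bounded_config_def)
  then show ?thesis
    using assms(1) wf by (auto simp: bounded_config_def wf_machine_def settled)
qed

lemma tracks_query:
  assumes tracks: "tracks m (losing_play m) g" and query: "state (losing_play m) = Query"
  shows "tracks (Suc m) (losing_play (Suc m)) (fin_settle g)"
proof -
  let ?c = "losing_play m" and ?C = "snd (fin_settle g)"
  note bet = losing_play_bet[OF query]
  have C: "?C = diff_fractions (snd g) (fin_bet_amount (fst g))"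
    by (simp add: fin_settle_def Let_def)
  note capital = capital_after_loss[OF tracks bet(1,3) C]
  note next_config = losing_play_Suc[of m, unfolded losing_step_query[OF query]]
  have "represents (losing_play (Suc m)) (fst (fin_settle g))"
    using tracks tracks_bet(1)[OF tracks bet(1)] unfolding next_config
    by (simp add: represents_def tracks_def fin_settle_def Let_def map_update abs_fin_tape_of
        rat_symbols_eq capital(1)[unfolded C, symmetric])
  moreover have "bounded_config G (tape_length (Suc m)) (fst (fin_settle g))"
  proof (rule bounded_fin_settle)
    show "bounded_config G (tape_length (Suc m)) (fst g)"
      by (rule bounded_config_mono[OF _ tape_length_mono[of m]])
        (use tracks in \<open>simp_all add: tracks_def\<close>)
    show "length (fraction_symbols ?C) \<le> tape_length (Suc m)"
      using capital(2,3) by (simp add: tape_length_def)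
  qed
  moreover have "snd (fst (fin_settle g)) ! 2 = fin_blank"
    using tracks_length[OF tracks] by (simp add: fin_settle_def Let_def)
  moreover have "capital (losing_play (Suc m)) = capital ?c - bet_amount ?c"
    by (simp add: next_config)
  ultimately show ?thesis using capital bet(3) by (simp add: tracks_def)
qed

lemma losing_step_represented:
  assumes nonquery: "state c \<noteq> Query" and rep: "represents c r" and bounded: "bounded_config G n r"
  shows "losing_step c = (case fin_moves r of [] \<Rightarrow> c
    | r' # _ \<Rightarrow> c\<lparr>state := fst r', tapes := map abs_tape (snd r'), elapsed := elapsed c + 1\<rparr>)"
proof (cases "fin_moves r")
  case Nil
  then show ?thesis
    using moves_represented[OF bounded rep] by (simp add: losing_step_nonquery[OF nonquery])
next
  case (Cons r' rs)
  then have "rs = []"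
    using length_fin_moves_deterministic[OF game_deterministic bounded] by simp
  then have "moves G c = {c\<lparr>state := fst r', tapes := map abs_tape (snd r')\<rparr>}"
    using moves_represented[OF bounded rep] Cons by simp
  then show ?thesis by (simp add: losing_step_nonquery[OF nonquery] Cons)
qed

lemma tracks_nonquery:
  assumes tracks: "tracks m (losing_play m) g" and nonquery: "state (losing_play m) \<noteq> Query"
  shows "tracks (Suc m) (losing_play (Suc m)) (fin_game_step g) \<and>
    capital (losing_play (Suc m)) = capital (losing_play m)"
proof -
  let ?c = "losing_play m"
  have rep: "represents ?c (fst g)" and bounded: "bounded_config G (tape_length m) (fst g)"
    and bet_tape: "bounded_tape (alphabet G) m (snd (fst g) ! 2)"
    using tracks by (simp_all add: tracks_def)
  have no_query: "fst (fst g) \<noteq> Query" using nonquery rep by (simp add: represents_def)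
  have lengths: "length (fst (snd g)) \<le> capital_length (Suc m)"
    "length (snd (snd g)) \<le> capital_length (Suc m)"
    using tracks_capital_length[OF tracks] capital_length_mono[of m "Suc m"] by simp_all
  note next_config = losing_play_Suc[of m,
      unfolded losing_step_represented[OF nonquery rep bounded]]
  show ?thesis
  proof (cases "fin_moves (fst g)")
    case Nil
    then have "losing_play (Suc m) = ?c" using next_config by simp
    moreover have "bounded_config G (tape_length (Suc m)) (fst g)"
      by (rule bounded_config_mono[OF bounded]) (simp add: tape_length_mono)
    moreover have "bounded_tape (alphabet G) (Suc m) (snd (fst g) ! 2)"
      by (rule bounded_tape_mono[OF bet_tape]) simp
    ultimately show ?thesis
      using tracks lengths no_query Nil by (simp add: tracks_def fin_game_step_def)
  next
    case (Cons r rs)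
    then have r: "r \<in> set (fin_moves (fst g))" by simp
    have "bounded_config G (tape_length (Suc m)) r"
      by (rule bounded_config_mono[OF bounded_fin_moves[OF bounded r] tape_length_Suc])
    moreover have "bounded_tape (alphabet G) (Suc m) (snd r ! 2)"
      by (rule bounded_tape_fin_moves_nth[OF bounded r _ bet_tape]) (use three_tapes in simp)
    ultimately show ?thesis
      using tracks lengths no_query Cons
      by (simp add: tracks_def fin_game_step_def next_config represents_def)
  qed
qed

lemma tracks_losing_play: "tracks m (losing_play m) (fin_play m)"
proof (induction m)
  case 0
  show ?case using tracks_start by (simp add: fin_play_def)
next
  case (Suc m)
  have step: "fin_play (Suc m) = fin_game_step (fin_play m)" by (simp add: fin_play_def)
  show ?case
  proof (cases "state (losing_play m) = Query")
    case True
    then have "fst (fst (fin_play m)) = Query" using Suc by (simp add: tracks_def represents_def)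
    then show ?thesis using tracks_query[OF Suc True] by (simp add: step fin_game_step_def)
  next
    case False
    then show ?thesis using tracks_nonquery[OF Suc] by (simp add: step)
  qed
qed

lemma capital_losing_play_Suc_le: "capital (losing_play (Suc m)) \<le> capital (losing_play m)"
proof (cases "state (losing_play m) = Query")
  case True
  then show ?thesis
    using losing_play_bet(2)[OF True] by (simp add: losing_play_Suc losing_step_query)
next
  case False
  then show ?thesis using tracks_nonquery[OF tracks_losing_play] by simp
qed

lemma not_succeeds_on_losing_language: "\<not> succeeds_on G losing_language"
proof -
  have "capital (losing_play m) \<le> capital (losing_play 0)" for m
    using lift_Suc_antimono_le[of "\<lambda>m. capital (losing_play m)" 0 m] capital_losing_play_Suc_le
    by simp
  then show ?thesis unfolding succeeds_on_def play_losing_language by (auto intro!: bdd_aboveI)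
qed

subsection \<open>The losing language is in EXP\<close>

definition fin_bets_against :: "bool list \<Rightarrow> fin_config \<Rightarrow> bool" where
  "fin_bets_against w r \<longleftrightarrow> fst r = Query \<and> fin_query_word r = w \<and> \<not> fin_bet_sign r"

definition watch_step :: "bool list \<Rightarrow> bool \<times> fin_game \<Rightarrow> bool \<times> fin_game" where
  "watch_step w s = (fst s \<or> fin_bets_against w (fst (snd s)), fin_game_step (snd s))"

lemma watch_steps:
  "(watch_step w ^^ i) (False, fin_start) =
   ((\<exists>m<i. fin_bets_against w (fst (fin_play m))), fin_play i)"
  by (induction i) (auto simp: watch_step_def fin_play_def less_Suc_eq)

lemma polytime_fin_game_step: "polytime fin_game_step"
  unfolding fin_game_step_def by (intro polytime_intros polytime_fin_moves)

lemma esize_fin_play_le: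
  assumes q: "poly_bound q" "\<And>n r. bounded_config G n r \<Longrightarrow> esize r \<le> q n" and "i \<le> n"
  shows "esize (fin_play i) \<le>
    Suc (q (tape_length n) + Suc (2 * capital_length n + 2 * capital_length n))"
proof -
  let ?g = "fin_play i"
  have tracks: "tracks i (losing_play i) ?g" by (rule tracks_losing_play)
  have "esize (fst ?g) \<le> q (tape_length i)" using tracks q(2) by (simp add: tracks_def)
  also have "\<dots> \<le> q (tape_length n)" by (rule poly_bound_mono[OF q(1) tape_length_mono[OF assms(3)]])
  finally have "esize (fst ?g) \<le> q (tape_length n)" .
  moreover have "esize (fst (snd ?g)) \<le> 2 * capital_length n"
    "esize (snd (snd ?g)) \<le> 2 * capital_length n"
    using tracks_capital_length[OF tracks] capital_length_mono[OF assms(3)]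
      esize_bits_le[of "fst (snd ?g)"] esize_bits_le[of "snd (snd ?g)"] by linarith+
  ultimately show ?thesis using esize_prod[of ?g] esize_prod[of "snd ?g"] by linarith
qed

lemma polytime_watch: "polytime (\<lambda>p. fst ((watch_step (fst p) ^^ snd p) (False, fin_start)))"
proof -
  obtain q where q: "poly_bound q" "\<And>n r. bounded_config G n r \<Longrightarrow> esize r \<le> q n"
    using bounded_config_esizeE[OF wf] by blast
  have "polytime (\<lambda>p. (watch_step (fst p) ^^ snd p) (False, fin_start))"
  proof (rule polytime_funpow[where f = "\<lambda>p. watch_step (fst p)"])
    show "polytime (\<lambda>p. watch_step (fst (fst p)) (snd p))"
      for p :: "(bool list \<times> nat) \<times> bool \<times> fin_game"
      unfolding watch_step_def fin_bets_against_def
      by (intro polytime_intros polytime_comp[OF polytime_fin_game_step])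
    let ?b = "\<lambda>n. Suc (q (tape_length n) + Suc (2 * capital_length n + 2 * capital_length n))"
    have "poly_bound tape_length" "poly_bound capital_length"
      unfolding tape_length_def capital_length_def by (intro poly_bound_intros)+
    then show "poly_bound (\<lambda>n. Suc (1 + ?b n))"
      by (intro poly_bound_intros poly_bound_comp[OF q(1)])
    fix p :: "bool list \<times> nat" and i assume "i \<le> snd p"
    then have "i \<le> esize p" using esize_prod[of p] by simp
    from esize_fin_play_le[OF q this]
    show "esize ((watch_step (fst p) ^^ i) (False, fin_start)) \<le> Suc (1 + ?b (esize p))"
      unfolding watch_steps esize_Pair using esize_bool_le
      by (intro Suc_le_mono[THEN iffD2] add_mono)
  qed (intro polytime_intros)+
  then show ?thesis by (rule polytime_fst)
qed

lemma fin_bets_against_fin_play: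
  "fin_bets_against w (fst (fin_play m)) \<longleftrightarrow> bets_against w (losing_play m)"
proof -
  have tracks: "tracks m (losing_play m) (fin_play m)" by (rule tracks_losing_play)
  then have rep: "represents (losing_play m) (fst (fin_play m))" by (simp add: tracks_def)
  then have "state (losing_play m) = fst (fst (fin_play m))" by (simp add: represents_def)
  moreover have "query_word (losing_play m) = fin_query_word (fst (fin_play m))"
    using query_word_represented[OF rep] tracks_length[OF tracks] by simp
  moreover have "bet_sign (losing_play m) = fin_bet_sign (fst (fin_play m))"
    if "state (losing_play m) = Query"
    using tracks_bet(1)[OF tracks losing_play_bet(1)[OF that]] by simp
  ultimately show ?thesis unfolding fin_bets_against_def bets_against_def by auto
qed

lemma losing_query_time:
  assumes "runs_in_time G t" "state (losing_play m) = Query"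
  shows "m \<le> t (2 ^ length (query_word (losing_play m)))"
proof -
  have "m \<le> elapsed (losing_play m)" using elapsed_losing_play_ge[of m] assms(2) by blast
  also have "\<dots> \<le> t (2 ^ length (query_word (losing_play m)))"
    using assms play_losing_language unfolding runs_in_time_def by metis
  finally show ?thesis .
qed

lemma losing_language_EXP:
  assumes "p2_bounded t" "runs_in_time G t"
  shows "losing_language \<in> EXP"
proof -
  obtain c where c: "\<And>n. t (2 ^ n) \<le> 2 ^ (n ^ c + c)"
    using assms(1) by (rule p2_boundedE) blast
  have "pad_decidable losing_language"
  proof (rule pad_decidableI[OF polytime_watch])
    fix x :: "bool list" and P assume P: "2 ^ (length x ^ (c + 2) + (c + 2)) \<le> (P::nat)"
    have "fst ((watch_step (fst (x, P)) ^^ snd (x, P)) (False, fin_start)) \<longleftrightarrow>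
        (\<exists>m<P. bets_against x (losing_play m))"
      by (simp add: watch_steps fin_bets_against_fin_play)
    also have "\<dots> \<longleftrightarrow> x \<in> losing_language"
    proof -
      have "m < P" if "bets_against x (losing_play m)" for m
        using losing_query_time[OF assms(2), of m] that c[of "length x"]
          exponent_less[of "length x" c] P
        unfolding bets_against_def by auto
      then show ?thesis unfolding losing_language_def by blast
    qed
    finally show "fst ((watch_step (fst (x, P)) ^^ snd (x, P)) (False, fin_start)) =
        (x \<in> losing_language)" .
  qed
  then show ?thesis by (rule pad_decidable_EXP)
qed

end

theorem theorem4p8:
  fixes k :: nat
  assumes "k > 0"
    and "p2_betting_game_measure_zero {A. Sigma_P k A = Pi_P k A}"
  shows "Sigma_P k {} \<noteq> EXP"
proof
  assume collapse: "Sigma_P k {} = EXP"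
  obtain G t where G: "is_betting_game G" "p2_bounded t" "runs_in_time G t"
    and succeeds: "\<And>A. Sigma_P k A = Pi_P k A \<Longrightarrow> succeeds_on G A"
    using assms(2) unfolding p2_betting_game_measure_zero_def p2_betting_game_def by blast
  have "wf_machine G" using G(1) by (simp add: is_betting_game_def)
  then obtain table where "tabulated_machine G table"
    by (rule tabulated_machineE)
  then interpret betting G table
    by (intro betting.intro betting_axioms.intro G(1))
  have "losing_language \<in> EXP" by (rule losing_language_EXP[OF G(2,3)])
  then have Sigma: "Sigma_P k losing_language = EXP"
    using Sigma_P_EXP_subset Sigma_P_empty_subset collapse by blast
  moreover have "Pi_P k losing_language = EXP"
    unfolding Pi_P_def Sigma using EXP_complement by (auto intro: exI[of _ "- _"])
  ultimately show False using succeeds not_succeeds_on_losing_language by simp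
qed

end
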